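(* Let $X$ be a pseudomanifold (of dimension $3$) with a conical singularity such that the cross section of the cone is the two-dimensional torus $T=S^1\times S^1$, where $S^1$ is the circle of radius one and $T$ carries the product metric $d\theta^2+d\varphi^2$, and fix a rank one orthogonal representation $\rho$ of $\pi_1(X)$. Then there is a non-trivial contribution from the singularity in the quotient of the intersection Reidemeister metric and the Ray–Singer metric on the determinant line of the intersection homology with middle perversity, that is, $$A_{\rm comb,\mathfrak m}(T)+A_{\rm analy}(T)\neq 0 .$$
   Context: Setting. For a closed Riemannian manifold $(W,\tilde g)$ the finite metric cone is $C_{0,l}(W)=([0,l]\times W)/(\{0\}\times W)$, $l>0$, with metric $dr^2+r^2\tilde g$ for $r>0$. A closed pseudomanifold $X$ has a conical singularity with cross section $W$ if $X=M\cup C_{0,l}(W)$, where $M$ is a smooth Riemannian manifold with boundary $\partial M=W$, glued along the boundary, the metric being conical on $C_{0,l}(W)$. Let $\rho:\pi_1(X)\to O(\mathbb R^k)$ be an orthogonal representation with flat bundle $E_\rho$ over $X$; here $\rho$ has rank one ($k=1$). Since $W$ bounds a cone in $X$, $E_\rho|_W$ is the trivial real line bundle. The Ray–Singer metric $\|\cdot\|^{\rm RS}$ (analytic torsion) and the intersection Reidemeister metric $\|\cdot\|^{\rm IR}$ (intersection Reidemeister torsion) are metrics on the determinant line $\det I^{\mathfrak m}H_\bullet(X;E_\rho)$ of the intersection homology with middle perversity $\mathfrak m$. The following is a known theorem, which may be used: $$\log\frac{\|\cdot\|^{\rm RS}_{\det I^{\mathfrak m}H_\bullet(X;E_\rho)}}{\|\cdot\|^{\rm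 IR}_{\det I^{\mathfrak m}H_\bullet(X;E_\rho)}}=A_{\rm comb,\mathfrak m}(W)+A_{\rm analy}(W);$$ the right-hand side is the contribution from the singularity. For $\dim X=2p+1$, $p\geq 1$ (here $p=1$, $W=T$), the two terms are defined as follows. Combinatorial anomaly: $$A_{\rm comb,\mathfrak m}(W)=\sum_{q=0}^{p}(-1)^{q+1}\log\Big(\#TH_q(W;\mathbb Z)\cdot\big|\det(\tilde{\mathcal A}_q(\tilde h_q)/n_q)\big|\Big),$$ where $\#TH_q(W;\mathbb Z)$ is the order of the torsion subgroup of $H_q(W;\mathbb Z)$; $\tilde h_q$ is an $L^2$-orthonormal basis of the harmonic $q$-forms on $W$ (with values in $E_\rho|_W$); $n_q$ is the standard basis of $H_q(W;E_\rho|_W)$ (coming from an integral basis of the free part of $H_q(W;\mathbb Z)$); $\tilde{\mathcal A}_q$ is the Ray–Singer isomorphism from harmonic $q$-forms to $H_q(W;E_\rho|_W)$, which up to sign sends $\omega$ to the homology class $\sum_j\big(\int_{\hat c_j}\ast\omega\big)c_j$, the sum being over the $q$-cells $c_j$ of a cell decomposition with dual cells $\hat c_j$ (i.e. the Poincaré dual of $[\ast\omega]$); and $(\tilde{\mathcal A}_q(\tilde h_q)/n_q)$ is the matrix of the change of basis. Analytic anomaly: $$A_{\rm analy}(W)=\sum_{q=0}^{p-1}(-1)^{q+1}r_q\log(2p-2q-1)!!+\frac14\chi(W;E_\rho|_W)\log 2+\frac12\sum_{q=0}^{p-1}(-1)^q\sum_{n=1}^\infty m_{{\rm cex},q,n}\log\frac{\mu_{q,n}+\alpha_q}{\mu_{q,n}-\alpha_q},$$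 where $r_q=\dim H_q(W;E_\rho|_W)$, $\chi$ is the Euler characteristic, $\alpha_q=\frac12+q-p$, $\mu_{q,n}=\sqrt{\lambda_{q,n}+\alpha_q^2}$, and $\{\lambda_{q,n}\}_{n\ge 1}$ are the distinct eigenvalues of the Hodge Laplacian on co-exact $q$-eigenforms of $W$, with multiplicities $m_{{\rm cex},q,n}$. The infinite sum is understood by analytic continuation: $$\sum_{n=1}^\infty m_{{\rm cex},q,n}\log\frac{\mu_{q,n}+\alpha_q}{\mu_{q,n}-\alpha_q}:=\frac{d}{ds}\Big(\zeta_{\rm cex}(s;-\alpha_q)-\zeta_{\rm cex}(s;\alpha_q)\Big)\Big|_{s=0},$$ where $\zeta_{\rm cex}(s;\pm\alpha_q)=\sum_{n=1}^\infty m_{{\rm cex},q,n}(\mu_{q,n}\pm\alpha_q)^{-s}$ for $\mathrm{Re}(s)\gg0$, continued meromorphically to a neighbourhood of $s=0$, where it is regular. *)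

theory Defs
  imports
    "HOL-Complex_Analysis.Complex_Analysis"
    "HOL-Library.Function_Algebras"
    "Jordan_Normal_Form.Determinant"
begin

section \<open>Smooth functions\<close>

definition iterated_deriv ::
  "'a list \<Rightarrow> ('a::euclidean_space \<Rightarrow> 'b::real_normed_vector) \<Rightarrow> 'a \<Rightarrow> 'b" where
  "iterated_deriv vs f = foldr (\<lambda>v g x. frechet_derivative g (at x) v) vs f"

text \<open>Intended for open sets only.\<close>
definition smooth_on :: "'a set \<Rightarrow> ('a::euclidean_space \<Rightarrow> 'b::real_normed_vector) \<Rightarrow> bool" where
  "smooth_on U f \<longleftrightarrow> (\<forall>vs. set vs \<subseteq> Basis \<longrightarrow> iterated_deriv vs f differentiable_on U)"

text \<open>Smoothness on an arbitrary set: local existence of smooth extensions.\<close>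
definition smooth_within :: "'a set \<Rightarrow> ('a::euclidean_space \<Rightarrow> 'b::real_normed_vector) \<Rightarrow> bool" where
  "smooth_within S f \<longleftrightarrow>
     (\<forall>x\<in>S. \<exists>U g. open U \<and> x \<in> U \<and> smooth_on U g \<and> (\<forall>y\<in>S \<inter> U. g y = f y))"


section \<open>Riemannian 3-manifolds with boundary\<close>

type_synonym r3 = "real \<times> real \<times> real"
type_synonym 'a chart = "'a set \<times> ('a \<Rightarrow> r3)"
type_synonym 'a metric_tensor = "'a chart \<Rightarrow> r3 \<Rightarrow> r3 \<Rightarrow> r3 \<Rightarrow> real"

definition half_space :: "r3 set" where
  "half_space = {x. 0 \<le> fst x}"

definition transition :: "'a chart \<Rightarrow> 'a chart \<Rightarrow> r3 \<Rightarrow> r3" where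
  "transition a b = snd b \<circ> inv_into (fst a) (snd a)"

definition smooth_atlas :: "'a::topological_space set \<Rightarrow> 'a chart set \<Rightarrow> bool" where
  "smooth_atlas M A \<longleftrightarrow>
     (\<Union>(U, \<phi>)\<in>A. U) = M \<and>
     (\<forall>(U, \<phi>)\<in>A. openin (top_of_set M) U \<and>
        openin (top_of_set half_space) (\<phi> ` U) \<and> (\<exists>\<psi>. homeomorphism U (\<phi> ` U) \<phi> \<psi>)) \<and>
     (\<forall>a\<in>A. \<forall>b\<in>A. smooth_within (snd a ` (fst a \<inter> fst b)) (transition a b))"

definition manifold_boundary :: "'a chart set \<Rightarrow> 'a set" where
  "manifold_boundary A = {x. \<exists>(U, \<phi>)\<in>A. x \<in> U \<and> fst (\<phi> x) = 0}"

text \<open>The tensor \<open>G\<close> is given by its coordinate expression in every chart.\<close>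
definition riemannian_metric :: "'a chart set \<Rightarrow> 'a metric_tensor \<Rightarrow> bool" where
  "riemannian_metric A G \<longleftrightarrow>
     (\<forall>a\<in>A. (\<forall>x\<in>snd a ` fst a. bilinear (G a x) \<and> (\<forall>u v. G a x u v = G a x v u) \<and>
                (\<forall>u. u \<noteq> 0 \<longrightarrow> 0 < G a x u u)) \<and>
            (\<forall>u v. smooth_within (snd a ` fst a) (\<lambda>x. G a x u v))) \<and>
     (\<forall>a\<in>A. \<forall>b\<in>A. \<forall>x\<in>snd a ` (fst a \<inter> fst b). \<forall>D.
        (transition a b has_derivative D) (at x within snd a ` (fst a \<inter> fst b)) \<longrightarrow>
        (\<forall>u v. G a x u v = G b (transition a b x) (D u) (D v)))"


section \<open>The torus, and pseudomanifolds with a conical singularity over it\<close>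

type_synonym pt = "real \<times> real"

definition torus :: "(complex \<times> complex) set" where
  "torus = sphere 0 1 \<times> sphere 0 1"

definition torus_cover :: "pt \<Rightarrow> complex \<times> complex" where
  "torus_cover x = (cis (fst x), cis (snd x))"

definition coord_vec :: "nat \<Rightarrow> pt" where
  "coord_vec i = (if i = 0 then (1, 0) else (0, 1))"

text \<open>The metric \<open>dr\<^sup>2 + r\<^sup>2 (d\<theta>\<^sup>2 + d\<phi>\<^sup>2)\<close> in the coordinates \<open>(r, \<theta>, \<phi>)\<close>.\<close>
definition cone_metric :: "real \<Rightarrow> real \<times> pt \<Rightarrow> real \<times> pt \<Rightarrow> real" where
  "cone_metric r u v = fst u * fst v + r\<^sup>2 * (snd u \<bullet> snd v)"

text \<open>
  \<open>X = M \<union> C\<close> where \<open>C\<close> is the image of \<open>[0,l] \<times> T\<close> under \<open>\<kappa>\<close>. As \<open>M\<close> and \<open>[0,l] \<times> T\<close> are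
  compact and \<open>X\<close> is Hausdorff, \<open>C\<close> is homeomorphic to the quotient collapsing \<open>{0} \<times> T\<close>, and
  \<open>X\<close> carries the gluing topology. The cone has \<open>cone_metric\<close> in the coordinates given by \<open>\<kappa>\<close>;
  the last conjunct says that \<open>\<partial>M\<close> and \<open>T\<close> are glued smoothly and the metrics
  of the two pieces agree along the seam.
\<close>
definition conical_pseudomanifold ::
  "'a::t2_space set \<Rightarrow> 'a set \<Rightarrow> 'a chart set \<Rightarrow> 'a metric_tensor \<Rightarrow> real \<Rightarrow>
   (real \<times> complex \<times> complex \<Rightarrow> 'a) \<Rightarrow> bool" where
  "conical_pseudomanifold X M A G l \<kappa> \<longleftrightarrow>
     0 < l \<and> compact M \<and> smooth_atlas M A \<and> riemannian_metric A G \<and>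
     continuous_on ({0..l} \<times> torus) \<kappa> \<and>
     (\<forall>r\<in>{0..l}. \<forall>r'\<in>{0..l}. \<forall>w\<in>torus. \<forall>w'\<in>torus.
        \<kappa> (r, w) = \<kappa> (r', w') \<longleftrightarrow> r = r' \<and> (r = 0 \<or> w = w')) \<and>
     X = M \<union> \<kappa> ` ({0..l} \<times> torus) \<and>
     M \<inter> \<kappa> ` ({0..l} \<times> torus) = \<kappa> ` ({l} \<times> torus) \<and>
     manifold_boundary A = \<kappa> ` ({l} \<times> torus) \<and>
     (\<forall>a\<in>A. let S = {y. \<kappa> (l, torus_cover y) \<in> fst a}; f = (\<lambda>y. snd a (\<kappa> (l, torus_cover y))) in
        smooth_within S f \<and>
        (\<forall>y\<in>S. \<forall>D. (f has_derivative D) (at y) \<longrightarrow>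
           (\<forall>u v. G a (f y) (D u) (D v) = cone_metric l (0, u) (0, v))))"


section \<open>Orthogonal representations and the flat bundle over the cross section\<close>

definition loops :: "'a::topological_space set \<Rightarrow> 'a \<Rightarrow> (real \<Rightarrow> 'a) set" where
  "loops X x0 = {p. path p \<and> path_image p \<subseteq> X \<and> pathstart p = x0 \<and> pathfinish p = x0}"

text \<open>
  A homomorphism from \<open>\<pi>\<^sub>1(X, x0)\<close> to the orthogonal group of \<open>'b\<close>, given on representing loops;
  rank one is \<open>'b = real\<close>.
\<close>
definition orthogonal_representation ::
  "'a::topological_space set \<Rightarrow> 'a \<Rightarrow> ((real \<Rightarrow> 'a) \<Rightarrow> 'b::euclidean_space \<Rightarrow> 'b) \<Rightarrow> bool" where
  "orthogonal_representation X x0 \<rho> \<longleftrightarrow>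
     (\<forall>p\<in>loops X x0. orthogonal_transformation (\<rho> p)) \<and>
     (\<forall>p\<in>loops X x0. \<forall>q\<in>loops X x0. homotopic_paths X p q \<longrightarrow> \<rho> p = \<rho> q) \<and>
     (\<forall>p\<in>loops X x0. \<forall>q\<in>loops X x0. \<rho> (p +++ q) = \<rho> p \<circ> \<rho> q)"

text \<open>
  The restriction of the flat bundle of \<open>\<rho>\<close> to \<open>\<partial>M = T\<close>, encoded by its monodromy along the
  two coordinate circles. In rank one these are \<open>\<plusminus>1\<close>, hence equal to their inverses.
\<close>
type_synonym monodromy = "nat \<Rightarrow> real \<Rightarrow> real"

definition restricted_bundle ::
  "(real \<times> complex \<times> complex \<Rightarrow> 'a) \<Rightarrow> real \<Rightarrow> ((real \<Rightarrow> 'a) \<Rightarrow> real \<Rightarrow> real) \<Rightarrow> monodromy" where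
  "restricted_bundle \<kappa> l \<rho> i =
     \<rho> (\<lambda>t. \<kappa> (l, torus_cover ((2 * pi * t) *\<^sub>R coord_vec i)))"


section \<open>Differential forms on the torus with values in the flat bundle\<close>

text \<open>
  Forms are pulled back to the universal cover; \<open>\<omega> I\<close> is the coefficient of
  \<open>dx\<^sub>I\<close>, the wedge product of the \<open>dx\<^sub>i\<close>, \<open>i \<in> I \<subseteq> {0,1}\<close>, in increasing order
  (\<open>x\<^sub>0 = \<theta>\<close>, \<open>x\<^sub>1 = \<phi>\<close>).
\<close>
type_synonym form = "nat set \<Rightarrow> pt \<Rightarrow> real"

definition form_scale :: "real \<Rightarrow> form \<Rightarrow> form" where
  "form_scale c \<omega> = (\<lambda>I x. c * \<omega> I x)"

interpretation form: vector_space form_scale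
  by unfold_locales (auto simp: form_scale_def fun_eq_iff algebra_simps)

definition forms :: "monodromy \<Rightarrow> nat \<Rightarrow> form set" where
  "forms E q = {\<omega>. (\<forall>I. \<not> (I \<subseteq> {0,1} \<and> card I = q) \<longrightarrow> \<omega> I = (\<lambda>x. 0)) \<and>
     (\<forall>I. smooth_on UNIV (\<omega> I) \<and>
          (\<forall>i<2. \<forall>x. \<omega> I (x + (2 * pi) *\<^sub>R coord_vec i) = E i (\<omega> I x)))}"

definition partial :: "nat \<Rightarrow> (pt \<Rightarrow> real) \<Rightarrow> pt \<Rightarrow> real" where
  "partial i f x = frechet_derivative f (at x) (coord_vec i)"

definition ext_deriv :: "form \<Rightarrow> form" where
  "ext_deriv \<omega> J x = (if J \<subseteq> {0,1}
     then \<Sum>j\<in>J. (-1) ^ card {i\<in>J. i < j} * partial j (\<omega> (J - {j})) x else 0)"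

text \<open>\<open>\<star>dx\<^sub>I = \<epsilon> dx\<^sub>J\<close> for \<open>J\<close> the complement of \<open>I\<close> and \<open>dx\<^sub>I \<and> dx\<^sub>J = \<epsilon> dx\<^sub>0 \<and> dx\<^sub>1\<close>.\<close>
definition hodge_star :: "form \<Rightarrow> form" where
  "hodge_star \<omega> J x = (if J \<subseteq> {0,1}
     then (-1) ^ card {(i, j). i \<in> {0,1} - J \<and> j \<in> J \<and> j < i} * \<omega> ({0,1} - J) x else 0)"

text \<open>In even dimension the sign is \<open>-1\<close> in all degrees.\<close>
definition codiff :: "form \<Rightarrow> form" where
  "codiff \<omega> = - hodge_star (ext_deriv (hodge_star \<omega>))"

definition hodge_laplacian :: "form \<Rightarrow> form" where
  "hodge_laplacian \<omega> = ext_deriv (codiff \<omega>) + codiff (ext_deriv \<omega>)"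

definition l2_inner :: "form \<Rightarrow> form \<Rightarrow> real" where
  "l2_inner \<omega> \<eta> =
     integral (cbox (0, 0) (2 * pi, 2 * pi)) (\<lambda>x. \<Sum>I\<in>Pow {0,1}. \<omega> I x * \<eta> I x)"

definition harmonic_forms :: "monodromy \<Rightarrow> nat \<Rightarrow> form set" where
  "harmonic_forms E q = {\<omega> \<in> forms E q. hodge_laplacian \<omega> = 0}"

definition harmonic_onb :: "monodromy \<Rightarrow> nat \<Rightarrow> form list \<Rightarrow> bool" where
  "harmonic_onb E q hs \<longleftrightarrow> form.span (set hs) = harmonic_forms E q \<and>
     (\<forall>i<length hs. \<forall>j<length hs. l2_inner (hs ! i) (hs ! j) = (if i = j then 1 else 0))"

definition coexact_eigenspace :: "monodromy \<Rightarrow> nat \<Rightarrow> real \<Rightarrow> form set" where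
  "coexact_eigenspace E q \<nu> =
     {\<omega> \<in> codiff ` forms E (Suc q). hodge_laplacian \<omega> = form_scale \<nu> \<omega>}"

definition coexact_spectrum :: "monodromy \<Rightarrow> nat \<Rightarrow> real set" where
  "coexact_spectrum E q = {\<nu>. coexact_eigenspace E q \<nu> \<noteq> {0}}"

definition coexact_mult :: "monodromy \<Rightarrow> nat \<Rightarrow> real \<Rightarrow> nat" where
  "coexact_mult E q \<nu> = form.dim (coexact_eigenspace E q \<nu>)"


section \<open>Cellular homology of the torus\<close>

text \<open>
  The product cell decomposition: for \<open>J \<subseteq> {0,1}\<close> the open cell \<open>c\<^sub>J\<close> lifts to
  \<open>{x. x\<^sub>j \<in> (0,2\<pi>) for j \<in> J, x\<^sub>j = 0 for j \<notin> J}\<close>, and the dual cell, which meets it in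
  its barycentre, lifts to \<open>{x. x\<^sub>j = \<pi> for j \<in> J, x\<^sub>j \<in> (-\<pi>,\<pi>) for j \<notin> J}\<close>.
  The boundary of a cell in the direction \<open>j\<close> is the face \<open>x\<^sub>j = 2\<pi>\<close>, a
  translate of the face \<open>x\<^sub>j = 0\<close>, minus the face \<open>x\<^sub>j = 0\<close>.
\<close>
definition chains :: "nat \<Rightarrow> (nat set \<Rightarrow> 'c::comm_ring_1) set" where
  "chains q = {a. \<forall>J. \<not> (J \<subseteq> {0,1} \<and> card J = q) \<longrightarrow> a J = 0}"

definition boundary :: "(nat \<Rightarrow> 'c \<Rightarrow> 'c) \<Rightarrow> (nat set \<Rightarrow> 'c::comm_ring_1) \<Rightarrow> nat set \<Rightarrow> 'c" where
  "boundary E a K =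
     (\<Sum>j\<in>{0,1} - K. (-1) ^ card {i\<in>K. i < j} * (E j (a (insert j K)) - a (insert j K)))"

definition cycles :: "(nat \<Rightarrow> 'c \<Rightarrow> 'c) \<Rightarrow> nat \<Rightarrow> (nat set \<Rightarrow> 'c::comm_ring_1) set" where
  "cycles E q = {a \<in> chains q. boundary E a = 0}"

definition boundaries :: "(nat \<Rightarrow> 'c \<Rightarrow> 'c) \<Rightarrow> nat \<Rightarrow> (nat set \<Rightarrow> 'c::comm_ring_1) set" where
  "boundaries E q = boundary E ` chains (Suc q)"

definition chain_scale :: "real \<Rightarrow> (nat set \<Rightarrow> real) \<Rightarrow> nat set \<Rightarrow> real" where
  "chain_scale c a = (\<lambda>J. c * a J)"

interpretation chain: vector_space chain_scale
  by unfold_locales (auto simp: chain_scale_def fun_eq_iff algebra_simps)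

text \<open>The dimension of cycles modulo boundaries.\<close>
definition betti :: "monodromy \<Rightarrow> nat \<Rightarrow> nat" where
  "betti E q = chain.dim (cycles E q) - chain.dim (boundaries E q)"

definition euler_char :: "monodromy \<Rightarrow> int" where
  "euler_char E = (\<Sum>q\<le>2. (-1) ^ q * int (betti E q))"

abbreviation int_coeff :: "nat \<Rightarrow> int \<Rightarrow> int" where
  "int_coeff \<equiv> \<lambda>_ a. a"

definition torsion_cycles :: "nat \<Rightarrow> (nat set \<Rightarrow> int) set" where
  "torsion_cycles q = {z \<in> cycles int_coeff q.
     \<exists>m>0. (\<lambda>J. m * z J) \<in> boundaries int_coeff q}"

definition torsion_order :: "nat \<Rightarrow> nat" where
  "torsion_order q =
     card (torsion_cycles q // {(z, z'). z - z' \<in> boundaries int_coeff q})"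

text \<open>Cycles whose classes form a basis of integral homology modulo torsion.\<close>
definition integral_basis :: "nat \<Rightarrow> (nat set \<Rightarrow> int) list \<Rightarrow> bool" where
  "integral_basis q ns \<longleftrightarrow> set ns \<subseteq> cycles int_coeff q \<and>
     (\<forall>z\<in>cycles int_coeff q. \<exists>!c. length c = length ns \<and>
        (\<lambda>J. z J - (\<Sum>i<length ns. c ! i * (ns ! i) J)) \<in> torsion_cycles q)"


section \<open>The combinatorial anomaly\<close>

definition dual_integral :: "nat set \<Rightarrow> form \<Rightarrow> real" where
  "dual_integral J \<eta> =
     (if J = {} then integral (cbox (-pi, -pi) (pi, pi)) (\<eta> {0,1})
      else if J = {0} then integral {-pi..pi} (\<lambda>t. \<eta> {1} (pi, t))
      else if J = {1} then integral {-pi..pi} (\<lambda>t. \<eta> {0} (t, pi))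
      else \<eta> {} (pi, pi))"

text \<open>
  The Ray--Singer map on the level of chains. The orientations of the dual cells are
  immaterial: up to the absolute value, the determinant below does not depend on them.
\<close>
definition ray_singer :: "nat \<Rightarrow> form \<Rightarrow> nat set \<Rightarrow> real" where
  "ray_singer q \<omega> J =
     (if J \<subseteq> {0,1} \<and> card J = q then dual_integral J (hodge_star \<omega>) else 0)"

definition change_of_basis ::
  "monodromy \<Rightarrow> nat \<Rightarrow> form list \<Rightarrow> (nat set \<Rightarrow> int) list \<Rightarrow> real mat" where
  "change_of_basis E q hs ns =
     (THE B. B \<in> carrier_mat (length hs) (length ns) \<and>
        (\<forall>i<length hs. (\<lambda>J. ray_singer q (hs ! i) J -
             (\<Sum>j<length ns. B $$ (i, j) * real_of_int ((ns ! j) J))) \<in> boundaries E q))"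

definition A_comb ::
  "nat \<Rightarrow> monodromy \<Rightarrow> (nat \<Rightarrow> form list) \<Rightarrow> (nat \<Rightarrow> (nat set \<Rightarrow> int) list) \<Rightarrow> real" where
  "A_comb p E h n = (\<Sum>q=0..p. (-1) ^ (q + 1) *
     ln (real (torsion_order q) * \<bar>Determinant.det (change_of_basis E q (h q) (n q))\<bar>))"


section \<open>The analytic anomaly\<close>

fun double_fact :: "nat \<Rightarrow> nat" where
  "double_fact 0 = 1"
| "double_fact (Suc 0) = 1"
| "double_fact (Suc (Suc k)) = Suc (Suc k) * double_fact k"

definition cex_alpha :: "nat \<Rightarrow> nat \<Rightarrow> real" where
  "cex_alpha p q = 1 / 2 + real q - real p"

definition cex_mu :: "nat \<Rightarrow> nat \<Rightarrow> real \<Rightarrow> real" where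
  "cex_mu p q \<nu> = sqrt (\<nu> + (cex_alpha p q)\<^sup>2)"

text \<open>
  \<open>Z\<close> is the meromorphic continuation of \<open>\<zeta>\<^sub>c\<^sub>e\<^sub>x(s; a)\<close> to some half plane
  containing \<open>0\<close>, regular at \<open>0\<close>. Half planes make the continuation unambiguous near \<open>0\<close>.
\<close>
definition cex_zeta_continuation ::
  "nat \<Rightarrow> monodromy \<Rightarrow> nat \<Rightarrow> real \<Rightarrow> (complex \<Rightarrow> complex) \<Rightarrow> bool" where
  "cex_zeta_continuation p E q a Z \<longleftrightarrow>
     (\<exists>c \<epsilon>. 0 < \<epsilon> \<and>
        (\<forall>s. c < Re s \<longrightarrow>
           ((\<lambda>\<nu>. of_nat (coexact_mult E q \<nu>) * complex_of_real (cex_mu p q \<nu> + a) powr (- s))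
              has_sum Z s) (coexact_spectrum E q)) \<and>
        Z meromorphic_on {s. - \<epsilon> < Re s} \<and> Z analytic_on {0})"

definition cex_log_sum :: "nat \<Rightarrow> monodromy \<Rightarrow> nat \<Rightarrow> real" where
  "cex_log_sum p E q =
     (THE D. \<exists>Zm Zp. cex_zeta_continuation p E q (- cex_alpha p q) Zm \<and>
        cex_zeta_continuation p E q (cex_alpha p q) Zp \<and>
        ((\<lambda>s. Zm s - Zp s) has_field_derivative complex_of_real D) (at 0))"

definition A_analy :: "nat \<Rightarrow> monodromy \<Rightarrow> real" where
  "A_analy p E =
     (\<Sum>q<p. (-1) ^ (q + 1) * real (betti E q) * ln (real (double_fact (2 * p - 2 * q - 1))))
     + 1 / 4 * real_of_int (euler_char E) * ln 2
     + 1 / 2 * (\<Sum>q<p. (-1) ^ q * cex_log_sum p E q)"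

end

theory Submission
  imports Defs "HOL-Probability.Probability"
begin

text \<open>
  The sum of the two anomalies is in fact positive. The cone over the torus contains the
  contraction of every loop of the torus, so the representation is trivial on the cross
  section and everything takes place on the flat torus with constant coefficients
  (\<open>restricted_bundle_trivial\<close>).

  There the harmonic forms are the constant ones. In degree 0 a unit constant function is \<open>\<plusminus> 1
  / (2 \<pi>)\<close>, whose integral over the torus is \<open>\<plusminus> 2 \<pi>\<close>; in degree 1 the periods of an
  orthonormal basis form an orthogonal matrix; and there is no torsion. Hence the
  combinatorial anomaly is \<open>- ln (2 \<pi>)\<close> (\<open>A_comb_trivial\<close>). In the analytic anomaly \<open>1!! = 1\<close>
  and the Euler characteristic vanishes, so that only half of the regularised logarithmic sum
  is left. Its spectrum consists of the numbers \<open>\<nu> = \<bar>k\<bar>\<^sup>2\<close> for nonzero lattice points \<open>k \<in>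
  \<int>\<^sup>2\<close>, counted with their number of representations (\<open>coexact_spectrum_trivial\<close>,
  \<open>coexact_mult_trivial\<close>).

  If \<open>y\<close> is defined by \<open>sinh y = 1 / (2 \<surd>\<nu>)\<close>, then \<open>\<surd>(\<nu> + 1/4) \<plusminus> 1/2 = \<surd>\<nu> exp (\<plusminus> y)\<close>. Let
  \<open>Z(w)\<close> be the Epstein zeta function, the continuation of the sum of \<open>\<bar>k\<bar>\<close> to the power \<open>- 2
  w\<close>. Expanding the exponential gives \<open>\<zeta>(s; 1/2) - \<zeta>(s; -1/2) = - s Z((s + 1) / 2) + h(s)\<close>,
  where \<open>h\<close> is the sum over \<open>k\<close> of \<open>\<nu>\<close> to the power \<open>- s / 2\<close> times \<open>2 (s sinh y - sinh (s
  y))\<close>; this series converges for \<open>Re s > - 1\<close>. By convexity of \<open>sinh\<close> its terms are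
  nonnegative for \<open>0 < s \<le> 1\<close>, and \<open>h(0) = 0\<close>, hence \<open>h'(0) \<ge> 0\<close>. The logarithmic sum is
  therefore at least \<open>- Z(1/2)\<close> (\<open>cex_log_sum_bound\<close>).

  The value \<open>Z(1/2)\<close> is negative and large enough: the inversion formula of the theta
  function, which is Poisson summation for Gaussians (\<open>poisson_gaussian\<close>), gives as for
  Riemann's zeta function \<open>- Z(1/2) = 4 - 2 B\<close>, where \<open>B\<close> is the integral over \<open>t > 1\<close> of the
  heat trace divided by \<open>\<surd>t\<close>, and \<open>B \<le> 1/10\<close> because the heat trace decays like \<open>exp (- \<pi> t)\<close>.
  So half of the logarithmic sum is at least \<open>19/10\<close>, while \<open>ln (2 \<pi>) < 19/10\<close>.

  Two facts from Fourier analysis enter, the completeness of the eigenfunctions and Poisson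
  summation. Both rest on \<open>hartley_complete\<close>, which comes from the Stone--Weierstrass theorem
  on the torus.
\<close>

section \<open>The holonomy along the cross section\<close>

text \<open>
  The constant loop equals its own square under concatenation, so it acts by an idempotent; as
  orthogonal transformations are injective, this idempotent is the identity.
\<close>
lemma null_homotopic_acts_trivially:
  assumes rep: "orthogonal_representation X x0 \<rho>"
    and p: "p \<in> loops X x0" and null: "homotopic_paths X p (\<lambda>t. x0)"
  shows "\<rho> p = (\<lambda>x. x)"
proof -
  define c where "c = (\<lambda>t::real. x0)"
  have "x0 \<in> X"
    using p by (force simp: loops_def pathstart_in_path_image)
  then have c: "c \<in> loops X x0"
    by (auto simp: loops_def c_def path_def path_image_def pathstart_def pathfinish_def)
  have cc: "c +++ c = c"
    by (auto simp: c_def joinpaths_def)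
  have rp: "\<rho> p = \<rho> c"
    using rep p c null unfolding orthogonal_representation_def c_def by blast
  have idem: "\<rho> c = \<rho> c \<circ> \<rho> c"
    using rep c cc unfolding orthogonal_representation_def by metis
  have "inj (\<rho> c)"
    using rep c unfolding orthogonal_representation_def
    by (meson orthogonal_transformation_inj)
  then have "\<rho> c = (\<lambda>x. x)"
    using idem by (metis comp_apply injD ext)
  with rp show ?thesis by simp
qed

text \<open>
  A continuous map from a compact space to a Hausdorff space is closed, hence a quotient map
  onto its image. This gives continuity at the apex of a cone, and it lets periodic functions
  on the plane descend to the torus.
\<close>
lemma continuous_on_compact_quotient:
  fixes f :: "'a::topological_space \<Rightarrow> 'b::t2_space" and g :: "'b \<Rightarrow> 'c::topological_space"
  assumes S: "compact S" and f: "continuous_on S f" and gf: "continuous_on S (\<lambda>x. g (f x))"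
  shows "continuous_on (f ` S) g"
  unfolding continuous_on_closed_invariant
proof (intro allI impI)
  fix B :: "'c set" assume "closed B"
  then obtain C where C: "closed C" "C \<inter> S = (\<lambda>x. g (f x)) -` B \<inter> S"
    using gf unfolding continuous_on_closed_invariant by blast
  have "compact (f ` (C \<inter> S))"
    using closed_Int_compact[OF C(1) S] continuous_on_subset[OF f, of "C \<inter> S"]
    by (intro compact_continuous_image) auto
  then have "closed (f ` (C \<inter> S))" by (rule compact_imp_closed)
  moreover have "f ` (C \<inter> S) \<inter> f ` S = g -` B \<inter> f ` S"
    using C by auto
  ultimately show "\<exists>D. closed D \<and> D \<inter> f ` S = g -` B \<inter> f ` S" by blast
qed

text \<open>
  A coordinate circle of the torus bounds a disc in \<open>X\<close>, namely the cone over this circle. In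
  the disc it is contracted along chords to its base point, which keeps the base point fixed,
  as a homotopy of loops representing elements of the fundamental group has to do.
\<close>
lemma restricted_bundle_trivial:
  fixes X M :: "'a::t2_space set"
  assumes con: "conical_pseudomanifold X M A G l \<kappa>"
    and rep: "orthogonal_representation X (\<kappa> (l, 1, 1)) \<rho>"
  shows "restricted_bundle \<kappa> l \<rho> = (\<lambda>i x. x)"
proof
  fix i :: nat
  define emb where "emb u = (if i = 0 then (u, 1) else (1, u))" for u :: complex
  define c where "c = (\<lambda>t. cis (2 * pi * t))"
  \<comment> \<open>the disc over the circle; the value 1 of the direction at the centre is arbitrary\<close>
  define F where "F z = \<kappa> (l * cmod z, emb (if z = 0 then 1 else sgn z))" for z
  have l: "0 < l" and cont: "continuous_on ({0..l} \<times> torus) \<kappa>"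
    and apex: "\<And>u u'. u \<in> torus \<Longrightarrow> u' \<in> torus \<Longrightarrow> \<kappa> (0, u) = \<kappa> (0, u')"
    and sub: "\<kappa> ` ({0..l} \<times> torus) \<subseteq> X"
    using con unfolding conical_pseudomanifold_def by auto
  have emb_torus: "emb u \<in> torus" if "cmod u = 1" for u
    using that by (simp add: emb_def torus_def)
  have emb_cont: "continuous_on S emb" for S
    unfolding emb_def by (cases "i = 0") (auto intro!: continuous_intros)
  have F_polar: "F (of_real r * u) = \<kappa> (l * r, emb u)" if "0 \<le> r" "cmod u = 1" for r u
  proof (cases "r = 0")
    case True
    then show ?thesis using apex[OF emb_torus[of 1] emb_torus[OF that(2)]] by (simp add: F_def)
  next
    case False
    then have "sgn (of_real r * u) = u" "of_real r * u \<noteq> 0"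
      using that by (auto simp: sgn_div_norm norm_mult scaleR_conv_of_real)
    then show ?thesis using that by (simp add: F_def norm_mult)
  qed
  \<comment> \<open>polar coordinates exhibit the disc as a quotient of the cylinder, so \<open>F\<close> is continuous at the apex\<close>
  define pol where "pol z = of_real (fst z) * snd z" for z :: "real \<times> complex"
  have disc: "pol ` ({0..1} \<times> sphere 0 1) = cball 0 1"
  proof (intro equalityI subsetI)
    fix z assume "z \<in> pol ` ({0..1} \<times> sphere 0 1)"
    then show "z \<in> cball 0 1" by (auto simp: pol_def norm_mult)
  next
    fix z :: complex assume z: "z \<in> cball 0 1"
    show "z \<in> pol ` ({0..1} \<times> sphere 0 1)"
    proof (rule image_eqI)
      show "z = pol (cmod z, if z = 0 then 1 else sgn z)"
        by (simp add: pol_def sgn_div_norm scaleR_conv_of_real)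
      show "(cmod z, if z = 0 then 1 else sgn z) \<in> {0..1} \<times> sphere 0 1"
        using z by (auto simp: norm_sgn)
    qed
  qed
  have seg: "l * s \<in> {0..l}" if "s \<in> {0..1}" for s
    using that l by (auto simp: mult_le_cancel_left1)
  have "continuous_on ({0..1} \<times> sphere 0 1) (\<lambda>z. \<kappa> (l * fst z, emb (snd z)))"
    by (rule continuous_on_compose2[OF cont])
       (use seg emb_torus in \<open>auto intro!: continuous_intros continuous_on_compose2[OF emb_cont[of UNIV]]\<close>)
  then have "continuous_on ({0..1} \<times> sphere 0 1) (\<lambda>z. F (pol z))"
    by (rule continuous_on_eq) (auto simp: pol_def F_polar)
  then have F_cont: "continuous_on (cball 0 1) F"
    unfolding disc[symmetric]
    by (intro continuous_on_compact_quotient)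
       (auto simp: pol_def intro!: continuous_intros compact_Times)
  have F_im: "F \<in> cball 0 1 \<rightarrow> X"
  proof
    fix z :: complex assume "z \<in> cball 0 1"
    then obtain r u where "z = of_real r * u" "r \<in> {0..1}" "cmod u = 1"
      unfolding disc[symmetric] by (auto simp: pol_def)
    then show "F z \<in> X" using sub F_polar seg emb_torus by fastforce
  qed
  have "path c" by (auto simp: c_def path_def intro!: continuous_intros)
  have "homotopic_paths (cball 0 1) c (linepath 1 1)"
  proof (rule homotopic_paths_linear)
    fix t :: real assume "t \<in> {0..1}"
    have "closed_segment (c t) (linepath 1 1 t) \<subseteq> cball 0 1"
      by (intro closed_segment_subset) (auto simp: c_def linepath_def simp flip: scaleR_left_distrib)
    then show "closed_segment (c t) (linepath 1 1 t) \<subseteq> cball 0 1" .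
  qed (use \<open>path c\<close> in \<open>auto simp: path_def c_def pathstart_def pathfinish_def linepath_def\<close>)
  from homotopic_paths_continuous_image[OF this F_cont F_im]
  have "homotopic_paths X (F \<circ> c) (F \<circ> linepath 1 1)" .
  moreover have "F \<circ> linepath 1 1 = (\<lambda>t. \<kappa> (l, 1, 1))"
    by (auto simp: F_def linepath_def emb_def fun_eq_iff simp flip: scaleR_left_distrib)
  ultimately have null: "homotopic_paths X (F \<circ> c) (\<lambda>t. \<kappa> (l, 1, 1))" by simp
  have "F \<circ> c \<in> loops X (\<kappa> (l, 1, 1))"
    using homotopic_paths_imp_path[OF null] homotopic_paths_imp_subset[OF null]
      homotopic_paths_imp_pathstart[OF null] homotopic_paths_imp_pathfinish[OF null]
    by (auto simp: loops_def pathstart_def pathfinish_def)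
  from null_homotopic_acts_trivially[OF rep this null]
  have "\<rho> (F \<circ> c) = (\<lambda>x. x)" .
  moreover have "F \<circ> c = (\<lambda>t. \<kappa> (l, torus_cover ((2 * pi * t) *\<^sub>R coord_vec i)))"
  proof
    fix t
    have "F (c t) = \<kappa> (l * 1, emb (c t))"
      using F_polar[of 1 "c t"] by (simp add: c_def)
    then show "(F \<circ> c) t = \<kappa> (l, torus_cover ((2 * pi * t) *\<^sub>R coord_vec i))"
      by (auto simp: emb_def torus_cover_def coord_vec_def c_def)
  qed
  ultimately show "restricted_bundle \<kappa> l \<rho> i = (\<lambda>x. x)"
    by (simp add: restricted_bundle_def)
qed

section \<open>Cellular homology of the torus\<close>

text \<open>
  Coordinate functionals on the combinations of the vectors \<open>v k\<close> make these vectors distinct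
  and independent. The hypothesis fixes the values of the functionals on these combinations
  because an integral over the torus is linear on continuous functions, but not on all
  functions.
\<close>
lemma (in vector_space) dim_eq_card_of_coordinates:
  assumes fin: "finite K"
    and coords: "\<And>c k. k \<in> K \<Longrightarrow> \<phi> k (\<Sum>j\<in>K. scale (c j) (v j)) = c k"
    and sub: "\<And>c. (\<Sum>j\<in>K. scale (c j) (v j)) \<in> V"
    and sup: "\<And>x. x \<in> V \<Longrightarrow> \<exists>c. x = (\<Sum>j\<in>K. scale (c j) (v j))"
  shows "dim V = card K"
proof -
  have delta: "(\<Sum>j\<in>K. scale (if j = i then 1 else 0) (v j)) = v i" if "i \<in> K" for i
  proof -
    have "(\<Sum>j\<in>K. scale (if j = i then 1 else 0) (v j)) = (\<Sum>j\<in>K. if j = i then v j else 0)"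
      by (rule sum.cong) auto
    then show ?thesis using fin that by simp
  qed
  have inj: "inj_on v K"
  proof (rule inj_onI)
    fix i j assume ij: "i \<in> K" "j \<in> K" "v i = v j"
    have "\<phi> i (v i) = 1" using coords[OF ij(1), of "\<lambda>j. if j = i then 1 else 0"] delta[OF ij(1)] by simp
    moreover have "\<phi> i (v j) = (if i = j then 1 else 0)"
      using coords[OF ij(1), of "\<lambda>k. if k = j then 1 else 0"] delta[OF ij(2)] by simp
    ultimately show "i = j" using ij(3) by (auto split: if_splits)
  qed
  have ind: "independent (v ` K)"
  proof -
    have "u (v k) = 0" if "(\<Sum>x\<in>v ` K. scale (u x) x) = 0" "k \<in> K" for u k
    proof -
      have eq: "(\<Sum>j\<in>K. scale (u (v j)) (v j)) = (\<Sum>j\<in>K. scale 0 (v j))"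
        using that by (simp add: sum.reindex[OF inj])
      show ?thesis using coords[OF that(2), of "\<lambda>j. u (v j)"] coords[OF that(2), of "\<lambda>j. 0"]
        unfolding eq by simp
    qed
    then show ?thesis using fin by (auto simp: dependent_finite)
  qed
  show ?thesis
  proof (rule dim_unique[OF _ _ ind])
    show "v ` K \<subseteq> V" using delta sub by (intro image_subsetI) (simp flip: delta)
    show "V \<subseteq> span (v ` K)"
      by (auto dest!: sup simp: span_sum span_scale span_base)
    show "card (v ` K) = card K" by (rule card_image[OF inj])
  qed
qed

lemma sum_apply: "sum f A x = (\<Sum>a\<in>A. f a x)" for f :: "_ \<Rightarrow> _ \<Rightarrow> _ :: comm_monoid_add"
  by (induction A rule: infinite_finite_induct) auto

definition cells :: "nat \<Rightarrow> nat set set" where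
  "cells q = {J. J \<subseteq> {0,1} \<and> card J = q}"

lemma cells_finite: "finite (cells q)"
  by (rule finite_subset[of _ "Pow {0,1}"]) (auto simp: cells_def)

lemma cells_0: "cells 0 = {{}}" 
  by (auto simp: cells_def dest: finite_subset)

lemma cells_1: "cells 1 = {{0}, {1}}"
  by (auto simp: cells_def card_1_singleton_iff)

lemma cells_2: "cells 2 = {{0, 1}}"
proof -
  have "J = {0, 1}" if "J \<subseteq> {0, 1::nat}" "card J = 2" for J
    using that by (intro card_subset_eq) auto
  then show ?thesis by (auto simp: cells_def)
qed

lemma chains_iff: "a \<in> chains q \<longleftrightarrow> (\<forall>J. J \<notin> cells q \<longrightarrow> a J = 0)"
  by (auto simp: chains_def cells_def)

text \<open>
  Opposite faces of a cell are identified by a deck transformation and cancel when the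
  coefficients are constant, so that every chain is a cycle and only \<open>0\<close> is a boundary.
\<close>
lemma boundary_trivial: "boundary (\<lambda>i x. x) a = 0"
  by (auto simp: boundary_def fun_eq_iff)

lemma cycles_trivial: "cycles (\<lambda>i x. x) q = chains q"
  by (simp add: cycles_def boundary_trivial)

lemma boundaries_trivial: "boundaries (\<lambda>i x. x) q = {0}"
proof -
  have "0 \<in> chains (Suc q)" by (simp add: chains_def)
  then show ?thesis by (auto simp: boundaries_def boundary_trivial)
qed

lemma dim_chains: "chain.dim (chains q) = card (cells q)"
proof (rule chain.dim_eq_card_of_coordinates[where \<phi> = "\<lambda>J a. a J"
      and v = "\<lambda>J K. if K = J then 1 else 0"])
  have expand: "(\<Sum>J\<in>cells q. chain_scale (c J) (\<lambda>K. if K = J then 1 else 0))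
      = (\<lambda>K. if K \<in> cells q then c K else 0)" for c
  proof
    fix K
    have "(\<Sum>J\<in>cells q. chain_scale (c J) (\<lambda>K. if K = J then 1 else 0)) K
       = (\<Sum>J\<in>cells q. if K = J then c J else 0)"
      by (simp add: sum_apply chain_scale_def if_distrib cong: if_cong)
    then show "(\<Sum>J\<in>cells q. chain_scale (c J) (\<lambda>K. if K = J then 1 else 0)) K
      = (if K \<in> cells q then c K else 0)"
      by (simp add: cells_finite)
  qed
  show "(\<Sum>J\<in>cells q. chain_scale (c J) (\<lambda>K. if K = J then 1 else 0)) k = c k"
    if "k \<in> cells q" for c k
    using that by (simp add: expand)
  show "(\<Sum>J\<in>cells q. chain_scale (c J) (\<lambda>K. if K = J then 1 else 0)) \<in> chains q" for c
    by (simp add: expand chains_iff)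
  show "\<exists>c. a = (\<Sum>J\<in>cells q. chain_scale (c J) (\<lambda>K. if K = J then 1 else 0))"
    if "a \<in> chains q" for a
    using that by (intro exI[of _ a]) (auto simp: expand chains_iff)
qed (rule cells_finite)

lemma betti_trivial: "betti (\<lambda>i x. x) q = card (cells q)"
proof -
  have "chain.dim {0} = 0"
    by (rule chain.dim_eq_card_of_coordinates[of "{}", simplified]) auto
  then show ?thesis
    by (simp add: betti_def cycles_trivial boundaries_trivial dim_chains)
qed

lemma euler_char_trivial: "euler_char (\<lambda>i x. x) = 0"
proof -
  have "{..2::nat} = {0, 1, 2}" by auto
  then show ?thesis
    unfolding euler_char_def betti_trivial
    by (simp add: cells_0 cells_1[unfolded One_nat_def] cells_2)
qed

lemma torsion_cycles_trivial: "torsion_cycles q = {0}"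
  by (auto simp: torsion_cycles_def cycles_trivial boundaries_trivial chains_def fun_eq_iff intro!: exI[of _ 1])

lemma torsion_order_trivial: "torsion_order q = 1"
  by (simp add: torsion_order_def torsion_cycles_trivial quotient_def)

section \<open>The combinatorial anomaly\<close>

text \<open>
  The traces of \<open>P Q\<close> and of \<open>Q P\<close> agree. This bounds the length of a basis from both sides at
  once.
\<close>
lemma matrix_inverse_imp_square:
  fixes P Q :: "'a :: {comm_ring_1, ring_char_0} mat"
  assumes P: "P \<in> carrier_mat m n" and Q: "Q \<in> carrier_mat n m"
    and PQ: "P * Q = 1\<^sub>m m" and QP: "Q * P = 1\<^sub>m n"
  shows "m = n"
proof -
  have "of_nat m = (\<Sum>i<m. (P * Q) $$ (i, i))" by (simp add: PQ)
  also have "\<dots> = (\<Sum>i<m. \<Sum>j<n. P $$ (i, j) * Q $$ (j, i))"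
    using P Q by (intro sum.cong) (auto simp: scalar_prod_def atLeast0LessThan)
  also have "\<dots> = (\<Sum>j<n. \<Sum>i<m. Q $$ (j, i) * P $$ (i, j))"
    by (subst sum.swap) (simp add: mult.commute)
  also have "\<dots> = (\<Sum>j<n. (Q * P) $$ (j, j))"
    using P Q by (intro sum.cong) (auto simp: scalar_prod_def atLeast0LessThan)
  also have "\<dots> = (of_nat n :: 'a)" by (simp add: QP)
  finally show ?thesis by simp
qed

text \<open>
  Together with \<open>cell\<close> an enumeration of the cells in degrees 0 and 1, the only ones that
  enter the combinatorial anomaly of a surface.
\<close>
definition num_cells :: "nat \<Rightarrow> nat" where
  "num_cells q = (if q = 0 then 1 else 2)"

definition cell :: "nat \<Rightarrow> nat \<Rightarrow> nat set" where
  "cell q i = (if q = 0 then {} else {i})"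

lemma cell_bij: "q \<le> 1 \<Longrightarrow> bij_betw (cell q) {..<num_cells q} (cells q)"
  by (cases q)
     (auto simp: bij_betw_def inj_on_def cell_def num_cells_def cells_0 cells_1[unfolded One_nat_def] lessThan_Suc numeral_2_eq_2)

lemma sum_cells: "q \<le> 1 \<Longrightarrow> (\<Sum>J\<in>cells q. f J) = (\<Sum>i<num_cells q. f (cell q i))"
  using sum.reindex_bij_betw[OF cell_bij, of q f] by simp

lemma chain_eqI:
  assumes "a \<in> chains q" "b \<in> chains q" "q \<le> 1" "\<And>i. i < num_cells q \<Longrightarrow> a (cell q i) = b (cell q i)"
  shows "a = b"
proof
  fix J
  show "a J = b J"
  proof (cases "J \<in> cells q")
    case True
    then obtain i where "i < num_cells q" "J = cell q i"
      using cell_bij[OF assms(3)] by (auto simp: bij_betw_def)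
    then show ?thesis using assms(4) by simp
  qed (use assms(1,2) in \<open>simp add: chains_iff\<close>)
qed

definition unit_chain :: "nat set \<Rightarrow> nat set \<Rightarrow> 'c :: comm_ring_1" where
  "unit_chain J K = (if K = J then 1 else 0)"

lemma cell_in_cells: "q \<le> 1 \<Longrightarrow> i < num_cells q \<Longrightarrow> cell q i \<in> cells q"
  using cell_bij by (auto simp: bij_betw_def)

lemma cell_eq_iff: "q \<le> 1 \<Longrightarrow> i < num_cells q \<Longrightarrow> j < num_cells q \<Longrightarrow> cell q i = cell q j \<longleftrightarrow> i = j"
  using cell_bij[of q] by (auto simp: bij_betw_def inj_on_def)

lemma unit_chain_in_chains: "J \<in> cells q \<Longrightarrow> unit_chain J \<in> chains q"
  by (auto simp: chains_iff unit_chain_def)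

definition basis_matrix :: "nat \<Rightarrow> (nat set \<Rightarrow> int) list \<Rightarrow> int mat" where
  "basis_matrix q ns = mat (length ns) (num_cells q) (\<lambda>(i, j). (ns ! i) (cell q j))"

text \<open>
  The rows of \<open>C\<close> express the elementary chains in the given basis. One product is the
  identity because these expressions are correct, the other because expressions in a basis are
  unique.
\<close>
lemma integral_basis_unimodular:
  assumes basis: "integral_basis q ns" and q: "q \<le> 1"
  obtains C where "length ns = num_cells q"
    "C \<in> carrier_mat (num_cells q) (num_cells q)"
    "C * basis_matrix q ns = 1\<^sub>m (num_cells q)" "basis_matrix q ns * C = 1\<^sub>m (num_cells q)"
proof -
  define L d N where "L = length ns" and "d = num_cells q" and "N = basis_matrix q ns"
  have N: "N \<in> carrier_mat L d" by (simp add: N_def basis_matrix_def L_def d_def)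
  have Nij: "N $$ (i, j) = (ns ! i) (cell q j)" if "i < L" "j < d" for i j
    using that by (simp add: N_def basis_matrix_def L_def d_def)
  have ns: "ns ! i \<in> chains q" if "i < L" for i
    using basis that unfolding integral_basis_def cycles_trivial L_def by (meson nth_mem subsetD)
  have ex1: "\<exists>!c. length c = L \<and> z = (\<lambda>J. \<Sum>i<L. c ! i * (ns ! i) J)" if "z \<in> chains q" for z
  proof -
    have *: "((\<lambda>J. z J - (\<Sum>i<L. c ! i * (ns ! i) J)) \<in> torsion_cycles q)
        = (z = (\<lambda>J. \<Sum>i<L. c ! i * (ns ! i) J))" for c
      by (auto simp: torsion_cycles_trivial fun_eq_iff)
    have "\<exists>!c. length c = L \<and> (\<lambda>J. z J - (\<Sum>i<L. c ! i * (ns ! i) J)) \<in> torsion_cycles q"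
      using basis that unfolding integral_basis_def cycles_trivial L_def by blast
    then show ?thesis by (simp only: *)
  qed
  have uniq: "(\<And>i. i < L \<Longrightarrow> f i = g i)"
    if "z \<in> chains q" "z = (\<lambda>J. \<Sum>i<L. f i * (ns ! i) J)" "z = (\<lambda>J. \<Sum>i<L. g i * (ns ! i) J)" for z f g
  proof -
    have "length (map h [0..<L]) = L \<and> z = (\<lambda>J. \<Sum>i<L. map h [0..<L] ! i * (ns ! i) J)"
      if "z = (\<lambda>J. \<Sum>i<L. h i * (ns ! i) J)" for h
      using that by auto
    with that have "map f [0..<L] = map g [0..<L]"
      using ex1[of z] by blast
    then show "f i = g i" if "i < L" for i using that by (simp add: list_eq_iff_nth_eq)
  qed
  have "\<forall>i. \<exists>c. i < d \<longrightarrow> length c = L \<and> unit_chain (cell q i) = (\<lambda>J. \<Sum>k<L. c ! k * (ns ! k) J)"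
    using ex1[OF unit_chain_in_chains[OF cell_in_cells[OF q]]] unfolding d_def by blast
  then obtain c where c: "\<And>i. i < d \<Longrightarrow> unit_chain (cell q i) = (\<lambda>J. \<Sum>k<L. c i ! k * (ns ! k) J)"
    by metis
  define C where "C = mat d L (\<lambda>(i, k). c i ! k)"
  have C: "C \<in> carrier_mat d L" by (simp add: C_def)
  have CN: "C * N = 1\<^sub>m d"
  proof (rule eq_matI)
    fix i j assume ij: "i < dim_row (1\<^sub>m d :: int mat)" "j < dim_col (1\<^sub>m d :: int mat)"
    have "(C * N) $$ (i, j) = (\<Sum>k<L. c i ! k * (ns ! k) (cell q j))"
      using ij C N by (simp add: scalar_prod_def atLeast0LessThan Nij C_def)
    also have "\<dots> = unit_chain (cell q i) (cell q j)" using c[of i] ij by (simp add: fun_eq_iff)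
    finally show "(C * N) $$ (i, j) = 1\<^sub>m d $$ (i, j)"
      using ij by (auto simp: unit_chain_def d_def cell_eq_iff[OF q])
  qed (use C N in auto)
  have NC: "N * C = 1\<^sub>m L"
  proof (rule eq_matI)
    fix i j assume ij: "i < dim_row (1\<^sub>m L :: int mat)" "j < dim_col (1\<^sub>m L :: int mat)"
    have i: "i < L" "j < L" using ij by auto
    have "ns ! i = (\<lambda>J. \<Sum>k<L. (\<Sum>m<d. N $$ (i, m) * c m ! k) * (ns ! k) J)"
    proof (rule chain_eqI[OF ns[OF i(1)] _ q])
      show "(\<lambda>J. \<Sum>k<L. (\<Sum>m<d. N $$ (i, m) * c m ! k) * (ns ! k) J) \<in> chains q"
        using ns by (auto simp: chains_iff)
      fix j assume j: "j < num_cells q"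
      have "(\<Sum>k<L. (\<Sum>m<d. N $$ (i, m) * c m ! k) * (ns ! k) (cell q j))
          = (\<Sum>m<d. N $$ (i, m) * (\<Sum>k<L. c m ! k * (ns ! k) (cell q j)))"
        by (simp add: sum_distrib_left sum_distrib_right mult.assoc) (rule sum.swap)
      also have "\<dots> = (\<Sum>m<d. N $$ (i, m) * (if m = j then 1 else 0))"
      proof (rule sum.cong[OF refl])
        fix m assume m: "m \<in> {..<d}"
        have "(\<Sum>k<L. c m ! k * (ns ! k) (cell q j)) = unit_chain (cell q m) (cell q j)"
          using c[of m] m by (simp add: fun_eq_iff)
        then show "N $$ (i, m) * (\<Sum>k<L. c m ! k * (ns ! k) (cell q j)) = N $$ (i, m) * (if m = j then 1 else 0)"
          using m j cell_eq_iff[OF q] by (auto simp: unit_chain_def d_def)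
      qed
      also have "\<dots> = (ns ! i) (cell q j)" using j i by (simp add: d_def[symmetric] Nij if_distrib[of "\<lambda>u. _ * u"] cong: if_cong)
      finally show "(ns ! i) (cell q j) = (\<Sum>k<L. (\<Sum>m<d. N $$ (i, m) * c m ! k) * (ns ! k) (cell q j))" ..
    qed
    moreover have "ns ! i = (\<lambda>J. \<Sum>k<L. (if k = i then 1 else 0) * (ns ! k) J)"
      using i by (simp add: if_distrib[of "\<lambda>u. u * _"] cong: if_cong)
    ultimately have "(\<Sum>m<d. N $$ (i, m) * c m ! j) = (if j = i then 1 else 0)"
      by (rule uniq[OF ns[OF i(1)] _ _ i(2)])
    then show "(N * C) $$ (i, j) = 1\<^sub>m L $$ (i, j)"
      using i N C by (auto simp: scalar_prod_def atLeast0LessThan C_def)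
  qed (use C N in auto)
  have "d = L" by (rule matrix_inverse_imp_square[OF C N CN NC])
  then show thesis using that[of C] C CN NC by (simp add: L_def d_def N_def)
qed

definition const_form :: "(nat set \<Rightarrow> real) \<Rightarrow> form" where
  "const_form a = (\<lambda>I x. a I)"

lemma l2_inner_const_form:
  assumes "a \<in> chains q" "q \<le> 1"
  shows "l2_inner (const_form a) (const_form b)
       = (2 * pi)\<^sup>2 * (\<Sum>i<num_cells q. a (cell q i) * b (cell q i))"
proof -
  have "(\<Sum>I\<in>Pow {0,1}. a I * b I) = (\<Sum>I\<in>cells q. a I * b I)"
    using assms(1) by (intro sum.mono_neutral_right) (auto simp: chains_iff cells_def)
  then show ?thesis
    by (simp add: l2_inner_def const_form_def content_Pair power2_eq_square sum_cells[OF assms(2)])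
qed

text \<open>
  The integral of \<open>\<star>\<omega>\<close> over a dual cell for constant \<open>\<omega>\<close>, relative to the coefficient of \<open>\<omega>\<close>:
  the volume of the dual cell, with the sign from \<open>\<star>dx\<^sub>1 = - dx\<^sub>0\<close>.
\<close>
definition dual_volume :: "nat \<Rightarrow> nat \<Rightarrow> real" where
  "dual_volume q i = (if q = 0 then (2 * pi)\<^sup>2 else if i = 0 then 2 * pi else - (2 * pi))"

lemma hodge_star_components:
  "hodge_star \<omega> {} x = \<omega> {0, Suc 0} x"
  "hodge_star \<omega> {0} x = - \<omega> {Suc 0} x"
  "hodge_star \<omega> {Suc 0} x = \<omega> {0} x"
  "hodge_star \<omega> {0, Suc 0} x = \<omega> {} x"
proof -
  have inversions: "{(i, j). i \<in> {0,1} - {0} \<and> j \<in> {0} \<and> j < i} = {(Suc 0, 0)}"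
    "{(i, j). i \<in> {0,1} - {Suc 0} \<and> j \<in> {Suc 0} \<and> j < i} = {}"
    "{(i, j). i \<in> {0,1} - {} \<and> j \<in> {} \<and> j < (i::nat)} = {}"
    "{(i, j). i \<in> {0,1} - {0, Suc 0} \<and> j \<in> {0, Suc 0} \<and> j < i} = {}"
    by auto
  have complements: "{0,1} - {0} = {Suc 0}" "{0,1} - {Suc 0} = {0::nat}" "{0,1} - {0,Suc 0} = {}" "{0,1} - {} = {0,Suc 0}"
    by auto
  have subs: "{} \<subseteq> {0,1::nat}" "{0} \<subseteq> {0,1::nat}" "{Suc 0} \<subseteq> {0,1::nat}" "{0,Suc 0} \<subseteq> {0,1::nat}"
    by auto
  show "hodge_star \<omega> {} x = \<omega> {0, Suc 0} x"
    unfolding hodge_star_def inversions if_P[OF subs(1)] unfolding complements by simp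
  show "hodge_star \<omega> {0} x = - \<omega> {Suc 0} x"
    unfolding hodge_star_def inversions if_P[OF subs(2)] unfolding complements by simp
  show "hodge_star \<omega> {Suc 0} x = \<omega> {0} x"
    unfolding hodge_star_def inversions if_P[OF subs(3)] unfolding complements by simp
  show "hodge_star \<omega> {0, Suc 0} x = \<omega> {} x"
    unfolding hodge_star_def inversions if_P[OF subs(4)] unfolding complements by simp
qed

lemma ray_singer_const_form:
  assumes "q \<le> 1" "i < num_cells q"
  shows "ray_singer q (const_form a) (cell q i) = dual_volume q i * a (cell q i)"
proof -
  have sub: "cell q i \<subseteq> {0, 1}" "card (cell q i) = q"
    using cell_in_cells[OF assms] by (auto simp: cells_def)
  have star: "hodge_star (const_form a) {0, Suc 0} = (\<lambda>x. a {})"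
    "hodge_star (const_form a) {0} = (\<lambda>x. - a {Suc 0})"
    "hodge_star (const_form a) {Suc 0} = (\<lambda>x. a {0})"
    by (auto simp: hodge_star_components const_form_def)
  consider "q = 0" | "q = 1" "i = 0" | "q = 1" "i = 1"
    using assms by (cases "q = 0"; cases "i = 0") (auto simp: num_cells_def)
  then show ?thesis
    by cases (use sub in \<open>auto simp: ray_singer_def dual_integral_def cell_def star
          dual_volume_def content_Pair power2_eq_square\<close>)
qed

text \<open>
  The factor \<open>2 \<pi>\<close> is the norm of the constant function 1, so orthonormality says \<open>V V\<^sup>T = 1\<close>.
  The spanning property supplies a left inverse of \<open>V\<close>, which must be \<open>V\<^sup>T\<close> as well; hence \<open>V\<close>
  is square and the number of forms is the number of cells.
\<close>
lemma harmonic_onb_matrix: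
  assumes harm: "harmonic_forms E q = const_form ` chains q" and q: "q \<le> 1"
    and onb: "harmonic_onb E q hs"
  defines "V \<equiv> mat (length hs) (num_cells q) (\<lambda>(i, j). 2 * pi * (hs ! i) (cell q j) (0, 0))"
  obtains "length hs = num_cells q" "V * transpose_mat V = 1\<^sub>m (num_cells q)"
    "\<And>i. i < length hs \<Longrightarrow> \<exists>a\<in>chains q. hs ! i = const_form a"
proof -
  define L d where "L = length hs" and "d = num_cells q"
  have V: "V \<in> carrier_mat L d" by (simp add: V_def L_def d_def)
  have const: "\<exists>a\<in>chains q. hs ! i = const_form a" if "i < L" for i
  proof -
    have "hs ! i \<in> form.span (set hs)" using that by (simp add: L_def form.span_base)
    then show ?thesis using onb harm by (auto simp: harmonic_onb_def)
  qed
  have Vij: "V $$ (i, j) = 2 * pi * (hs ! i) (cell q j) (0, 0)" if "i < L" "j < d" for i j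
    using that by (simp add: V_def L_def d_def)
  have VVt: "V * transpose_mat V = 1\<^sub>m L"
  proof (rule eq_matI)
    fix i j assume "i < dim_row (1\<^sub>m L :: real mat)" "j < dim_col (1\<^sub>m L :: real mat)"
    then have ij: "i < L" "j < L" by auto
    obtain a b where ab: "a \<in> chains q" "hs ! i = const_form a" "hs ! j = const_form b"
      using const[OF ij(1)] const[OF ij(2)] by blast
    have "(V * transpose_mat V) $$ (i, j) = l2_inner (hs ! i) (hs ! j)"
      using ij V by (simp add: scalar_prod_def atLeast0LessThan Vij ab(2,3) l2_inner_const_form[OF ab(1) q]
          sum_distrib_left d_def[symmetric] power2_eq_square)
        (simp add: const_form_def algebra_simps)
    then show "(V * transpose_mat V) $$ (i, j) = 1\<^sub>m L $$ (i, j)"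
      using onb ij by (auto simp: harmonic_onb_def L_def)
  qed (use V in auto)
  have span: "\<exists>c. \<forall>J x. w J x = (\<Sum>i<L. c i * (hs ! i) J x)" if "w \<in> form.span (set hs)" for w
    using that
  proof (induction rule: form.span_induct_alt)
    case base
    show ?case by (intro exI[of _ "\<lambda>i. 0"]) simp
  next
    case (step c x y)
    then obtain k f where k: "k < L" "x = hs ! k" and f: "\<And>J z. y J z = (\<Sum>i<L. f i * (hs ! i) J z)"
      by (auto simp: in_set_conv_nth L_def)
    have "(form_scale c x + y) J z = (\<Sum>i<L. (f i + (if i = k then c else 0)) * (hs ! i) J z)" for J z
      using k by (simp add: form_scale_def f distrib_right sum.distrib if_distrib[of "\<lambda>u. u * _"] cong: if_cong)
    then show ?case by (intro exI[of _ "\<lambda>i. f i + (if i = k then c else 0)"]) blast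
  qed
  \<comment> \<open>the spanning property gives a left inverse of \<open>V\<close>\<close>
  have "\<forall>j. \<exists>c. j < d \<longrightarrow> (\<forall>J x. const_form (unit_chain (cell q j)) J x = (\<Sum>i<L. c i * (hs ! i) J x))"
  proof (intro allI)
    fix j
    show "\<exists>c. j < d \<longrightarrow> (\<forall>J x. const_form (unit_chain (cell q j)) J x = (\<Sum>i<L. c i * (hs ! i) J x))"
    proof (cases "j < d")
      case True
      then have "const_form (unit_chain (cell q j)) \<in> form.span (set hs)"
        using onb harm unit_chain_in_chains[OF cell_in_cells[OF q]]
        by (auto simp: harmonic_onb_def d_def)
      from span[OF this] show ?thesis by auto
    qed simp
  qed
  then obtain c where c: "\<And>j J x. j < d \<Longrightarrow>
      const_form (unit_chain (cell q j)) J x = (\<Sum>i<L. c j i * (hs ! i) J x)"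
    by metis
  define U where "U = mat d L (\<lambda>(j, i). c j i / (2 * pi))"
  have U: "U \<in> carrier_mat d L" by (simp add: U_def)
  have UV: "U * V = 1\<^sub>m d"
  proof (rule eq_matI)
    fix j k assume "j < dim_row (1\<^sub>m d :: real mat)" "k < dim_col (1\<^sub>m d :: real mat)"
    then have jk: "j < d" "k < d" by auto
    have "(U * V) $$ (j, k) = (\<Sum>i<L. c j i * (hs ! i) (cell q k) (0, 0))"
      using jk U V by (simp add: scalar_prod_def atLeast0LessThan Vij) (simp add: U_def)
    also have "\<dots> = unit_chain (cell q j) (cell q k)"
      using c[OF jk(1)] by (simp add: const_form_def)
    finally show "(U * V) $$ (j, k) = 1\<^sub>m d $$ (j, k)"
      using jk by (auto simp: unit_chain_def d_def cell_eq_iff[OF q])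
  qed (use U V in auto)
  have Vt: "transpose_mat V \<in> carrier_mat d L" using V by simp
  have "U = U * (V * transpose_mat V)" using U by (simp add: VVt)
  also have "\<dots> = transpose_mat V"
    using UV Vt by (simp add: assoc_mult_mat[OF U V Vt, symmetric])
  finally have "transpose_mat V * V = 1\<^sub>m d" using UV by simp
  from matrix_inverse_imp_square[OF V Vt VVt this] have "L = d" .
  with VVt const show thesis using that by (simp add: L_def d_def)
qed

lemma abs_eq_1_of_square: "\<bar>x\<bar> = 1" if "x * x = 1" for x :: real
  using that by (metis abs_1 abs_mult power2_eq_square power2_eq_1_iff abs_minus_cancel)

text \<open>
  The matrix factors as \<open>V D C\<close> with \<open>V\<close> orthogonal, \<open>C\<close> unimodular and \<open>D\<close> diagonal with the
  volumes of the dual cells divided by \<open>2 \<pi>\<close>. So only \<open>D\<close> contributes: the area \<open>(2 \<pi>)\<^sup>2\<close>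
  leaves \<open>2 \<pi>\<close> in degree 0, and the length \<open>2 \<pi>\<close> leaves \<open>\<plusminus> 1\<close> in degree 1.
\<close>
lemma abs_det_change_of_basis:
  assumes harm: "harmonic_forms (\<lambda>i x. x) q = const_form ` chains q" and q: "q \<le> 1"
    and onb: "harmonic_onb (\<lambda>i x. x) q hs" and basis: "integral_basis q ns"
  shows "\<bar>Determinant.det (change_of_basis (\<lambda>i x. x) q hs ns)\<bar> = (if q = 0 then 2 * pi else 1)"
proof -
  define d where "d = num_cells q"
  define V where "V = mat (length hs) (num_cells q) (\<lambda>(i, j). 2 * pi * (hs ! i) (cell q j) (0, 0))"
  from harmonic_onb_matrix[OF harm q onb]
  have len: "length hs = d" and VVt: "V * transpose_mat V = 1\<^sub>m d"
    and const: "\<And>i. i < length hs \<Longrightarrow> \<exists>a\<in>chains q. hs ! i = const_form a"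
    unfolding V_def d_def by blast+
  have V: "V \<in> carrier_mat d d" using len by (simp add: V_def d_def)
  define N where "N = basis_matrix q ns"
  obtain C where lenn: "length ns = d" and C: "C \<in> carrier_mat d d"
    and CN: "C * N = 1\<^sub>m d" and NC: "N * C = 1\<^sub>m d"
    using integral_basis_unimodular[OF basis q] unfolding d_def N_def by blast
  have N: "N \<in> carrier_mat d d" by (simp add: N_def basis_matrix_def lenn d_def[symmetric])
  define N' C' where "N' = map_mat real_of_int N" and "C' = map_mat real_of_int C"
  have N': "N' \<in> carrier_mat d d" and C': "C' \<in> carrier_mat d d"
    using N C by (auto simp: N'_def C'_def)
  have CN': "C' * N' = 1\<^sub>m d"
    using of_int_hom.mat_hom_mult[OF C N, where 'a = real] by (simp add: CN N'_def C'_def of_int_hom.mat_hom_one)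
  have NC': "N' * C' = 1\<^sub>m d"
    using of_int_hom.mat_hom_mult[OF N C, where 'a = real] by (simp add: NC N'_def C'_def of_int_hom.mat_hom_one)
  define D where "D = mat d d (\<lambda>(i, j). if i = j then dual_volume q i / (2 * pi) else 0)"
  have D: "D \<in> carrier_mat d d" by (simp add: D_def)
  have VD: "(V * D) $$ (i, j) = ray_singer q (hs ! i) (cell q j)" if ij: "i < d" "j < d" for i j
  proof -
    obtain a where a: "hs ! i = const_form a" using const[of i] ij len by auto
    have "(V * D) $$ (i, j) = (\<Sum>k<d. V $$ (i, k) * (if k = j then dual_volume q k / (2 * pi) else 0))"
      using ij V D by (simp add: scalar_prod_def atLeast0LessThan) (simp add: D_def)
    also have "\<dots> = V $$ (i, j) * (dual_volume q j / (2 * pi))"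
      using ij by (simp add: if_distrib[of "\<lambda>u. _ * u"] cong: if_cong)
    finally show ?thesis
      using ij ray_singer_const_form[OF q, of j a] len
      by (simp add: a d_def[symmetric]) (simp add: V_def d_def[symmetric] a const_form_def)
  qed
  have iff: "(B \<in> carrier_mat (length hs) (length ns) \<and>
        (\<forall>i<length hs. (\<lambda>J. ray_singer q (hs ! i) J -
             (\<Sum>j<length ns. B $$ (i, j) * real_of_int ((ns ! j) J))) \<in> boundaries (\<lambda>i x. x) q))
      \<longleftrightarrow> B \<in> carrier_mat d d \<and> B * N' = V * D" for B
  proof (cases "B \<in> carrier_mat d d")
    case True
    have BN: "(B * N') $$ (i, k) = (\<Sum>j<d. B $$ (i, j) * real_of_int ((ns ! j) (cell q k)))"
      if "i < d" "k < d" for i k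
      using that True N' N by (simp add: scalar_prod_def atLeast0LessThan)
         (simp add: N'_def N_def basis_matrix_def lenn d_def[symmetric])
    have "(\<lambda>J. ray_singer q (hs ! i) J - (\<Sum>j<d. B $$ (i, j) * real_of_int ((ns ! j) J))) = 0
        \<longleftrightarrow> (\<forall>k<d. (B * N') $$ (i, k) = (V * D) $$ (i, k))" (is "?l = ?r") if i: "i < d" for i
    proof
      assume ?l
      then show ?r using i by (auto simp: BN VD fun_eq_iff)
    next
      assume r: ?r
      have "ray_singer q (hs ! i) = (\<lambda>J. \<Sum>j<d. B $$ (i, j) * real_of_int ((ns ! j) J))"
      proof (rule chain_eqI[OF _ _ q])
        show "ray_singer q (hs ! i) \<in> chains q" by (auto simp: chains_def ray_singer_def)
        have "ns ! j \<in> chains q" if "j < d" for j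
          using basis that lenn unfolding integral_basis_def cycles_trivial by (meson nth_mem subsetD)
        then show "(\<lambda>J. \<Sum>j<d. B $$ (i, j) * real_of_int ((ns ! j) J)) \<in> chains q"
          by (auto simp: chains_iff)
        show "ray_singer q (hs ! i) (cell q k) = (\<Sum>j<d. B $$ (i, j) * real_of_int ((ns ! j) (cell q k)))"
          if "k < num_cells q" for k
          using r that i by (simp add: BN VD d_def)
      qed
      then show ?l by (auto simp: fun_eq_iff)
    qed
    then have "(\<forall>i<d. (\<lambda>J. ray_singer q (hs ! i) J - (\<Sum>j<d. B $$ (i, j) * real_of_int ((ns ! j) J))) \<in> {0})
        \<longleftrightarrow> (\<forall>i<d. \<forall>k<d. (B * N') $$ (i, k) = (V * D) $$ (i, k))"
      by simp
    also have "\<dots> \<longleftrightarrow> B * N' = V * D"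
    proof
      assume "\<forall>i<d. \<forall>k<d. (B * N') $$ (i, k) = (V * D) $$ (i, k)"
      then show "B * N' = V * D" using True N' V D by (intro eq_matI) auto
    qed simp
    finally show ?thesis using True by (simp add: boundaries_trivial len lenn)
  qed (simp add: len lenn)
  have "change_of_basis (\<lambda>i x. x) q hs ns = V * D * C'"
    unfolding change_of_basis_def iff
  proof (rule the_equality)
    show "V * D * C' \<in> carrier_mat d d \<and> V * D * C' * N' = V * D"
      using V D C' N' CN' assoc_mult_mat[of "V * D" d d C' d N' d] by auto
    fix B assume B: "B \<in> carrier_mat d d \<and> B * N' = V * D"
    then have "B = B * (N' * C')" by (auto simp: NC')
    also have "\<dots> = V * D * C'" using B N' C' assoc_mult_mat[of B d d N' d C' d] by auto
    finally show "B = V * D * C'" .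
  qed
  then have "Determinant.det (change_of_basis (\<lambda>i x. x) q hs ns)
      = Determinant.det V * Determinant.det D * Determinant.det C'"
    using V D C' by (simp add: det_mult[of _ d])
  moreover have "\<bar>Determinant.det V\<bar> = 1"
  proof (rule abs_eq_1_of_square)
    have "Determinant.det (V * transpose_mat V) = Determinant.det V * Determinant.det V"
      using V by (simp add: det_mult[of _ d] det_transpose)
    then show "Determinant.det V * Determinant.det V = 1" by (simp add: VVt)
  qed
  moreover have "\<bar>Determinant.det C'\<bar> = 1"
  proof -
    have "Determinant.det C * Determinant.det N = 1"
      using det_mult[OF C N] by (simp add: CN)
    then have "\<bar>Determinant.det C\<bar> = 1" using zmult_eq_1_iff by fastforce
    moreover have "Determinant.det C' = real_of_int (Determinant.det C)"
      unfolding C'_def by simp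
    ultimately show ?thesis by (metis of_int_abs of_int_1)
  qed
  moreover have "\<bar>Determinant.det D\<bar> = (if q = 0 then 2 * pi else 1)"
  proof -
    have "Determinant.det D = prod_list (diag_mat D)"
      by (rule det_upper_triangular[OF _ D]) (auto simp: D_def upper_triangular_def)
    also have "\<dots> = (\<Prod>i<d. dual_volume q i / (2 * pi))"
      by (simp add: prod_list_diag_prod D_def atLeast0LessThan)
    also have "\<bar>\<dots>\<bar> = (if q = 0 then 2 * pi else 1)"
      by (auto simp: d_def num_cells_def dual_volume_def power2_eq_square numeral_2_eq_2)
    finally show ?thesis .
  qed
  ultimately show ?thesis by (simp add: abs_mult)
qed

lemma A_comb_trivial:
  assumes harm: "\<And>q. q \<le> 1 \<Longrightarrow> harmonic_forms (\<lambda>i x. x) q = const_form ` chains q"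
    and h: "\<And>q. q \<le> 1 \<Longrightarrow> harmonic_onb (\<lambda>i x. x) q (h q)"
    and n: "\<And>q. q \<le> 1 \<Longrightarrow> integral_basis q (n q)"
  shows "A_comb 1 (\<lambda>i x. x) h n = - ln (2 * pi)"
proof -
  have "{0..1::nat} = {0, 1}" by auto
  then show ?thesis
    using abs_det_change_of_basis[OF harm _ h n, of 0] abs_det_change_of_basis[OF harm _ h n, of 1]
    by (simp add: A_comb_def torsion_order_trivial)
qed

text \<open>
  The other two terms vanish because \<open>1!! = 1\<close> and because the torus has Euler characteristic
  0.
\<close>
lemma A_analy_trivial: "A_analy 1 (\<lambda>i x. x) = cex_log_sum 1 (\<lambda>i x. x) 0 / 2"
  by (simp add: A_analy_def euler_char_trivial)

section \<open>Hartley functions on the torus\<close>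

definition phase :: "int \<times> int \<Rightarrow> pt \<Rightarrow> real" where
  "phase k x = of_int (fst k) * fst x + of_int (snd k) * snd x"

text \<open>
  The Hartley functions: a real orthogonal basis that is indexed by the whole lattice, whereas
  sines and cosines would need a choice of one frequency from each pair \<open>\<plusminus> k\<close>. Their partial
  derivatives are \<open>k\<^sub>i\<close> times the function of frequency \<open>- k\<close>.
\<close>
definition cas :: "int \<times> int \<Rightarrow> pt \<Rightarrow> real" where
  "cas k x = cos (phase k x) + sin (phase k x)"

definition freq :: "nat \<Rightarrow> int \<times> int \<Rightarrow> real" where
  "freq i k = phase k (coord_vec i)"

definition doubly_periodic :: "(pt \<Rightarrow> real) \<Rightarrow> bool" where
  "doubly_periodic f \<longleftrightarrow> (\<forall>i<2. \<forall>x. f (x + (2 * pi) *\<^sub>R coord_vec i) = f x)"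

abbreviation square :: "pt set" where
  "square \<equiv> cbox (0, 0) (2 * pi, 2 * pi)"

definition hartley :: "(pt \<Rightarrow> real) \<Rightarrow> int \<times> int \<Rightarrow> real" where
  "hartley f k = integral square (\<lambda>x. f x * cas k x)"

lemma cas_zero [simp]: "cas 0 = (\<lambda>x. 1)" "cas (0, 0) = (\<lambda>x. 1)"
  by (auto simp: cas_def phase_def)

lemma phase_diff: "phase (k - l) x = phase k x - phase l x"
  and phase_add: "phase (k + l) x = phase k x + phase l x"
  and phase_minus: "phase (- k) x = - phase k x"
  by (simp_all add: phase_def algebra_simps)

lemma cas_mult:
  "cas k x * cas l x = (cas (k - l) x + cas (l - k) x + cas (k + l) x - cas (- (k + l)) x) / 2"
  unfolding cas_def phase_diff phase_minus phase_add
  by (simp add: cos_add cos_diff sin_add sin_diff algebra_simps)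

lemma cas_continuous [continuous_intros]: "continuous_on S (cas k)"
  unfolding cas_def phase_def by (intro continuous_intros)

lemma cas_has_derivative: "(cas k has_derivative (\<lambda>v. phase k v * cas (- k) x)) (at x)"
proof -
  have "(phase k has_derivative phase k) (at x)"
    unfolding phase_def[abs_def] by (auto intro!: derivative_eq_intros)
  then have "((\<lambda>x. cos (phase k x) + sin (phase k x)) has_derivative
      (\<lambda>v. phase k v * (- sin (phase k x)) + phase k v * cos (phase k x))) (at x)"
    by (intro has_derivative_add has_derivative_cos has_derivative_sin)
  then show ?thesis
    unfolding cas_def[abs_def] phase_minus by (simp add: algebra_simps)
qed

lemma partial_eq: "(f has_derivative D) (at x) \<Longrightarrow> partial i f x = D (coord_vec i)"
  unfolding partial_def by (metis frechet_derivative_at)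

lemma partial_cas: "partial i (cas k) x = freq i k * cas (- k) x"
  using partial_eq[OF cas_has_derivative] by (simp add: freq_def)

lemma freq_minus: "freq i (- k) = - freq i k"
  by (simp add: freq_def phase_minus)

lemma freq_simps: "freq 0 k = of_int (fst k)" "freq (Suc 0) k = of_int (snd k)"
  by (simp_all add: freq_def phase_def coord_vec_def)

lemma cas_doubly_periodic: "doubly_periodic (cas k)"
proof -
  have "cos (t + 2 * pi * of_int m) = cos t" "sin (t + 2 * pi * of_int m) = sin t" for t :: real and m :: int
    by (simp_all add: cos_add sin_add)
  moreover have "phase k (x + (2 * pi) *\<^sub>R coord_vec i) = phase k x + 2 * pi * of_int (if i = 0 then fst k else snd k)" for x i
    by (simp add: phase_def coord_vec_def algebra_simps)
  ultimately show ?thesis by (simp only: doubly_periodic_def cas_def) simp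
qed

lemma iterated_deriv_Nil: "iterated_deriv [] f = f"
  and iterated_deriv_Cons: "iterated_deriv (v # vs) f = (\<lambda>x. frechet_derivative (iterated_deriv vs f) (at x) v)"
  by (simp_all add: iterated_deriv_def)

lemma smooth_imp_differentiable: "smooth_on UNIV f \<Longrightarrow> f differentiable at x"
  unfolding smooth_on_def
  by (drule spec[of _ "[]"]) (simp add: iterated_deriv_Nil differentiable_on_def)

lemma smooth_iterated_differentiable:
  "smooth_on UNIV f \<Longrightarrow> set vs \<subseteq> Basis \<Longrightarrow> iterated_deriv vs f differentiable at x"
  unfolding smooth_on_def by (auto simp: differentiable_on_def)

lemma coord_vec_Basis: "coord_vec i \<in> Basis"
  by (auto simp: coord_vec_def Basis_prod_def)

text \<open>
  Iterated derivatives take the last direction of the list first, so differentiating once more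
  in advance appends a direction to the list.
\<close>
lemma smooth_partial: "smooth_on UNIV f \<Longrightarrow> smooth_on UNIV (partial i f)"
  unfolding smooth_on_def
proof (intro allI impI)
  fix vs :: "pt list" assume f: "\<forall>vs. set vs \<subseteq> Basis \<longrightarrow> iterated_deriv vs f differentiable_on UNIV" "set vs \<subseteq> Basis"
  have "iterated_deriv vs (partial i f) = iterated_deriv (vs @ [coord_vec i]) f"
    by (simp add: iterated_deriv_def partial_def[abs_def])
  then show "iterated_deriv vs (partial i f) differentiable_on UNIV"
    using f coord_vec_Basis by auto
qed

lemma smooth_combination:
  fixes f g :: "pt \<Rightarrow> real"
  assumes f: "smooth_on UNIV f" and g: "smooth_on UNIV g"
  shows "smooth_on UNIV (\<lambda>x. a * f x + b * g x)"
proof -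
  have *: "iterated_deriv vs (\<lambda>x. a * f x + b * g x) = (\<lambda>x. a * iterated_deriv vs f x + b * iterated_deriv vs g x)"
    if "set vs \<subseteq> Basis" for vs
    using that
  proof (induction vs)
    case (Cons v vs)
    then have vs: "set vs \<subseteq> Basis" by simp
    have "((\<lambda>x. a * iterated_deriv vs f x + b * iterated_deriv vs g x) has_derivative
       (\<lambda>v. a * frechet_derivative (iterated_deriv vs f) (at x) v + b * frechet_derivative (iterated_deriv vs g) (at x) v)) (at x)" for x
      using smooth_iterated_differentiable[OF f vs, of x] smooth_iterated_differentiable[OF g vs, of x]
      unfolding frechet_derivative_works by (auto intro!: derivative_intros)
    from frechet_derivative_at[OF this, symmetric] show ?case
      using Cons vs by (simp add: iterated_deriv_Cons)
  qed (simp add: iterated_deriv_Nil)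
  show ?thesis unfolding smooth_on_def
  proof (intro allI impI)
    fix vs :: "pt list" assume vs: "set vs \<subseteq> Basis"
    show "iterated_deriv vs (\<lambda>x. a * f x + b * g x) differentiable_on UNIV"
      unfolding *[OF vs] differentiable_on_def
      using smooth_iterated_differentiable[OF f vs] smooth_iterated_differentiable[OF g vs]
      by (auto intro!: derivative_intros)
  qed
qed

lemma smooth_cas: "smooth_on UNIV (cas k)"
proof -
  have "\<exists>c j. iterated_deriv vs (cas k) = (\<lambda>x. c * cas j x)" for vs
  proof (induction vs)
    case Nil
    show ?case by (rule exI[of _ 1], rule exI[of _ k]) (simp add: iterated_deriv_Nil)
  next
    case (Cons v vs)
    then obtain c j where cj: "iterated_deriv vs (cas k) = (\<lambda>x. c * cas j x)" by blast
    have "((\<lambda>x. c * cas j x) has_derivative (\<lambda>v. c * (phase j v * cas (- j) x))) (at x)" for x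
      by (intro derivative_intros cas_has_derivative)
    from frechet_derivative_at[OF this, symmetric]
    have "iterated_deriv (v # vs) (cas k) = (\<lambda>x. (c * phase j v) * cas (- j) x)"
      by (simp add: iterated_deriv_Cons cj mult_ac)
    then show ?case by blast
  qed
  moreover have "(\<lambda>x. c * cas j x) differentiable (at x)" for c j x
    unfolding differentiable_def by (auto intro!: exI has_derivative_mult_right cas_has_derivative)
  ultimately show ?thesis unfolding smooth_on_def differentiable_on_def by metis
qed

lemma smooth_sum:
  fixes f :: "'i \<Rightarrow> pt \<Rightarrow> real"
  assumes "finite S" "\<And>i. i \<in> S \<Longrightarrow> smooth_on UNIV (f i)"
  shows "smooth_on UNIV (\<lambda>x. \<Sum>i\<in>S. c i * f i x)"
  using assms
proof (induction rule: finite_induct)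
  case empty
  show ?case using smooth_combination[OF smooth_cas smooth_cas, of 0 0 0 0] by simp
next
  case (insert i S)
  then show ?case using smooth_combination[of "f i" _ "c i" 1] by simp
qed

lemma smooth_zero: "smooth_on UNIV (\<lambda>x::pt. 0::real)"
  using smooth_sum[of "{}"] by simp

lemma smooth_continuous: "smooth_on UNIV f \<Longrightarrow> continuous_on S (f :: pt \<Rightarrow> real)"
  by (intro continuous_at_imp_continuous_on ballI differentiable_imp_continuous_within smooth_imp_differentiable)

text \<open>
  A translate of \<open>f\<close> by a period is \<open>f\<close> itself, so the derivative at \<open>x\<close> is also the one at
  the translated point.
\<close>
lemma partial_doubly_periodic:
  assumes "\<And>x. f differentiable at x" "doubly_periodic f"
  shows "doubly_periodic (partial i f)"
  unfolding doubly_periodic_def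
proof (intro allI impI)
  fix j :: nat and x :: pt assume "j < 2"
  define a where "a = (2 * pi) *\<^sub>R coord_vec j"
  have fa: "(\<lambda>x. f (x + a)) = f" using assms(2) \<open>j < 2\<close> by (auto simp: doubly_periodic_def a_def)
  obtain D where D: "(f has_derivative D) (at (x + a))" using assms(1) unfolding differentiable_def by blast
  have "((\<lambda>x. f (x + a)) has_derivative D) (at x)"
    by (rule has_derivative_compose[of "\<lambda>x. x + a" "\<lambda>v. v" x UNIV f D, simplified])
       (auto intro!: derivative_eq_intros D)
  then have "(f has_derivative D) (at x)" by (simp add: fa)
  then show "partial i f (x + (2 * pi) *\<^sub>R coord_vec j) = partial i f x"
    using partial_eq[OF D] partial_eq a_def by metis
qed

text \<open>
  Integrating first in the direction of the derivative leaves a difference of values at the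
  two ends of a period.
\<close>
lemma integral_partial_zero:
  assumes diff: "\<And>x. f differentiable at x" and per: "doubly_periodic f"
    and cont: "continuous_on UNIV (partial i f)"
  shows "integral square (partial i f) = 0"
proof -
  have "continuous_on square (partial i f)" using cont continuous_on_subset by blast
  note prod = integral_prod_continuous[OF this]
  have der: "(f has_derivative frechet_derivative f (at x)) (at x)" for x
    using diff by (simp add: frechet_derivative_works)
  show ?thesis
  proof (cases "i = 0")
    case True
    have "((\<lambda>x. partial i f (x, y)) has_integral (f (2 * pi, y) - f (0, y))) {0..2 * pi}" for y
    proof (rule fundamental_theorem_of_calculus)
      fix x
      have "((\<lambda>x. f (x, y)) has_derivative (\<lambda>t. frechet_derivative f (at (x, y)) (t, 0))) (at x)"
        by (rule has_derivative_compose[of "\<lambda>x. (x, y)" "\<lambda>t. (t, 0)" x UNIV f, simplified])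
           (auto intro!: derivative_eq_intros der)
      moreover have "frechet_derivative f (at (x, y)) (t, 0) = t * partial i f (x, y)" for t
        using linear_scale[OF has_derivative_linear[OF der], of "(x, y)" t "(1, 0)"]
        by (simp add: partial_def True coord_vec_def)
      ultimately show "((\<lambda>x. f (x, y)) has_vector_derivative partial i f (x, y)) (at x within {0..2 * pi})"
        unfolding has_vector_derivative_def by (simp add: has_derivative_at_withinI)
    qed simp
    moreover have "f (2 * pi, y) = f (0, y)" for y
      using per[unfolded doubly_periodic_def, rule_format, of 0 "(0, y)"] by (simp add: coord_vec_def)
    ultimately have inner: "integral {0..2 * pi} (\<lambda>x. partial i f (x, y)) = 0" for y
      by (auto intro!: integral_unique)
    have "integral square (partial i f) = integral {0..2*pi} (\<lambda>x. integral {0..2*pi} (\<lambda>y. partial i f (x, y)))"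
      using prod by simp
    also have "\<dots> = integral {0..2*pi} (\<lambda>y. integral {0..2*pi} (\<lambda>x. partial i f (x, y)))"
      using integral_swap_continuous[of 0 0 "2*pi" "2*pi" "\<lambda>x y. partial i f (x, y)"] cont
      by (auto intro: continuous_on_subset)
    finally show ?thesis by (simp add: inner)
  next
    case False
    have "((\<lambda>y. partial i f (x, y)) has_integral (f (x, 2 * pi) - f (x, 0))) {0..2 * pi}" for x
    proof (rule fundamental_theorem_of_calculus)
      fix y
      have "((\<lambda>y. f (x, y)) has_derivative (\<lambda>t. frechet_derivative f (at (x, y)) (0, t))) (at y)"
        by (rule has_derivative_compose[of "\<lambda>y. (x, y)" "\<lambda>t. (0, t)" y UNIV f, simplified])
           (auto intro!: derivative_eq_intros der)
      moreover have "frechet_derivative f (at (x, y)) (0, t) = t * partial i f (x, y)" for t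
        using linear_scale[OF has_derivative_linear[OF der], of "(x, y)" t "(0, 1)"] False
        by (simp add: partial_def coord_vec_def)
      ultimately show "((\<lambda>y. f (x, y)) has_vector_derivative partial i f (x, y)) (at y within {0..2 * pi})"
        unfolding has_vector_derivative_def by (simp add: has_derivative_at_withinI)
    qed simp
    moreover have "f (x, 2 * pi) = f (x, 0)" for x
      using per[unfolded doubly_periodic_def, rule_format, of 1 "(x, 0)"] by (simp add: coord_vec_def)
    ultimately have inner: "integral {0..2 * pi} (\<lambda>y. partial i f (x, y)) = 0" for x
      by (auto intro!: integral_unique)
    then show ?thesis using prod by simp
  qed
qed

lemma continuous_integrable: "continuous_on UNIV (f :: pt \<Rightarrow> real) \<Longrightarrow> f integrable_on cbox a b"
  by (rule integrable_continuous, rule continuous_on_subset) auto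

lemma hartley_combination:
  assumes "continuous_on UNIV f" "continuous_on UNIV g"
  shows "hartley (\<lambda>x. a * f x + b * g x) k = a * hartley f k + b * hartley g k"
proof -
  have "integral square (\<lambda>x. (a * f x + b * g x) * cas k x)
      = integral square (\<lambda>x. a * (f x * cas k x) + b * (g x * cas k x))"
    by (simp add: algebra_simps)
  also have "\<dots> = a * hartley f k + b * hartley g k"
    unfolding hartley_def
    by (subst integral_add) (auto intro!: continuous_integrable continuous_intros assms)
  finally show ?thesis by (simp add: hartley_def)
qed

text \<open>
  Integration by parts. The frequency changes sign because a derivative of \<open>cas k\<close> is a
  multiple of \<open>cas (- k)\<close>.
\<close>
lemma hartley_partial:
  assumes f: "smooth_on UNIV f" and per: "doubly_periodic f"
  shows "hartley (partial i f) k = - freq i k * hartley f (- k)"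
proof -
  define F where "F x = f x * cas k x" for x
  have der: "(f has_derivative frechet_derivative f (at x)) (at x)" for x
    using smooth_imp_differentiable[OF f] by (simp add: frechet_derivative_works)
  have F: "(F has_derivative (\<lambda>v. f x * (phase k v * cas (- k) x) + frechet_derivative f (at x) v * cas k x)) (at x)" for x
    unfolding F_def by (intro has_derivative_mult der cas_has_derivative)
  have pF: "partial i F = (\<lambda>x. partial i f x * cas k x + freq i k * (f x * cas (- k) x))"
    using partial_eq[OF F] by (simp add: fun_eq_iff freq_def partial_def algebra_simps)
  have c: "continuous_on UNIV (\<lambda>x. partial i f x * cas k x)" "continuous_on UNIV (\<lambda>x. f x * cas (- k) x)"
    by (intro continuous_intros smooth_continuous f smooth_partial)+
  have "integral square (partial i F) = 0"
  proof (rule integral_partial_zero)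
    show "F differentiable at x" for x using F unfolding differentiable_def by blast
    show "doubly_periodic F" using per cas_doubly_periodic by (auto simp: doubly_periodic_def F_def)
    show "continuous_on UNIV (partial i F)" unfolding pF by (intro continuous_intros c)
  qed
  also have "integral square (partial i F) = hartley (partial i f) k + freq i k * hartley f (- k)"
    unfolding pF hartley_def
    by (subst integral_add) (auto intro!: continuous_integrable c continuous_intros)
  finally show ?thesis by simp
qed

lemma hartley_partial_partial:
  assumes f: "smooth_on UNIV f" and per: "doubly_periodic f"
  shows "hartley (partial i (partial j f)) k = - freq i k * freq j k * hartley f k"
  using hartley_partial[OF smooth_partial[OF f], of j i k] hartley_partial[OF f per, of j "- k"]
    partial_doubly_periodic[OF smooth_imp_differentiable[OF f] per]
  by (simp add: freq_minus)

text \<open>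
  For \<open>k \<noteq> 0\<close> some component \<open>k\<^sub>i\<close> is nonzero, and then \<open>cas k\<close> is a multiple of the \<open>i\<close>-th
  partial derivative of \<open>cas (- k)\<close>.
\<close>
lemma integral_cas: "integral square (cas k) = (if k = 0 then (2 * pi)\<^sup>2 else 0)"
proof (cases "k = 0")
  case True
  then show ?thesis by (simp add: content_Pair power2_eq_square)
next
  case False
  then have "freq 0 k \<noteq> 0 \<or> freq 1 k \<noteq> 0"
    by (auto simp: freq_simps prod_eq_iff)
  then obtain i where "freq i k \<noteq> 0" by blast
  have "integral square (partial i (cas (- k))) = 0"
  proof (rule integral_partial_zero)
    show "continuous_on UNIV (partial i (cas (- k)))" 
      by (intro smooth_continuous smooth_partial smooth_cas)
  qed (use cas_doubly_periodic smooth_imp_differentiable[OF smooth_cas] in auto)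
  then have "integral square (\<lambda>x. (- freq i k) * cas k x) = 0"
    by (simp add: partial_cas[abs_def] freq_minus)
  then show ?thesis using \<open>freq i k \<noteq> 0\<close> False by simp
qed

lemma hartley_cas: "hartley (cas l) k = (if k = l then (2 * pi)\<^sup>2 else 0)"
proof -
  have i: "cas j integrable_on square" for j by (intro continuous_integrable continuous_intros)
  have "hartley (cas l) k = integral square (\<lambda>x. (1/2) * (cas (l - k) x + cas (k - l) x + cas (l + k) x - cas (- (l + k)) x))"
    unfolding hartley_def cas_mult by simp
  also have "\<dots> = (1/2) * (integral square (cas (l - k)) + integral square (cas (k - l))
      + integral square (cas (l + k)) - integral square (cas (- (l + k))))"
    by (simp only: integral_mult_right) (simp add: integral_diff integral_add integrable_add i)
  also have "\<dots> = (if k = l then (2 * pi)\<^sup>2 else 0)"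
    unfolding integral_cas neg_equal_0_iff_equal right_minus_eq by (simp add: eq_commute[of l k])
  finally show ?thesis .
qed

lemma hartley_sum_cas:
  assumes "finite S"
  shows "hartley (\<lambda>x. \<Sum>j\<in>S. c j * cas j x) k = (if k \<in> S then c k * (2 * pi)\<^sup>2 else 0)"
  using assms
proof (induction rule: finite_induct)
  case (insert j S)
  have "hartley (\<lambda>x. c j * cas j x + 1 * (\<Sum>j\<in>S. c j * cas j x)) k
      = c j * hartley (cas j) k + 1 * hartley (\<lambda>x. \<Sum>j\<in>S. c j * cas j x) k"
    by (intro hartley_combination continuous_intros)
  then show ?case using insert by (auto simp: hartley_cas)
qed (simp add: hartley_def)

section \<open>Completeness of the Hartley functions\<close>

inductive trig_poly :: "(pt \<Rightarrow> real) \<Rightarrow> bool" where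
  monomial: "trig_poly (\<lambda>x. c * cas k x)"
| add: "trig_poly f \<Longrightarrow> trig_poly g \<Longrightarrow> trig_poly (\<lambda>x. f x + g x)"

lemma trig_poly_const: "trig_poly (\<lambda>x. c)"
  using trig_poly.monomial[of c 0] by simp

lemma trig_poly_cmult: "trig_poly f \<Longrightarrow> trig_poly (\<lambda>x. c * f x)"
proof (induction rule: trig_poly.induct)
  case (monomial d k)
  then show ?case using trig_poly.monomial[of "c * d" k] by (simp add: mult_ac)
next
  case (add f g)
  then show ?case using trig_poly.add[of "\<lambda>x. c * f x" "\<lambda>x. c * g x"] by (simp add: algebra_simps)
qed

lemma trig_poly_mult: "trig_poly f \<Longrightarrow> trig_poly g \<Longrightarrow> trig_poly (\<lambda>x. f x * g x)"
proof (induction arbitrary: g rule: trig_poly.induct)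
  case (monomial c k)
  have "trig_poly (\<lambda>x. cas k x * g x)" using monomial
  proof (induction rule: trig_poly.induct)
    case (monomial d l)
    have "(\<lambda>x. cas k x * (d * cas l x)) = (\<lambda>x. (d / 2) * cas (k - l) x + (d / 2) * cas (l - k) x
        + ((d / 2) * cas (k + l) x + (- d / 2) * cas (- (k + l)) x))"
    proof
      fix x
      have "cas k x * (d * cas l x) = d * (cas k x * cas l x)" by simp
      then show "cas k x * (d * cas l x) = (d / 2) * cas (k - l) x + (d / 2) * cas (l - k) x
        + ((d / 2) * cas (k + l) x + (- d / 2) * cas (- (k + l)) x)"
        unfolding cas_mult by (simp add: field_simps)
    qed
    then show ?case by (simp only:) (intro trig_poly.intros)
  next
    case (add f g)
    then show ?case using trig_poly.add[of "\<lambda>x. cas k x * f x" "\<lambda>x. cas k x * g x"] by (simp add: algebra_simps)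
  qed
  then show ?case using trig_poly_cmult[of "\<lambda>x. cas k x * g x" c] by (simp add: mult_ac)
next
  case (add f1 f2)
  then show ?case using trig_poly.add[of "\<lambda>x. f1 x * g x" "\<lambda>x. f2 x * g x"] by (simp add: distrib_right)
qed

lemma trig_poly_polynomial:
  assumes "real_polynomial_function (g :: complex \<times> complex \<Rightarrow> real)"
  shows "trig_poly (\<lambda>x. g (torus_cover x))"
  using assms
proof (induction rule: real_polynomial_function.induct)
  case (linear f)
  interpret bounded_linear f by fact
  have half: "cos (fst x) = (1/2) * cas (1, 0) x + (1/2) * cas (-1, 0) x"
     "sin (fst x) = (1/2) * cas (1, 0) x + (-1/2) * cas (-1, 0) x"
     "cos (snd x) = (1/2) * cas (0, 1) x + (1/2) * cas (0, -1) x"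
     "sin (snd x) = (1/2) * cas (0, 1) x + (-1/2) * cas (0, -1) x" for x
    by (simp_all add: cas_def phase_def field_simps)
  have tp: "trig_poly (\<lambda>x. cos (fst x))" "trig_poly (\<lambda>x. sin (fst x))"
    "trig_poly (\<lambda>x. cos (snd x))" "trig_poly (\<lambda>x. sin (snd x))"
    unfolding half by (intro trig_poly.intros)+
  have "f (torus_cover x) = (f (1, 0) * cos (fst x) + f (\<i>, 0) * sin (fst x))
      + (f (0, 1) * cos (snd x) + f (0, \<i>) * sin (snd x))" for x
  proof -
    have "torus_cover x = (cos (fst x) *\<^sub>R (1, 0) + sin (fst x) *\<^sub>R (\<i>, 0))
        + (cos (snd x) *\<^sub>R (0, 1) + sin (snd x) *\<^sub>R (0, \<i>))"
      by (simp add: torus_cover_def complex_eq_iff)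
    then show ?thesis by (simp only: add scaleR) (simp add: mult.commute)
  qed
  then show ?case by (simp only:) (intro trig_poly.intros(2) trig_poly_cmult tp)
next
  case (const c)
  show ?case by (rule trig_poly_const)
qed (auto intro: trig_poly.add trig_poly_mult)

lemma doubly_periodic_int:
  assumes "doubly_periodic f"
  shows "f (x + 2 * pi * of_int m, y + 2 * pi * of_int n) = f (x, y)"
proof -
  have *: "g (z + 2 * pi * of_int m) = g z" if "\<And>z::real. g (z + 2 * pi) = g z" for g :: "real \<Rightarrow> real" and z m
  proof (induction m rule: int_induct[where k = 0])
    case (step1 i)
    then show ?case using that[of "z + 2 * pi * of_int i"] by (simp add: algebra_simps)
  next
    case (step2 i)
    then show ?case using that[of "z + 2 * pi * of_int (i - 1)"] by (simp add: algebra_simps)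
  qed simp
  have "f (z + 2 * pi, w) = f (z, w)" for z w
    using assms[unfolded doubly_periodic_def, rule_format, of 0 "(z, w)"] by (simp add: coord_vec_def)
  moreover have "f (z, w + 2 * pi) = f (z, w)" for z w
    using assms[unfolded doubly_periodic_def, rule_format, of 1 "(z, w)"] by (simp add: coord_vec_def)
  ultimately show ?thesis using *[of "\<lambda>x. f (x, y + 2 * pi * of_int n)" x m] *[of "\<lambda>y. f (x, y)" y n] by simp
qed

lemma torus_cover_eq_imp:
  assumes "doubly_periodic f" "torus_cover x = torus_cover y"
  shows "f x = f y"
proof -
  have "sin (fst x) = sin (fst y) \<and> cos (fst x) = cos (fst y)"
     "sin (snd x) = sin (snd y) \<and> cos (snd x) = cos (snd y)"
    using assms(2) by (auto simp: torus_cover_def complex_eq_iff)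
  then obtain m n :: int where "fst x = fst y + 2 * pi * of_int m" "snd x = snd y + 2 * pi * of_int n"
    unfolding sin_cos_eq_iff by auto
  then show ?thesis using doubly_periodic_int[OF assms(1), of "fst y" m "snd y" n] by (metis prod.collapse)
qed

lemma torus_cover_in_torus: "torus_cover y \<in> torus"
  by (simp add: torus_cover_def torus_def)

lemma torus_cover_square: "torus_cover ` square = torus"
proof (intro equalityI subsetI)
  fix w assume "w \<in> torus"
  then have w: "cmod (fst w) = 1" "cmod (snd w) = 1" by (auto simp: torus_def)
  have "\<exists>t\<in>{0..2*pi}. cis t = z" if "cmod z = 1" for z
  proof -
    have "cis (Arg2pi z) = z" using Arg2pi_eq[of z] that by (simp add: cis_conv_exp)
    then show ?thesis using Arg2pi[of z] by (intro bexI[of _ "Arg2pi z"]) auto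
  qed
  then obtain s t where "s \<in> {0..2*pi}" "t \<in> {0..2*pi}" "cis s = fst w" "cis t = snd w"
    using w by metis
  then show "w \<in> torus_cover ` square"
    by (intro image_eqI[of _ _ "(s, t)"]) (auto simp: torus_cover_def)
qed (use torus_cover_in_torus in blast)

text \<open>
  A doubly periodic function descends to the torus, a compact subset of \<open>\<complex>\<^sup>2\<close>, where it is a
  uniform limit of polynomials by Stone--Weierstrass. Pulled back to the plane these are
  trigonometric polynomials, to which \<open>f\<close> is orthogonal. Thus \<open>f\<close> is orthogonal to itself.
\<close>
lemma hartley_complete:
  assumes cont: "continuous_on UNIV f" and per: "doubly_periodic f"
    and zero: "\<And>k. hartley f k = 0"
  shows "f x = 0"
proof -
  define F where "F w = f (SOME x. torus_cover x = w)" for w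
  have F: "F (torus_cover x) = f x" for x
    unfolding F_def by (rule torus_cover_eq_imp[OF per]) (rule someI[of _ x], rule refl)
  have tc: "continuous_on S torus_cover" for S
    unfolding torus_cover_def by (intro continuous_intros)
  have F_cont: "continuous_on torus F"
    unfolding torus_cover_square[symmetric]
    by (rule continuous_on_compact_quotient) (auto simp: F tc intro: continuous_on_subset[OF cont])
  have "compact torus" by (simp add: torus_def compact_Times)
  have orth: "integral square (\<lambda>x. f x * h x) = 0 \<and> continuous_on UNIV h" if "trig_poly h" for h
    using that
  proof (induction rule: trig_poly.induct)
    case (monomial c k)
    have "integral square (\<lambda>x. c * (f x * cas k x)) = 0"
      using zero[of k] by (simp add: hartley_def)
    then show ?case by (auto simp: mult_ac intro!: continuous_intros)
  next
    case (add g h)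
    have "integral square (\<lambda>x. f x * g x + f x * h x) = 0"
      using add by (subst integral_add) (auto intro!: continuous_integrable continuous_intros cont)
    then show ?case using add by (auto simp: algebra_simps intro!: continuous_intros)
  qed
  have f2c: "continuous_on UNIV (\<lambda>x. f x * f x)" and fac: "continuous_on UNIV (\<lambda>x. \<bar>f x\<bar>)"
    by (intro continuous_intros cont)+
  \<comment> \<open>\<open>f\<close> is orthogonal to the approximation, so the square may be replaced by \<open>f\<close> times the error\<close>
  have bound: "integral square (\<lambda>x. f x * f x) \<le> e * integral square (\<lambda>x. \<bar>f x\<bar>)" if "e > 0" for e
  proof -
    obtain g where g: "real_polynomial_function g" "\<And>w. w \<in> torus \<Longrightarrow> \<bar>F w - g w\<bar> < e"
      using Stone_Weierstrass_real_polynomial_function[OF \<open>compact torus\<close> F_cont \<open>e > 0\<close>] by metis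
    define h where "h x = g (torus_cover x)" for x
    have h: "integral square (\<lambda>x. f x * h x) = 0" "continuous_on UNIV h"
      using orth[OF trig_poly_polynomial[OF g(1)]] by (auto simp: h_def)
    have "integral square (\<lambda>x. f x * f x) = integral square (\<lambda>x. f x * f x) - integral square (\<lambda>x. f x * h x)"
      by (simp add: h(1))
    also have "\<dots> = integral square (\<lambda>x. f x * f x - f x * h x)"
      by (intro integral_diff[symmetric] continuous_integrable continuous_intros cont h(2))
    also have "\<dots> \<le> integral square (\<lambda>x. e * \<bar>f x\<bar>)"
    proof (rule integral_le)
      fix x assume "x \<in> square"
      have "\<bar>f x - h x\<bar> < e" using g(2)[OF torus_cover_in_torus, of x] by (simp add: F h_def)
      then have "\<bar>f x\<bar> * \<bar>f x - h x\<bar> \<le> \<bar>f x\<bar> * e" by (intro mult_left_mono) auto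
      then have "\<bar>f x * (f x - h x)\<bar> \<le> e * \<bar>f x\<bar>" by (simp add: abs_mult mult.commute)
      then show "f x * f x - f x * h x \<le> e * \<bar>f x\<bar>" by (simp add: algebra_simps)
    qed (intro continuous_integrable continuous_intros cont h(2))+
    finally show ?thesis by simp
  qed
  have "integral square (\<lambda>x. f x * f x) \<le> 0"
  proof (rule field_le_epsilon)
    fix e :: real assume "e > 0"
    define B where "B = integral square (\<lambda>x. \<bar>f x\<bar>)"
    have "B \<ge> 0" unfolding B_def by (rule integral_nonneg) (auto intro: continuous_integrable fac)
    then show "integral square (\<lambda>x. f x * f x) \<le> 0 + e"
    proof -
      have "integral square (\<lambda>x. f x * f x) \<le> e / (B + 1) * B"
        using bound[of "e / (B + 1)"] \<open>e > 0\<close> \<open>B \<ge> 0\<close> by (simp add: B_def)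
      also have "\<dots> \<le> e" using \<open>e > 0\<close> \<open>B \<ge> 0\<close> by (simp add: field_simps)
      finally show ?thesis by simp
    qed
  qed
  moreover have "integral square (\<lambda>x. f x * f x) \<ge> 0"
    by (rule integral_nonneg) (auto intro: continuous_integrable f2c)
  ultimately have i0: "integral square (\<lambda>x. f x * f x) = 0" by simp
  have on_square: "f x = 0" if "x \<in> square" for x
  proof -
    have "((\<lambda>x. f x * f x) has_integral 0) square"
      using i0 continuous_integrable[OF f2c] by (metis integrable_integral)
    then have "f x * f x = 0"
      using continuous_on_subset[OF f2c, of square] that
      by (intro has_integral_0_cbox_imp_0[of "(0, 0)" "(2 * pi, 2 * pi)" "\<lambda>x. f x * f x"])
         (auto simp: box_ne_empty Basis_prod_def)
    then show ?thesis by simp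
  qed
  obtain y where "y \<in> square" "torus_cover x = torus_cover y"
    using torus_cover_square torus_cover_in_torus[of x] by (metis imageE)
  then show ?thesis using torus_cover_eq_imp[OF per] on_square by metis
qed

section \<open>Frequencies and Hartley expansions\<close>

definition norm_sq :: "int \<times> int \<Rightarrow> real" where
  "norm_sq k = (freq 0 k)\<^sup>2 + (freq 1 k)\<^sup>2"

lemma norm_sq_alt: "norm_sq k = of_int ((fst k)\<^sup>2 + (snd k)\<^sup>2)"
  by (simp add: norm_sq_def freq_simps)

lemma norm_sq_eq_0_iff: "norm_sq k = 0 \<longleftrightarrow> k = 0"
  by (auto simp: norm_sq_def freq_simps prod_eq_iff)

lemma norm_sq_ge_1: "k \<noteq> 0 \<Longrightarrow> norm_sq k \<ge> 1"
proof -
  assume "k \<noteq> 0"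
  then have "norm_sq k \<noteq> 0" by (simp add: norm_sq_eq_0_iff)
  moreover have "(fst k)\<^sup>2 + (snd k)\<^sup>2 \<ge> 0" by simp
  ultimately have "(fst k)\<^sup>2 + (snd k)\<^sup>2 \<ge> 1" unfolding norm_sq_alt by (smt (verit) of_int_0)
  then show ?thesis unfolding norm_sq_alt by linarith
qed

lemma int_abs_le_square: "\<bar>z\<bar> \<le> z\<^sup>2" for z :: int
  using self_le_power[of "\<bar>z\<bar>" 2] by (cases "z = 0") auto

lemma finite_norm_sq_le: "finite {k. norm_sq k \<le> c}"
proof (rule finite_subset)
  define N where "N = \<lfloor>c\<rfloor>"
  show "{k. norm_sq k \<le> c} \<subseteq> {-N..N} \<times> {-N..N}"
  proof
    fix k assume k: "k \<in> {k. norm_sq k \<le> c}"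
    obtain a b where ab: "k = (a, b)" by (rule prod.exhaust)
    with k have "norm_sq (a, b) \<le> c" by simp
    then have "a\<^sup>2 + b\<^sup>2 \<le> N" by (simp only: norm_sq_alt N_def le_floor_iff fst_conv snd_conv)
    then have "\<bar>a\<bar> \<le> N" "\<bar>b\<bar> \<le> N"
      using int_abs_le_square[of a] int_abs_le_square[of b] zero_le_power2[of a] zero_le_power2[of b]
      by linarith+
    then show "k \<in> {-N..N} \<times> {-N..N}" unfolding ab by auto
  qed
qed auto

definition frequencies :: "real \<Rightarrow> (int \<times> int) set" where
  "frequencies \<nu> = {k. k \<noteq> 0 \<and> norm_sq k = \<nu>}"

lemma finite_frequencies: "finite (frequencies \<nu>)"
  by (rule finite_subset[OF _ finite_norm_sq_le[of \<nu>]]) (auto simp: frequencies_def)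

text \<open>
  The difference of the two sides has vanishing coefficients.
\<close>
lemma hartley_expansion:
  assumes f: "continuous_on UNIV f" "doubly_periodic f" and K: "finite K"
    and zero: "\<And>k. k \<notin> K \<Longrightarrow> hartley f k = 0"
  shows "f = (\<lambda>x. \<Sum>k\<in>K. hartley f k / (2 * pi)\<^sup>2 * cas k x)"
proof
  fix x
  define s where "s = (\<lambda>x. \<Sum>k\<in>K. hartley f k / (2 * pi)\<^sup>2 * cas k x)"
  have sc: "continuous_on UNIV s" unfolding s_def by (intro continuous_intros)
  have "1 * f x + (-1) * s x = 0"
  proof (rule hartley_complete)
    show "continuous_on UNIV (\<lambda>x. 1 * f x + (-1) * s x)" by (intro continuous_intros f sc)
    show "doubly_periodic (\<lambda>x. 1 * f x + (-1) * s x)"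
      using f(2) cas_doubly_periodic by (simp add: doubly_periodic_def s_def)
    fix k
    have "hartley s k = (if k \<in> K then hartley f k else 0)"
      unfolding s_def hartley_sum_cas[OF K] by simp
    then show "hartley (\<lambda>x. 1 * f x + (-1) * s x) k = 0"
      unfolding hartley_combination[OF f(1) sc] using zero[of k] by simp
  qed
  then show "f x = (\<Sum>k\<in>K. hartley f k / (2 * pi)\<^sup>2 * cas k x)" by (simp add: s_def)
qed

section \<open>Harmonic forms and the co-exact spectrum\<close>

abbreviation dx0 :: "nat set" where "dx0 \<equiv> {0}"
abbreviation dx1 :: "nat set" where "dx1 \<equiv> {Suc 0}"
abbreviation dx01 :: "nat set" where "dx01 \<equiv> {0, Suc 0}"

lemma subset_01_cases:
  assumes "J \<subseteq> {0, Suc 0}" obtains "J = {}" | "J = dx0" | "J = dx1" | "J = dx01"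
proof -
  have "J \<in> Pow {0, Suc 0}" using assms by (rule PowI)
  then show thesis using that unfolding Pow_insert Pow_empty by blast
qed

lemma ext_deriv_components:
  "ext_deriv \<omega> {} x = 0"
  "ext_deriv \<omega> dx0 x = partial 0 (\<omega> {}) x"
  "ext_deriv \<omega> dx1 x = partial 1 (\<omega> {}) x"
  "ext_deriv \<omega> dx01 x = partial 0 (\<omega> dx1) x - partial 1 (\<omega> dx0) x"
proof -
  have "{i \<in> dx01. i < Suc 0} = {0}" "dx01 - {0} = dx1" "dx01 - {Suc 0} = dx0" by auto
  then show "ext_deriv \<omega> dx1 x = partial 1 (\<omega> {}) x" "ext_deriv \<omega> dx01 x = partial 0 (\<omega> dx1) x - partial 1 (\<omega> dx0) x"
    by (simp_all add: ext_deriv_def cong: conj_cong)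
qed (simp_all add: ext_deriv_def)

lemma hodge_star_outside: "\<not> J \<subseteq> {0, Suc 0} \<Longrightarrow> hodge_star \<omega> J x = 0"
  by (simp add: hodge_star_def)

lemma partial_minus: "partial i (\<lambda>x. - f x) x = - partial i f x" if "f differentiable at x"
proof -
  have "((\<lambda>x. - f x) has_derivative (\<lambda>v. - frechet_derivative f (at x) v)) (at x)"
    using that by (auto simp: frechet_derivative_works intro!: derivative_intros)
  from partial_eq[OF this] show ?thesis by (simp add: partial_def)
qed

lemma partial_const: "partial i (\<lambda>x. c) = (\<lambda>x. 0)"
  using partial_eq[OF has_derivative_const] by (auto simp: fun_eq_iff)

lemma codiff_components:
  assumes "smooth_on UNIV (\<omega> dx1)"
  shows "codiff \<omega> {} x = - partial 0 (\<omega> dx0) x - partial 1 (\<omega> dx1) x"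
    and "codiff \<omega> dx0 x = partial 1 (\<omega> dx01) x"
    and "codiff \<omega> dx1 x = - partial 0 (\<omega> dx01) x"
    and "codiff \<omega> dx01 x = 0"
proof -
  have star: "hodge_star \<omega> {} = \<omega> dx01" "hodge_star \<omega> dx0 = (\<lambda>x. - \<omega> dx1 x)" "hodge_star \<omega> dx1 = \<omega> dx0"
    by (auto simp: hodge_star_components)
  show "codiff \<omega> {} x = - partial 0 (\<omega> dx0) x - partial 1 (\<omega> dx1) x"
    "codiff \<omega> dx0 x = partial 1 (\<omega> dx01) x"
    "codiff \<omega> dx1 x = - partial 0 (\<omega> dx01) x"
    "codiff \<omega> dx01 x = 0"
    by (simp_all add: codiff_def hodge_star_components ext_deriv_components star partial_minus[OF smooth_imp_differentiable[OF assms]])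
qed

lemma codiff_outside: "\<not> J \<subseteq> {0, Suc 0} \<Longrightarrow> codiff \<omega> J x = 0"
  by (simp add: codiff_def hodge_star_outside)

lemma forms_trivial_iff:
  "\<omega> \<in> forms (\<lambda>i x. x) q \<longleftrightarrow> (\<forall>I. I \<notin> cells q \<longrightarrow> \<omega> I = (\<lambda>x. 0)) \<and>
     (\<forall>I. smooth_on UNIV (\<omega> I) \<and> doubly_periodic (\<omega> I))"
  by (auto simp: forms_def cells_def doubly_periodic_def)

lemma laplacian_function:
  assumes "\<omega> \<in> forms (\<lambda>i x. x) 0"
  shows "hodge_laplacian \<omega> {} x = - partial 0 (partial 0 (\<omega> {})) x - partial 1 (partial 1 (\<omega> {})) x"
    and "I \<noteq> {} \<Longrightarrow> hodge_laplacian \<omega> I x = 0"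
proof -
  have s: "smooth_on UNIV (\<omega> I)" for I using assms by (simp add: forms_trivial_iff)
  have z: "\<omega> I = (\<lambda>x. 0)" if "I \<noteq> {}" for I using assms that by (auto simp: forms_trivial_iff cells_0)
  have d: "ext_deriv \<omega> {} = (\<lambda>x. 0)" "ext_deriv \<omega> dx0 = partial 0 (\<omega> {})" "ext_deriv \<omega> dx1 = partial 1 (\<omega> {})"
     "ext_deriv \<omega> dx01 = (\<lambda>x. 0)"
    by (auto simp: fun_eq_iff ext_deriv_components z partial_const)
  have dd: "smooth_on UNIV (ext_deriv \<omega> dx1)"
    unfolding d by (intro smooth_partial s)
  have \<delta>: "codiff \<omega> = 0"
  proof (intro ext)
    fix J x
    have *: "smooth_on UNIV (\<omega> dx1)" by (rule s)
    show "codiff \<omega> J x = 0 J x"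
    proof (cases "J \<subseteq> {0, Suc 0}")
      case True
      then show ?thesis
        by (cases rule: subset_01_cases) (simp_all add: codiff_components[of \<omega>, OF *] z partial_const)
    qed (simp add: codiff_outside)
  qed
  have d0: "ext_deriv 0 = 0"
  proof (intro ext)
    fix J x
    have "partial i (0 :: pt \<Rightarrow> real) x = 0" for i
      using partial_const[of i 0] by (simp add: zero_fun_def)
    then show "ext_deriv 0 J x = 0 J x" by (simp add: ext_deriv_def)
  qed
  show "hodge_laplacian \<omega> {} x = - partial 0 (partial 0 (\<omega> {})) x - partial 1 (partial 1 (\<omega> {})) x"
    by (simp add: hodge_laplacian_def \<delta> d0 codiff_components[of "ext_deriv \<omega>", OF dd] d)
  show "hodge_laplacian \<omega> I x = 0" if "I \<noteq> {}"
  proof (cases "I \<subseteq> {0, Suc 0}")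
    case True
    then show ?thesis using that
      by (cases rule: subset_01_cases) (simp_all add: hodge_laplacian_def \<delta> d0 codiff_components[of "ext_deriv \<omega>", OF dd] d partial_const)
  qed (simp add: hodge_laplacian_def \<delta> d0 codiff_outside)
qed

lemma hartley_minus_combination:
  assumes "smooth_on UNIV f" "smooth_on UNIV g"
  shows "hartley (\<lambda>x. - f x - g x) k = - hartley f k - hartley g k"
    "hartley (\<lambda>x. f x - g x) k = hartley f k - hartley g k"
  using hartley_combination[OF assms[THEN smooth_continuous], of "-1" "-1" k]
    hartley_combination[OF assms[THEN smooth_continuous], of 1 "-1" k] by simp_all

lemma smooth_minus_combination:
  fixes f g :: "pt \<Rightarrow> real"
  assumes "smooth_on UNIV f" "smooth_on UNIV g"
  shows "smooth_on UNIV (\<lambda>x. - f x - g x)" "smooth_on UNIV (\<lambda>x. f x - g x)"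
  using smooth_combination[OF assms, of "-1" "-1"] smooth_combination[OF assms, of 1 "-1"] by simp_all

lemma hartley_laplacian_function:
  assumes \<omega>: "\<omega> \<in> forms (\<lambda>i x. x) 0"
  shows "hartley (hodge_laplacian \<omega> {}) k = norm_sq k * hartley (\<omega> {}) k"
proof -
  have s: "smooth_on UNIV (\<omega> {})" "doubly_periodic (\<omega> {})" using \<omega> by (auto simp: forms_trivial_iff)
  have "hodge_laplacian \<omega> {} = (\<lambda>x. - partial 0 (partial 0 (\<omega> {})) x - partial 1 (partial 1 (\<omega> {})) x)"
    using laplacian_function(1)[OF \<omega>] by blast
  then show ?thesis
    by (simp add: hartley_minus_combination smooth_partial s hartley_partial_partial norm_sq_def power2_eq_square algebra_simps)
qed

text \<open>
  On coefficients each \<open>\<partial>\<^sub>i \<partial>\<^sub>j\<close> acts as multiplication by \<open>- k\<^sub>i k\<^sub>j\<close>, which is symmetric in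
  \<open>i\<close> and \<open>j\<close>, so the mixed terms of \<open>d \<delta> + \<delta> d\<close> cancel.
\<close>
lemma hartley_laplacian_1_form:
  assumes \<omega>: "\<omega> \<in> forms (\<lambda>i x. x) 1" and I: "I \<in> cells 1"
  shows "hartley (hodge_laplacian \<omega> I) k = norm_sq k * hartley (\<omega> I) k"
proof -
  have s: "smooth_on UNIV (\<omega> I)" "doubly_periodic (\<omega> I)" for I using \<omega> by (auto simp: forms_trivial_iff)
  have z: "\<omega> {} = (\<lambda>x. 0)" "\<omega> dx01 = (\<lambda>x. 0)" using \<omega> by (auto simp: forms_trivial_iff cells_def)
  have d1: "smooth_on UNIV (\<omega> dx1)" by (rule s)
  define \<delta> where "\<delta> = codiff \<omega> {}"
  define \<eta> where "\<eta> = ext_deriv \<omega> dx01"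
  have \<delta>: "\<delta> = (\<lambda>x. - partial 0 (\<omega> dx0) x - partial 1 (\<omega> dx1) x)"
    unfolding \<delta>_def using codiff_components(1)[of \<omega>, OF d1] by blast
  have \<eta>: "\<eta> = (\<lambda>x. partial 0 (\<omega> dx1) x - partial 1 (\<omega> dx0) x)"
    unfolding \<eta>_def using ext_deriv_components(4) by blast
  have sm: "smooth_on UNIV \<delta>" "smooth_on UNIV \<eta>"
    unfolding \<delta> \<eta> by (intro smooth_minus_combination smooth_partial s)+
  have pp: "doubly_periodic (partial i (\<omega> I))" for i I
    by (intro partial_doubly_periodic smooth_imp_differentiable s)
  have per: "doubly_periodic \<delta>" "doubly_periodic \<eta>"
    using pp by (auto simp: doubly_periodic_def \<delta> \<eta>)
  have z1: "ext_deriv \<omega> dx1 = (\<lambda>x. 0)" by (simp add: fun_eq_iff ext_deriv_components z partial_const)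
  have d2: "smooth_on UNIV (ext_deriv \<omega> dx1)" unfolding z1 by (rule smooth_zero)
  have L0: "hodge_laplacian \<omega> dx0 = (\<lambda>x. 1 * partial 0 \<delta> x + 1 * partial 1 \<eta> x)"
    by (simp add: fun_eq_iff hodge_laplacian_def ext_deriv_components codiff_components[of "ext_deriv \<omega>", OF d2] \<delta>_def \<eta>_def)
  have L1: "hodge_laplacian \<omega> dx1 = (\<lambda>x. 1 * partial 1 \<delta> x + (-1) * partial 0 \<eta> x)"
    by (simp add: fun_eq_iff hodge_laplacian_def ext_deriv_components codiff_components[of "ext_deriv \<omega>", OF d2] \<delta>_def \<eta>_def)
  have h\<delta>: "hartley \<delta> j = freq 0 j * hartley (\<omega> dx0) (- j) + freq 1 j * hartley (\<omega> dx1) (- j)" for j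
    unfolding \<delta> by (simp add: hartley_minus_combination smooth_partial s hartley_partial)
  have h\<eta>: "hartley \<eta> j = - freq 0 j * hartley (\<omega> dx1) (- j) + freq 1 j * hartley (\<omega> dx0) (- j)" for j
    unfolding \<eta> by (simp add: hartley_minus_combination smooth_partial s hartley_partial)
  note comb = hartley_combination[OF smooth_continuous smooth_continuous, OF smooth_partial smooth_partial]
  from I have "I = dx0 \<or> I = dx1" by (auto simp: cells_1[unfolded One_nat_def])
  then show ?thesis
  proof
    assume "I = dx0"
    then show ?thesis
      by (simp only: L0 comb[OF sm] hartley_partial[OF sm(1) per(1)] hartley_partial[OF sm(2) per(2)] h\<delta> h\<eta> freq_minus minus_minus)
         (simp add: norm_sq_def power2_eq_square algebra_simps)
  next
    assume "I = dx1"
    then show ?thesis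
      by (simp only: L1 comb[OF sm] hartley_partial[OF sm(1) per(1)] hartley_partial[OF sm(2) per(2)] h\<delta> h\<eta> freq_minus minus_minus)
         (simp add: norm_sq_def power2_eq_square algebra_simps)
  qed
qed

lemma smooth_const: "smooth_on UNIV (\<lambda>x::pt. c::real)"
  using smooth_combination[OF smooth_cas[of 0] smooth_zero, of c 0] by simp

lemma laplacian_const_form: "hodge_laplacian (const_form a) = 0"
proof -
  have d: "ext_deriv (const_form b) = const_form (\<lambda>I. 0)" for b
    by (auto simp: fun_eq_iff ext_deriv_def const_form_def partial_const)
  have s: "\<exists>c. hodge_star (const_form b) = const_form c" for b
    by (rule exI[of _ "\<lambda>I. hodge_star (const_form b) I 0"])
       (auto simp: fun_eq_iff hodge_star_def const_form_def)
  have "codiff (const_form b) = 0" for b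
    unfolding codiff_def using s[of b] by (auto simp: d) (auto simp: fun_eq_iff hodge_star_def const_form_def)
  then show ?thesis
    by (auto simp: hodge_laplacian_def d) (simp add: fun_eq_iff ext_deriv_def partial_const zero_fun_def)
qed

text \<open>
  The coefficients of a harmonic form are killed by \<open>\<bar>k\<bar>\<^sup>2\<close>, hence vanish for \<open>k \<noteq> 0\<close>.
\<close>
lemma harmonic_forms_trivial:
  assumes q: "q \<le> 1"
  shows "harmonic_forms (\<lambda>i x. x) q = const_form ` chains q"
proof (intro equalityI subsetI)
  fix \<omega> assume "\<omega> \<in> harmonic_forms (\<lambda>i x. x) q"
  then have \<omega>: "\<omega> \<in> forms (\<lambda>i x. x) q" and harm: "hodge_laplacian \<omega> = 0"
    by (auto simp: harmonic_forms_def)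
  have const: "\<omega> I = (\<lambda>x. hartley (\<omega> I) 0 / (2 * pi)\<^sup>2)" if I: "I \<in> cells q" for I
  proof -
    have "hartley (hodge_laplacian \<omega> I) k = norm_sq k * hartley (\<omega> I) k" for k
    proof (cases "q = 0")
      case True
      then show ?thesis using hartley_laplacian_function[of \<omega>] \<omega> I by (auto simp: cells_0)
    next
      case False
      then have "q = 1" using q by simp
      then show ?thesis using hartley_laplacian_1_form[of \<omega> I] \<omega> I by auto
    qed
    moreover have "hartley (hodge_laplacian \<omega> I) k = 0" for k
      unfolding harm hartley_def by simp
    ultimately have eq: "norm_sq k * hartley (\<omega> I) k = 0" for k by metis
    have "hartley (\<omega> I) k = 0" if "k \<notin> {0}" for k
      using that eq[of k] by (simp add: norm_sq_eq_0_iff)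
    then have "\<omega> I = (\<lambda>x. \<Sum>k\<in>{0}. hartley (\<omega> I) k / (2 * pi)\<^sup>2 * cas k x)"
      using \<omega> by (intro hartley_expansion smooth_continuous) (auto simp only: forms_trivial_iff finite.intros)
    then show ?thesis by simp
  qed
  define a where "a I = (if I \<in> cells q then hartley (\<omega> I) 0 / (2 * pi)\<^sup>2 else 0)" for I
  have "\<omega> = const_form a"
  proof
    fix I
    show "\<omega> I = const_form a I"
      using const[of I] \<omega> by (auto simp: const_form_def a_def forms_trivial_iff)
  qed
  moreover have "a \<in> chains q" by (simp add: chains_iff a_def)
  ultimately show "\<omega> \<in> const_form ` chains q" by blast
next
  fix \<omega> :: form assume "\<omega> \<in> const_form ` chains q"
  then obtain a where a: "a \<in> chains q" "\<omega> = const_form a" by blast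
  then have "hodge_laplacian \<omega> = 0" by (simp add: laplacian_const_form)
  moreover from a have "\<omega> \<in> forms (\<lambda>i x. x) q"
    by (auto simp: forms_trivial_iff chains_iff const_form_def smooth_const doubly_periodic_def)
  ultimately show "\<omega> \<in> harmonic_forms (\<lambda>i x. x) q" by (simp add: harmonic_forms_def)
qed

text \<open>
  A function, regarded as a form of degree 0.
\<close>
definition function_form :: "(pt \<Rightarrow> real) \<Rightarrow> form" where
  "function_form f = (\<lambda>I. if I = {} then f else (\<lambda>x. 0))"

lemma function_form_sum: "(\<Sum>k\<in>K. form_scale (c k) (function_form (f k))) = function_form (\<lambda>x. \<Sum>k\<in>K. c k * f k x)"
proof (intro ext)
  fix I x
  show "(\<Sum>k\<in>K. form_scale (c k) (function_form (f k))) I x = function_form (\<lambda>x. \<Sum>k\<in>K. c k * f k x) I x"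
    by (simp add: sum_apply form_scale_def function_form_def)
qed

lemma partial_sum_cas: 
  "partial i (\<lambda>x. \<Sum>k\<in>K. c k * cas k x) x = (\<Sum>k\<in>K. c k * (freq i k * cas (- k) x))"
proof -
  have "((\<lambda>x. \<Sum>k\<in>K. c k * cas k x) has_derivative (\<lambda>v. \<Sum>k\<in>K. c k * (phase k v * cas (- k) x))) (at x)"
    by (intro has_derivative_sum has_derivative_mult_right cas_has_derivative)
  from partial_eq[OF this] show ?thesis by (simp add: freq_def)
qed

lemma partial_partial_sum_cas: 
  assumes "finite K"
  shows "partial i (partial i (\<lambda>x. \<Sum>k\<in>K. c k * cas k x)) x = (\<Sum>k\<in>K. - (freq i k)\<^sup>2 * c k * cas k x)"
proof -
  have "((\<lambda>x. \<Sum>k\<in>K. c k * (freq i k * cas (- k) x)) has_derivative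
      (\<lambda>v. \<Sum>k\<in>K. c k * (freq i k * (phase (- k) v * cas (- (- k)) x)))) (at x)"
    by (intro has_derivative_sum has_derivative_mult_right cas_has_derivative)
  from partial_eq[OF this] show ?thesis
    by (simp add: partial_sum_cas[abs_def] freq_def[symmetric] freq_minus power2_eq_square mult_ac)
qed

text \<open>
  A co-exact function is a divergence and has mean 0, which excludes the frequency 0; the
  eigenvalue equation confines the other coefficients to \<open>\<bar>k\<bar>\<^sup>2 = \<nu>\<close>. Conversely an
  eigenfunction \<open>f\<close> with \<open>\<nu> \<noteq> 0\<close> is the codifferential of \<open>df / \<nu>\<close>. For \<open>\<nu> = 0\<close> there are no
  frequencies and both sides consist of 0 only.
\<close>
lemma coexact_eigenspace_trivial:
  "coexact_eigenspace (\<lambda>i x. x) 0 \<nu>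
     = range (\<lambda>c. function_form (\<lambda>x. \<Sum>k\<in>frequencies \<nu>. c k * cas k x))"
proof (intro equalityI subsetI)
  fix \<omega> assume "\<omega> \<in> coexact_eigenspace (\<lambda>i x. x) 0 \<nu>"
  then obtain \<eta> where \<eta>: "\<eta> \<in> forms (\<lambda>i x. x) 1" "\<omega> = codiff \<eta>" and ev: "hodge_laplacian \<omega> = form_scale \<nu> \<omega>"
    by (auto simp: coexact_eigenspace_def)
  have s: "smooth_on UNIV (\<eta> I)" "doubly_periodic (\<eta> I)" for I using \<eta> by (auto simp: forms_trivial_iff)
  have z: "\<eta> {} = (\<lambda>x. 0)" "\<eta> dx01 = (\<lambda>x. 0)" using \<eta> by (auto simp: forms_trivial_iff cells_def)
  have d1: "smooth_on UNIV (\<eta> dx1)" by (rule s)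
  define f where "f = \<omega> {}"
  have f: "f = (\<lambda>x. - partial 0 (\<eta> dx0) x - partial 1 (\<eta> dx1) x)"
    unfolding f_def \<eta> using codiff_components(1)[of \<eta>, OF d1] by blast
  have sf: "smooth_on UNIV f" unfolding f by (intro smooth_minus_combination smooth_partial s)
  have pp: "doubly_periodic (partial i (\<eta> I))" for i I
    by (intro partial_doubly_periodic smooth_imp_differentiable s)
  have pf: "doubly_periodic f" using pp by (auto simp: f doubly_periodic_def)
  have \<omega>f: "\<omega> = function_form f"
  proof (intro ext)
    fix I x
    show "\<omega> I x = function_form f I x"
    proof (cases "I \<subseteq> {0, Suc 0}")
      case True
      then show ?thesis
        by (cases rule: subset_01_cases)
           (simp_all add: function_form_def f_def, simp_all add: \<eta>(2) codiff_components[of \<eta>, OF d1] z partial_const)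
    qed (auto simp: function_form_def \<eta>(2) codiff_outside)
  qed
  have \<omega>0: "\<omega> \<in> forms (\<lambda>i x. x) 0"
    using sf pf by (auto simp: forms_trivial_iff cells_0 \<omega>f function_form_def smooth_zero doubly_periodic_def)
  have eig: "norm_sq k * hartley f k = \<nu> * hartley f k" for k
  proof -
    have "norm_sq k * hartley f k = hartley (\<lambda>x. \<nu> * f x) k"
      using hartley_laplacian_function[OF \<omega>0, of k] unfolding ev by (simp add: f_def form_scale_def)
    also have "\<dots> = \<nu> * hartley f k"
      using hartley_combination[OF smooth_continuous[OF sf] smooth_continuous[OF sf], of \<nu> 0 k] by simp
    finally show ?thesis .
  qed
  have h0: "hartley f 0 = 0"
    using hartley_minus_combination(1)[OF smooth_partial[OF s(1)[of dx0]] smooth_partial[OF s(1)[of dx1]], of 0 1 0]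
      hartley_partial[OF s[of dx0], of 0 0] hartley_partial[OF s[of dx1], of 1 0]
    by (simp add: f freq_simps)
  have "f = (\<lambda>x. \<Sum>k\<in>frequencies \<nu>. hartley f k / (2 * pi)\<^sup>2 * cas k x)"
    by (rule hartley_expansion[OF smooth_continuous[OF sf] pf finite_frequencies])
       (use eig h0 in \<open>auto simp: frequencies_def\<close>)
  then have "\<omega> = function_form (\<lambda>x. \<Sum>k\<in>frequencies \<nu>. hartley f k / (2 * pi)\<^sup>2 * cas k x)"
    unfolding \<omega>f by (rule arg_cong[where f = function_form])
  then show "\<omega> \<in> range (\<lambda>c. function_form (\<lambda>x. \<Sum>k\<in>frequencies \<nu>. c k * cas k x))"
    by (rule range_eqI[where x = "\<lambda>k. hartley f k / (2 * pi)\<^sup>2"])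
next
  fix \<omega> assume "\<omega> \<in> range (\<lambda>c. function_form (\<lambda>x. \<Sum>k\<in>frequencies \<nu>. c k * cas k x))"
  then obtain c where \<omega>: "\<omega> = function_form (\<lambda>x. \<Sum>k\<in>frequencies \<nu>. c k * cas k x)" by blast
  define f where "f = (\<lambda>x. \<Sum>k\<in>frequencies \<nu>. c k * cas k x)"
  have sf: "smooth_on UNIV f" unfolding f_def by (intro smooth_sum finite_frequencies smooth_cas)
  have pf: "doubly_periodic f" using cas_doubly_periodic by (simp add: f_def doubly_periodic_def)
  have lap: "- partial 0 (partial 0 f) x - partial 1 (partial 1 f) x = \<nu> * f x" for x
  proof -
    have "- partial 0 (partial 0 f) x - partial 1 (partial 1 f) x = (\<Sum>k\<in>frequencies \<nu>. norm_sq k * c k * cas k x)"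
      unfolding f_def partial_partial_sum_cas[OF finite_frequencies]
      by (simp add: norm_sq_def algebra_simps sum.distrib sum_negf)
    also have "\<dots> = (\<Sum>k\<in>frequencies \<nu>. \<nu> * (c k * cas k x))"
      by (rule sum.cong) (auto simp: frequencies_def)
    finally show ?thesis by (simp add: f_def sum_distrib_left)
  qed
  have \<nu>f: "\<nu> = 0 \<Longrightarrow> f x = 0" for x
    by (auto simp: f_def frequencies_def norm_sq_eq_0_iff intro!: sum.neutral)
  have \<omega>0: "\<omega> \<in> forms (\<lambda>i x. x) 0"
    using sf pf by (auto simp: forms_trivial_iff cells_0 \<omega> f_def[symmetric] function_form_def smooth_zero doubly_periodic_def)
  \<comment> \<open>\<open>df / \<nu>\<close>; for \<open>\<nu> = 0\<close> it is 0 by the convention for division, as is \<open>f\<close>\<close>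
  define \<eta> where "\<eta> = (\<lambda>I x. if I = dx0 then partial 0 f x / \<nu> else if I = dx1 then partial 1 f x / \<nu> else 0)"
  have sp: "smooth_on UNIV (\<lambda>x. partial i f x / \<nu>)" for i
    using smooth_combination[OF smooth_partial[OF sf] smooth_zero, of "1 / \<nu>" i 0] by simp
  have pp: "doubly_periodic (\<lambda>x. partial i f x / \<nu>)" for i
    using partial_doubly_periodic[OF smooth_imp_differentiable[OF sf] pf] by (simp add: doubly_periodic_def)
  have \<eta>_comp: "\<eta> dx0 = (\<lambda>x. partial 0 f x / \<nu>)" "\<eta> dx1 = (\<lambda>x. partial 1 f x / \<nu>)" "\<eta> dx01 = (\<lambda>x. 0)"
    "I \<noteq> dx0 \<Longrightarrow> I \<noteq> dx1 \<Longrightarrow> \<eta> I = (\<lambda>x. 0)" for I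
    by (auto simp: \<eta>_def fun_eq_iff)
  have \<eta>: "\<eta> \<in> forms (\<lambda>i x. x) 1"
    unfolding forms_trivial_iff
  proof (intro conjI allI impI)
    fix I
    show "smooth_on UNIV (\<eta> I)" "doubly_periodic (\<eta> I)"
      by (cases "I = dx0"; cases "I = dx1"; simp add: \<eta>_comp sp pp smooth_zero doubly_periodic_def; fail)+
    show "I \<notin> cells 1 \<Longrightarrow> \<eta> I = (\<lambda>x. 0)" by (auto simp: cells_1[unfolded One_nat_def] \<eta>_comp)
  qed
  have d1: "smooth_on UNIV (\<eta> dx1)" unfolding \<eta>_comp by (rule sp)
  have pdiv: "partial i (\<lambda>x. partial i f x / \<nu>) x = partial i (partial i f) x / \<nu>" for i x
  proof -
    have "((\<lambda>x. partial i f x / \<nu>) has_derivative (\<lambda>v. frechet_derivative (partial i f) (at x) v / \<nu>)) (at x)"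
      using smooth_imp_differentiable[OF smooth_partial[OF sf]]
      unfolding divide_inverse by (intro has_derivative_mult_left) (simp add: frechet_derivative_works)
    from partial_eq[OF this] show ?thesis by (simp add: partial_def)
  qed
  have "codiff \<eta> = \<omega>"
  proof (intro ext)
    fix I x
    show "codiff \<eta> I x = \<omega> I x"
    proof (cases "I \<subseteq> {0, Suc 0}")
      case True
      then show ?thesis
      proof (cases rule: subset_01_cases)
        case 1
        have "codiff \<eta> {} x = (- partial 0 (partial 0 f) x - partial 1 (partial 1 f) x) / \<nu>"
          unfolding codiff_components(1)[of \<eta>, OF d1] \<eta>_comp pdiv by (simp add: diff_divide_distrib)
        also have "\<dots> = f x" unfolding lap using \<nu>f[of x] by auto
        finally show ?thesis using 1 by (simp add: \<omega> f_def function_form_def)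
      qed (simp_all add: codiff_components[of \<eta>, OF d1] \<eta>_comp partial_const \<omega> function_form_def)
    qed (auto simp: codiff_outside \<omega> function_form_def)
  qed
  moreover have "hodge_laplacian \<omega> = form_scale \<nu> \<omega>"
  proof (intro ext)
    fix I x
    show "hodge_laplacian \<omega> I x = form_scale \<nu> \<omega> I x"
    proof (cases "I = {}")
      case True
      have "\<omega> {} = f" by (simp add: \<omega> f_def function_form_def)
      then show ?thesis using laplacian_function(1)[OF \<omega>0, of x] lap[of x] True by (simp add: form_scale_def)
    next
      case False
      then show ?thesis using laplacian_function(2)[OF \<omega>0 False, of x] by (simp add: form_scale_def \<omega> function_form_def)
    qed
  qed
  ultimately show "\<omega> \<in> coexact_eigenspace (\<lambda>i x. x) 0 \<nu>"
    using \<eta> by (auto simp: coexact_eigenspace_def)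
qed

lemma coexact_mult_trivial: "coexact_mult (\<lambda>i x. x) 0 \<nu> = card (frequencies \<nu>)"
  unfolding coexact_mult_def
proof (rule form.dim_eq_card_of_coordinates[where \<phi> = "\<lambda>k \<omega>. hartley (\<omega> {}) k / (2 * pi)\<^sup>2"
      and v = "\<lambda>k. function_form (cas k)"])
  show "finite (frequencies \<nu>)" by (rule finite_frequencies)
  show "hartley ((\<Sum>j\<in>frequencies \<nu>. form_scale (c j) (function_form (cas j))) {}) k / (2 * pi)\<^sup>2 = c k"
    if "k \<in> frequencies \<nu>" for c k
    using that unfolding function_form_sum by (simp add: function_form_def hartley_sum_cas[OF finite_frequencies])
  show "(\<Sum>j\<in>frequencies \<nu>. form_scale (c j) (function_form (cas j))) \<in> coexact_eigenspace (\<lambda>i x. x) 0 \<nu>" for c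
    unfolding function_form_sum coexact_eigenspace_trivial by blast
  show "\<exists>c. \<omega> = (\<Sum>j\<in>frequencies \<nu>. form_scale (c j) (function_form (cas j)))"
    if "\<omega> \<in> coexact_eigenspace (\<lambda>i x. x) 0 \<nu>" for \<omega>
    using that unfolding function_form_sum coexact_eigenspace_trivial by blast
qed

lemma coexact_spectrum_trivial: "coexact_spectrum (\<lambda>i x. x) 0 = norm_sq ` (- {0})"
proof -
  have "coexact_eigenspace (\<lambda>i x. x) 0 \<nu> \<noteq> {0} \<longleftrightarrow> frequencies \<nu> \<noteq> {}" for \<nu>
  proof
    assume ne: "coexact_eigenspace (\<lambda>i x. x) 0 \<nu> \<noteq> {0}"
    show "frequencies \<nu> \<noteq> {}"
    proof
      assume "frequencies \<nu> = {}"
      then have "coexact_eigenspace (\<lambda>i x. x) 0 \<nu> = {0}"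
        unfolding coexact_eigenspace_trivial by (auto simp: function_form_def zero_fun_def)
      with ne show False by simp
    qed
  next
    assume "frequencies \<nu> \<noteq> {}"
    then have "coexact_mult (\<lambda>i x. x) 0 \<nu> > 0"
      by (simp add: coexact_mult_trivial card_gt_0_iff finite_frequencies)
    moreover have "form.dim {0} = 0"
      by (rule form.dim_eq_card_of_coordinates[of "{}", simplified]) auto
    ultimately show "coexact_eigenspace (\<lambda>i x. x) 0 \<nu> \<noteq> {0}"
      unfolding coexact_mult_def by (metis less_irrefl)
  qed
  then show ?thesis by (auto simp: coexact_spectrum_def frequencies_def)
qed

section \<open>Summation and integration over countable index sets\<close>

text \<open>
  Fubini's theorem for an unordered sum and an integral, obtained by enumerating the index
  set.
\<close>
lemma has_sum_integral:
  fixes f :: "'i \<Rightarrow> 'a \<Rightarrow> 'b::{banach, second_countable_topology}"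
  assumes I: "countable I" "infinite I"
    and int: "\<And>i. i \<in> I \<Longrightarrow> integrable M (f i)"
    and ptw: "\<And>x. x \<in> space M \<Longrightarrow> ((\<lambda>i. f i x) has_sum g x) I"
    and nrm: "\<And>x. x \<in> space M \<Longrightarrow> (\<lambda>i. norm (f i x)) summable_on I"
    and sum: "(\<lambda>i. \<integral>x. norm (f i x) \<partial>M) summable_on I"
  shows "integrable M g" "((\<lambda>i. \<integral>x. f i x \<partial>M) has_sum (\<integral>x. g x \<partial>M)) I"
proof -
  define e where "e = from_nat_into I"
  have bij: "bij_betw e UNIV I" unfolding e_def by (rule bij_betw_from_nat_into[OF I])
  have eI: "e n \<in> I" for n using bij by (auto simp: bij_betw_def)
  have nat_summable: "summable (\<lambda>n. h (e n))" if "h summable_on I" for h :: "'i \<Rightarrow> real"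
  proof -
    have "(\<lambda>n. h (e n)) summable_on UNIV" using that summable_on_reindex_bij_betw[OF bij] by blast
    then obtain S where "((\<lambda>n. h (e n)) has_sum S) UNIV" by (auto simp: summable_on_def)
    then show ?thesis by (intro sums_summable[OF has_sum_imp_sums])
  qed
  have F_int: "integrable M (f (e n))" for n by (rule int[OF eI])
  have s1: "AE x in M. summable (\<lambda>n. norm (f (e n) x))"
    by (intro AE_I2 nat_summable nrm)
  have s2: "summable (\<lambda>n. \<integral>x. norm (f (e n) x) \<partial>M)"
    by (rule nat_summable[OF sum])
  have g: "g x = (\<Sum>n. f (e n) x)" if "x \<in> space M" for x
  proof (intro sums_unique has_sum_imp_sums)
    show "((\<lambda>n. f (e n) x) has_sum g x) UNIV"
      using ptw[OF that] by (simp only: has_sum_reindex_bij_betw[OF bij, of "\<lambda>i. f i x"])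
  qed
  have "integrable M (\<lambda>x. \<Sum>n. f (e n) x)"
    by (rule integrable_suminf[OF F_int s1 s2])
  then show "integrable M g"
    by (subst Bochner_Integration.integrable_cong[OF refl]) (auto simp: g)
  have sums: "(\<lambda>n. \<integral>x. f (e n) x \<partial>M) sums (\<integral>x. (\<Sum>n. f (e n) x) \<partial>M)"
    by (rule sums_integral[OF F_int s1 s2])
  have eq: "(\<integral>x. (\<Sum>n. f (e n) x) \<partial>M) = (\<integral>x. g x \<partial>M)"
    by (intro Bochner_Integration.integral_cong) (auto simp: g)
  have "summable (\<lambda>n. norm (\<integral>x. f (e n) x \<partial>M))"
    by (rule summable_comparison_test[OF _ s2]) (auto intro!: exI[of _ 0] integral_norm_bound)
  from norm_summable_imp_has_sum[OF this sums]
  have "((\<lambda>n. \<integral>x. f (e n) x \<partial>M) has_sum (\<integral>x. g x \<partial>M)) UNIV" unfolding eq .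
  then show "((\<lambda>i. \<integral>x. f i x \<partial>M) has_sum (\<integral>x. g x \<partial>M)) I"
    by (simp only: has_sum_reindex_bij_betw[OF bij, of "\<lambda>i. \<integral>x. f i x \<partial>M"])
qed

text \<open>
  An even function on the integers: the value at 0 is counted once, every other value twice.
\<close>
lemma has_sum_int_abs:
  fixes f :: "nat \<Rightarrow> real"
  assumes "f sums S" "\<And>n. 0 \<le> f n"
  shows "((\<lambda>m::int. f (nat \<bar>m\<bar>)) has_sum (2 * S - f 0)) UNIV"
proof -
  have nonneg: "((\<lambda>m::int. f (nat \<bar>m\<bar>)) has_sum S) {0..}"
  proof -
    have "bij_betw int UNIV {0..}"
      by (rule bij_betwI[where g = nat]) auto
    from has_sum_reindex_bij_betw[OF this, of "\<lambda>m. f (nat \<bar>m\<bar>)"] show ?thesis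
      using sums_nonneg_imp_has_sum[OF assms(1)] assms(2) by simp
  qed
  have "(\<lambda>n. f (Suc n)) sums (S - f 0)" using assms(1) by (simp add: sums_Suc_iff)
  then have "((\<lambda>n. f (Suc n)) has_sum (S - f 0)) UNIV"
    using assms(2) by (intro sums_nonneg_imp_has_sum) auto
  moreover have "bij_betw (\<lambda>n. - int (Suc n)) UNIV {..<0}"
    by (rule bij_betwI[where g = "\<lambda>m. nat (- m) - 1"]) auto
  from has_sum_reindex_bij_betw[OF this, of "\<lambda>m. f (nat \<bar>m\<bar>)"]
  have "((\<lambda>n. f (Suc n)) has_sum (S - f 0)) UNIV \<longleftrightarrow> ((\<lambda>m::int. f (nat \<bar>m\<bar>)) has_sum (S - f 0)) {..<0}"
    by (simp add: nat_add_distrib)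
  ultimately have neg: "((\<lambda>m::int. f (nat \<bar>m\<bar>)) has_sum (S - f 0)) {..<0}" by simp
  have "{0..} \<inter> {..<0::int} = {}" "{0..} \<union> {..<0::int} = UNIV" by auto
  with has_sum_Un_disjoint[OF nonneg neg] show ?thesis by simp
qed

lemma summable_on_int_abs:
  fixes f :: "nat \<Rightarrow> real"
  assumes "summable f" "\<And>n. 0 \<le> f n"
  shows "(\<lambda>m::int. f (nat \<bar>m\<bar>)) summable_on UNIV"
  using has_sum_int_abs[of f "suminf f"] assms by (auto simp: summable_on_def summable_sums)

lemma has_sum_times_nonneg:
  fixes f :: "'a \<Rightarrow> real" and g :: "'b \<Rightarrow> real"
  assumes f: "(f has_sum a) A" and g: "(g has_sum b) B"
    and "\<And>x. x \<in> A \<Longrightarrow> 0 \<le> f x" "\<And>y. y \<in> B \<Longrightarrow> 0 \<le> g y"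
  shows "((\<lambda>(x, y). f x * g y) has_sum (a * b)) (A \<times> B)"
proof -
  have inner: "((\<lambda>y. f x * g y) has_sum (f x * b)) B" for x
    by (rule has_sum_cmult_right[OF g])
  have outer: "((\<lambda>x. f x * b) has_sum (a * b)) A"
    by (rule has_sum_cmult_left[OF f])
  show ?thesis
  proof (rule has_sum_SigmaI)
    show "((\<lambda>y. case (x, y) of (x, y) \<Rightarrow> f x * g y) has_sum (f x * b)) B" for x
      using inner by simp
    show "((\<lambda>x. f x * b) has_sum (a * b)) A" by (rule outer)
    show "(\<lambda>(x, y). f x * g y) summable_on A \<times> B"
      by (rule summable_on_SigmaI[where g = "\<lambda>x. f x * b"])
         (use inner outer assms in \<open>auto simp: summable_on_def\<close>)
  qed
qed

lemma continuous_on_infsum: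
  fixes f :: "'i \<Rightarrow> 'a::topological_space \<Rightarrow> 'b::banach"
  assumes "\<And>i. i \<in> I \<Longrightarrow> continuous_on A (f i)"
    and "\<And>i x. i \<in> I \<Longrightarrow> x \<in> A \<Longrightarrow> norm (f i x) \<le> B i" and "B summable_on I"
  shows "continuous_on A (\<lambda>x. \<Sum>\<^sub>\<infinity>i\<in>I. f i x)"
proof (rule uniform_limit_theorem[OF _ Weierstrass_m_test_general[OF assms(2,3)]])
  show "\<forall>\<^sub>F X in finite_subsets_at_top I. continuous_on A (\<lambda>x. \<Sum>i\<in>X. f i x)"
    unfolding eventually_finite_subsets_at_top
    by (intro exI[of _ "{}"]) (auto intro!: continuous_on_sum assms(1))
qed (auto simp: finite_subsets_at_top_neq_bot)

text \<open>
  Comparison with a geometric series, as \<open>n\<^sup>2 \<ge> \<bar>n\<bar>\<close>.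
\<close>
lemma gaussian_summable:
  assumes "c > 0"
  shows "(\<lambda>n::int. exp (- (c * (real_of_int n)\<^sup>2))) summable_on UNIV"
proof (rule summable_on_comparison_test)
  show "(\<lambda>n::int. exp (- c) ^ nat \<bar>n\<bar>) summable_on UNIV"
    by (rule summable_on_int_abs) (use assms in \<open>auto intro!: summable_geometric\<close>)
  fix n :: int
  have "real_of_int \<bar>n\<bar> \<le> real_of_int (n\<^sup>2)" by (simp only: of_int_le_iff int_abs_le_square)
  then have "c * real (nat \<bar>n\<bar>) \<le> c * (real_of_int n)\<^sup>2" using assms by simp
  then show "exp (- (c * (real_of_int n)\<^sup>2)) \<le> exp (- c) ^ nat \<bar>n\<bar>"
    by (simp flip: exp_of_nat_mult add: mult.commute)
qed auto

section \<open>Poisson summation for Gaussians\<close>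

definition casr :: "real \<Rightarrow> real" where
  "casr u = cos u + sin u"

lemma casr_bound: "\<bar>casr u\<bar> \<le> 2"
  unfolding casr_def using abs_cos_le_one[of u] abs_sin_le_one[of u] by linarith

lemma casr_periodic: "casr (u + 2 * pi * of_int m) = casr u"
  by (simp add: casr_def cos_add sin_add)

lemma casr_continuous [continuous_intros]: "continuous_on S (f :: real \<Rightarrow> real) \<Longrightarrow> continuous_on S (\<lambda>x. casr (f x))"
  unfolding casr_def by (intro continuous_intros)

lemma cas_first: "cas (m, 0) x = casr (of_int m * fst x)"
  by (simp add: cas_def casr_def phase_def)

text \<open>
  The characteristic function of the standard normal distribution is real, so the sine part
  contributes 0.
\<close>
lemma std_normal_casr:
  "integrable lborel (\<lambda>u. std_normal_density u * casr (t * u))"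
  "(\<integral>u. std_normal_density u * casr (t * u) \<partial>lborel) = exp (- t\<^sup>2 / 2)"
proof -
  define f where "f u = std_normal_density u *\<^sub>R iexp (t * u)" for u
  have fi: "integrable lborel f"
  proof (rule Bochner_Integration.integrable_bound)
    show "integrable lborel std_normal_density" by simp
    show "AE x in lborel. norm (f x) \<le> norm (std_normal_density x)"
      by (simp add: f_def)
    show "f \<in> borel_measurable lborel" unfolding f_def[abs_def] by measurable
  qed
  have "(\<integral>u. f u \<partial>lborel) = char std_normal_distribution t"
    unfolding char_def f_def by (subst integral_density) auto
  then have fv: "(\<integral>u. f u \<partial>lborel) = complex_of_real (exp (- t\<^sup>2 / 2))"
    by (simp add: char_std_normal_distribution)
  have eq: "std_normal_density u * casr (t * u) = Re (f u) + Im (f u)" for u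
    by (simp add: f_def casr_def Re_exp Im_exp algebra_simps)
  show "integrable lborel (\<lambda>u. std_normal_density u * casr (t * u))"
    unfolding eq using fi by (intro Bochner_Integration.integrable_add) auto
  show "(\<integral>u. std_normal_density u * casr (t * u) \<partial>lborel) = exp (- t\<^sup>2 / 2)"
    unfolding eq using fi fv by simp
qed

lemma gaussian_casr:
  assumes "\<sigma> > 0"
  shows "integrable lborel (\<lambda>x. exp (- (x\<^sup>2 / (2 * \<sigma>\<^sup>2))) * casr (t * x))"
    "(\<integral>x. exp (- (x\<^sup>2 / (2 * \<sigma>\<^sup>2))) * casr (t * x) \<partial>lborel) = \<sigma> * sqrt (2 * pi) * exp (- ((t * \<sigma>)\<^sup>2 / 2))"
proof -
  define f where "f = (\<lambda>x. exp (- (x\<^sup>2 / (2 * \<sigma>\<^sup>2))) * casr (t * x))"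
  have f: "f (0 + \<sigma> * u) = sqrt (2 * pi) * (std_normal_density u * casr ((t * \<sigma>) * u))" for u
    using assms by (simp add: f_def std_normal_density_def power_mult_distrib mult_ac)
  have i: "integrable lborel (\<lambda>u. f (0 + \<sigma> * u))"
    unfolding f by (intro integrable_mult_right std_normal_casr)
  show "integrable lborel (\<lambda>x. exp (- (x\<^sup>2 / (2 * \<sigma>\<^sup>2))) * casr (t * x))"
    using lborel_integrable_real_affine_iff[of \<sigma> f 0] i assms unfolding f_def by simp
  have "(\<integral>x. f x \<partial>lborel) = \<sigma> * (\<integral>u. f (0 + \<sigma> * u) \<partial>lborel)"
    using lborel_integral_real_affine[of \<sigma> f 0] assms by simp
  also have "\<dots> = \<sigma> * sqrt (2 * pi) * exp (- ((t * \<sigma>)\<^sup>2 / 2))"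
    unfolding f by (simp only: integral_mult_right_zero std_normal_casr) simp
  finally show "(\<integral>x. exp (- (x\<^sup>2 / (2 * \<sigma>\<^sup>2))) * casr (t * x) \<partial>lborel) = \<sigma> * sqrt (2 * pi) * exp (- ((t * \<sigma>)\<^sup>2 / 2))"
    by (simp add: f_def)
qed

text \<open>
  Both sides are values at 0 of continuous periodic functions: \<open>G\<close>, the sum of the translates
  of the Gaussian by periods, and \<open>F\<close>, the Hartley series with coefficients taken from the
  Fourier transform of the Gaussian. They have the same Hartley coefficients, so completeness
  identifies them. Functions of one variable are treated as functions on the torus that depend
  on the first coordinate only.
\<close>
lemma poisson_gaussian:
  assumes \<sigma>: "\<sigma> > 0"
  shows "(\<Sum>\<^sub>\<infinity>n::int. exp (- ((2 * pi * of_int n)\<^sup>2 / (2 * \<sigma>\<^sup>2))))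
    = \<sigma> / sqrt (2 * pi) * (\<Sum>\<^sub>\<infinity>m::int. exp (- ((of_int m * \<sigma>)\<^sup>2 / 2)))"
proof -
  define h where "h x = exp (- (x\<^sup>2 / (2 * \<sigma>\<^sup>2)))" for x :: real
  define G where "G x = (\<Sum>\<^sub>\<infinity>n::int. h (x + 2 * pi * of_int n))" for x
  define bnd where "bnd R n = exp (R\<^sup>2 / (2 * \<sigma>\<^sup>2)) * exp (- (pi\<^sup>2 / \<sigma>\<^sup>2 * (real_of_int n)\<^sup>2))" for R n
  have h_pos: "h x > 0" for x by (simp add: h_def)
  have h_cont: "continuous_on S h" for S unfolding h_def by (intro continuous_intros) (use \<sigma> in auto)
  have bnd_sum: "bnd R summable_on UNIV" for R
    unfolding bnd_def using \<sigma> by (intro summable_on_cmult_right gaussian_summable) auto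
  \<comment> \<open>a bound uniform for \<open>x\<close> in a bounded set, from \<open>(x + a)\<^sup>2 \<ge> a\<^sup>2 / 2 - x\<^sup>2\<close>\<close>
  have h_bnd: "h (x + 2 * pi * of_int n) \<le> bnd R n" if "\<bar>x\<bar> \<le> R" for x R n
  proof -
    have "(2 * pi * of_int n)\<^sup>2 / 2 - x\<^sup>2 \<le> (x + 2 * pi * of_int n)\<^sup>2"
      using zero_le_power2[of "2 * x + 2 * pi * of_int n"] by (simp add: power2_eq_square algebra_simps)
    moreover have "x\<^sup>2 \<le> R\<^sup>2" using that by (simp add: abs_le_square_iff[symmetric])
    ultimately have "(2 * pi * of_int n)\<^sup>2 / 2 - R\<^sup>2 \<le> (x + 2 * pi * of_int n)\<^sup>2" by linarith
    then have "((2 * pi * of_int n)\<^sup>2 / 2 - R\<^sup>2) / (2 * \<sigma>\<^sup>2) \<le> (x + 2 * pi * of_int n)\<^sup>2 / (2 * \<sigma>\<^sup>2)"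
      by (intro divide_right_mono) auto
    also have "((2 * pi * of_int n)\<^sup>2 / 2 - R\<^sup>2) / (2 * \<sigma>\<^sup>2) = pi\<^sup>2 / \<sigma>\<^sup>2 * (real_of_int n)\<^sup>2 - R\<^sup>2 / (2 * \<sigma>\<^sup>2)"
      using \<sigma> by (simp add: field_simps power2_eq_square)
    finally have "h (x + 2 * pi * of_int n) \<le> exp (R\<^sup>2 / (2 * \<sigma>\<^sup>2) - pi\<^sup>2 / \<sigma>\<^sup>2 * (real_of_int n)\<^sup>2)"
      unfolding h_def by simp
    also have "\<dots> = bnd R n" unfolding bnd_def by (subst exp_add[symmetric]) simp
    finally show ?thesis .
  qed
  have G_sum: "((\<lambda>n. h (x + 2 * pi * of_int n)) has_sum G x) UNIV" for x
    unfolding G_def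
    by (intro has_sum_infsum summable_on_comparison_test[OF bnd_sum[of "\<bar>x\<bar>"]] h_bnd)
       (use h_pos in \<open>auto intro: less_imp_le\<close>)
  have G_cont: "continuous_on UNIV G"
  proof -
    have *: "continuous_on {-R..R} G" for R
      unfolding G_def
      by (rule continuous_on_infsum[OF _ _ bnd_sum[of R]])
         (use h_bnd h_pos in \<open>auto intro!: continuous_intros continuous_on_compose2[OF h_cont[of UNIV]] simp: less_imp_le\<close>)
    have "isCont G x" for x
    proof -
      have "- (\<bar>x\<bar> + 1) < x" "x < \<bar>x\<bar> + 1" by linarith+
      then show ?thesis using continuous_on_interior[OF *[of "\<bar>x\<bar> + 1"], of x] by simp
    qed
    then show ?thesis by (simp add: continuous_at_imp_continuous_on)
  qed
  have G_per: "G (x + 2 * pi) = G x" for x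
  proof -
    have "bij_betw (\<lambda>n. n + 1) UNIV (UNIV :: int set)" by (rule bij_betwI[where g = "\<lambda>n. n - 1"]) auto
    from infsum_reindex_bij_betw[OF this, of "\<lambda>n. h (x + 2 * pi * of_int n)"]
    show ?thesis unfolding G_def by (simp add: algebra_simps)
  qed
  \<comment> \<open>the integral of \<open>G\<close> over one period unfolds to an integral over the line\<close>
  have unfold: "integral {0..2 * pi} (\<lambda>x. G x * casr (of_int l * x)) = \<sigma> * sqrt (2 * pi) * exp (- ((of_int l * \<sigma>)\<^sup>2 / 2))" for l
  proof -
    \<comment> \<open>\<open>r n\<close> cuts out the \<open>n\<close>-th period of the line, and \<open>p n\<close> is this piece moved to \<open>{0..<2 * pi}\<close>\<close>
    define p where "p n x = indicator {0..<2 * pi} x * (h (x + 2 * pi * of_int n) * casr (of_int l * x))" for n :: int and x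
    define r where "r n x = indicator {2 * pi * of_int n..<2 * pi * of_int (n + 1)} x * (h x * casr (of_int l * x))" for n :: int and x
    have meas: "(\<lambda>x. h (f x)) \<in> borel_measurable lborel" "(\<lambda>x. casr (f x)) \<in> borel_measurable lborel"
      if "f \<in> borel_measurable lborel" for f
      using that unfolding h_def casr_def by measurable
    have rp: "r n (2 * pi * of_int n + 1 * x) = p n x" for n x
    proof -
      have "casr (of_int l * (2 * pi * of_int n + x)) = casr (of_int l * x)"
        using casr_periodic[of "of_int l * x" "l * n"] by (simp add: algebra_simps)
      moreover have "indicator {2 * pi * of_int n..<2 * pi * of_int (n + 1)} (2 * pi * of_int n + x)
          = (indicator {0..<2 * pi} x :: real)"
        by (auto simp: indicator_def algebra_simps)
      ultimately show ?thesis by (simp add: r_def p_def add.commute)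
    qed
    have p_le: "norm (p n x) \<le> 2 * bnd (2 * pi) n * indicator {0..<2 * pi} x" for n x
      using mult_mono[OF h_bnd[of x "2 * pi" n] casr_bound[of "of_int l * x"]] h_pos[of "x + 2 * pi * of_int n"]
      by (auto simp: p_def indicator_def abs_mult bnd_def)
    have p_int: "integrable lborel (p n)" for n
    proof (rule Bochner_Integration.integrable_bound)
      show "integrable lborel (\<lambda>x. 2 * bnd (2 * pi) n * indicator {0..<2 * pi} x :: real)"
        by (intro integrable_mult_right integrable_real_indicator) auto
      show "p n \<in> borel_measurable lborel" unfolding p_def by (intro borel_measurable_times meas) auto
      show "AE x in lborel. norm (p n x) \<le> norm (2 * bnd (2 * pi) n * indicator {0..<2 * pi} x :: real)"
        using p_le by (intro AE_I2) (smt (verit) real_norm_def)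
    qed
    have p_norm: "(\<integral>x. norm (p n x) \<partial>lborel) \<le> 4 * pi * bnd (2 * pi) n" for n
    proof -
      have "(\<integral>x. norm (p n x) \<partial>lborel) \<le> (\<integral>x. 2 * bnd (2 * pi) n * indicator {0..<2 * pi} x \<partial>lborel)"
        by (rule integral_mono) (use p_int p_le in \<open>auto intro!: integrable_mult_right integrable_real_indicator\<close>)
      also have "\<dots> = 4 * pi * bnd (2 * pi) n" by simp
      finally show ?thesis .
    qed
    have p_norm_sum: "(\<lambda>n. \<integral>x. norm (p n x) \<partial>lborel) summable_on UNIV"
      by (rule summable_on_comparison_test[OF summable_on_cmult_right[OF bnd_sum] p_norm]) auto
    have P: "((\<lambda>n. \<integral>x. p n x \<partial>lborel) has_sum (\<integral>x. indicator {0..<2 * pi} x * (G x * casr (of_int l * x)) \<partial>lborel)) UNIV"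
    proof (rule has_sum_integral(2)[OF _ _ p_int _ _ p_norm_sum])
      show "((\<lambda>n. p n x) has_sum indicator {0..<2 * pi} x * (G x * casr (of_int l * x))) UNIV" for x
        unfolding p_def by (intro has_sum_cmult_right has_sum_cmult_left G_sum)
      show "(\<lambda>n. norm (p n x)) summable_on UNIV" for x
        by (rule summable_on_comparison_test[OF summable_on_cmult_left[OF summable_on_cmult_right[OF bnd_sum[of "2 * pi"]]] p_le]) auto
    qed auto
    have r_int: "integrable lborel (r n)" for n
      using lborel_integrable_real_affine_iff[of 1 "r n" "2 * pi * of_int n"] p_int[of n] unfolding rp by simp
    have r_norm: "(\<integral>x. norm (r n x) \<partial>lborel) = (\<integral>x. norm (p n x) \<partial>lborel)" for n
      using lborel_integral_real_affine[of 1 "\<lambda>x. norm (r n x)" "2 * pi * of_int n"] unfolding rp by simp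
    have r_eq: "(\<integral>x. r n x \<partial>lborel) = (\<integral>x. p n x \<partial>lborel)" for n
      using lborel_integral_real_affine[of 1 "r n" "2 * pi * of_int n"] unfolding rp by simp
    have r_zero: "r n x = 0" if "n \<noteq> \<lfloor>x / (2 * pi)\<rfloor>" for n x
    proof -
      have "\<not> (2 * pi * of_int n \<le> x \<and> x < 2 * pi * of_int (n + 1))"
      proof
        assume "2 * pi * of_int n \<le> x \<and> x < 2 * pi * of_int (n + 1)"
        then have "of_int n \<le> x / (2 * pi)" "x / (2 * pi) < of_int n + 1"
          by (simp_all add: field_simps)
        then have "\<lfloor>x / (2 * pi)\<rfloor> = n" by (simp add: floor_eq_iff)
        with that show False by simp
      qed
      then show ?thesis by (auto simp: r_def indicator_def)
    qed
    have r_val: "r \<lfloor>x / (2 * pi)\<rfloor> x = h x * casr (of_int l * x)" for x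
    proof -
      define z where "z = \<lfloor>x / (2 * pi)\<rfloor>"
      have "of_int z \<le> x / (2 * pi)" "x / (2 * pi) < of_int z + 1" unfolding z_def by linarith+
      then have "2 * pi * of_int z \<le> x" "x < 2 * pi * of_int (z + 1)"
        by (simp_all add: field_simps)
      then have "r z x = h x * casr (of_int l * x)" by (simp add: r_def)
      then show ?thesis by (simp only: z_def)
    qed
    have "((\<lambda>n. \<integral>x. r n x \<partial>lborel) has_sum (\<integral>x. h x * casr (of_int l * x) \<partial>lborel)) UNIV"
    proof (rule has_sum_integral(2))
      show "((\<lambda>n. r n x) has_sum (h x * casr (of_int l * x))) UNIV" for x
        by (rule has_sum_finite_neutralI[of "{\<lfloor>x / (2 * pi)\<rfloor>}"]) (auto simp: r_zero r_val)
      have "((\<lambda>n. norm (r n x)) has_sum (norm (r \<lfloor>x / (2 * pi)\<rfloor> x))) UNIV" for x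
        by (rule has_sum_finite_neutralI[of "{\<lfloor>x / (2 * pi)\<rfloor>}"]) (auto simp: r_zero)
      then show "(\<lambda>n. norm (r n x)) summable_on UNIV" for x by (rule has_sum_imp_summable)
    qed (use r_int p_norm_sum r_norm in auto)
    with P have "(\<integral>x. indicator {0..<2 * pi} x * (G x * casr (of_int l * x)) \<partial>lborel) = (\<integral>x. h x * casr (of_int l * x) \<partial>lborel)"
      unfolding r_eq by (rule has_sum_unique)
    also have "\<dots> = \<sigma> * sqrt (2 * pi) * exp (- ((of_int l * \<sigma>)\<^sup>2 / 2))"
      unfolding h_def by (rule gaussian_casr(2)[OF \<sigma>])
    finally have "set_lebesgue_integral lborel {0..<2 * pi} (\<lambda>x. G x * casr (of_int l * x)) = \<sigma> * sqrt (2 * pi) * exp (- ((of_int l * \<sigma>)\<^sup>2 / 2))"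
      by (simp add: set_lebesgue_integral_def)
    moreover have "set_integrable lborel {0..2 * pi} (\<lambda>x. G x * casr (of_int l * x))"
      by (rule borel_integrable_atLeastAtMost')
         (intro continuous_intros continuous_on_subset[OF G_cont], auto)
    then have si: "set_integrable lborel {0..<2 * pi} (\<lambda>x. G x * casr (of_int l * x))"
      by (rule set_integrable_subset) auto
    from set_borel_integral_eq_integral(2)[OF si]
    have "set_lebesgue_integral lborel {0..<2 * pi} (\<lambda>x. G x * casr (of_int l * x)) = integral {0..<2 * pi} (\<lambda>x. G x * casr (of_int l * x))" .
    moreover have "integral {0..<2 * pi} (\<lambda>x. G x * casr (of_int l * x)) = integral {0..2 * pi} (\<lambda>x. G x * casr (of_int l * x))"
      by (rule integral_subset_negligible) (auto intro!: negligible_subset[OF negligible_sing[of "2 * pi"]])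
    ultimately show ?thesis by simp
  qed
  define a where "a m = \<sigma> / sqrt (2 * pi) * exp (- ((of_int m * \<sigma>)\<^sup>2 / 2))" for m :: int
  have a_pos: "a m \<ge> 0" for m using \<sigma> by (simp add: a_def)
  have a_sum: "a summable_on UNIV"
  proof -
    have "a = (\<lambda>m. \<sigma> / sqrt (2 * pi) * exp (- (\<sigma>\<^sup>2 / 2 * (real_of_int m)\<^sup>2)))"
      by (simp add: fun_eq_iff a_def power_mult_distrib mult_ac)
    then show ?thesis using \<sigma> by (simp only:) (intro summable_on_cmult_right gaussian_summable, simp)
  qed
  define F where "F x = (\<Sum>\<^sub>\<infinity>m. a m * cas (m, 0) x)" for x
  have F_bnd: "norm (a m * cas (m, 0) x) \<le> 2 * a m" for m x
    using mult_left_mono[OF casr_bound[of "of_int m * fst x"] a_pos[of m]] a_pos[of m]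
    by (simp add: abs_mult cas_first mult.commute)
  have F_abs: "(\<lambda>m. norm (a m * cas (m, 0) x)) summable_on UNIV" for x
    by (rule summable_on_comparison_test[OF summable_on_cmult_right[OF a_sum, of 2] F_bnd]) auto
  have F_sum: "((\<lambda>m. a m * cas (m, 0) x) has_sum F x) UNIV" for x
    unfolding F_def by (rule has_sum_infsum[OF abs_summable_summable[OF F_abs]])
  have F_cont: "continuous_on UNIV F"
    unfolding F_def
    by (rule continuous_on_infsum[OF _ F_bnd summable_on_cmult_right[OF a_sum]]) (intro continuous_intros)
  have F_per: "doubly_periodic F"
    using cas_doubly_periodic by (simp add: doubly_periodic_def F_def)
  have G_per2: "doubly_periodic (\<lambda>x. G (fst x))"
    using G_per by (auto simp: doubly_periodic_def coord_vec_def)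
  have G_cont2: "continuous_on UNIV (\<lambda>x :: pt. G (fst x))"
    by (intro continuous_on_compose2[OF G_cont] continuous_intros) auto
  have F_hartley: "hartley F (l, n) = (if n = 0 then (2 * pi)\<^sup>2 * a l else 0)" for l n
  proof -
    define q where "q m x = indicator square x * (a m * cas (m, 0) x * cas (l, n) x)" for m x
    have cas_le: "\<bar>cas k x\<bar> \<le> 2" for k x
      unfolding cas_def using abs_cos_le_one[of "phase k x"] abs_sin_le_one[of "phase k x"] by linarith
    have q_le: "norm (q m x) \<le> 4 * a m * indicator square x" for m x
      using mult_mono[OF F_bnd[of m x] cas_le[of "(l, n)" x]] a_pos[of m] by (auto simp: q_def indicator_def abs_mult)
    have q_si: "set_integrable lborel square (\<lambda>x. a m * cas (m, 0) x * cas (l, n) x)" for m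
      unfolding set_integrable_def by (intro borel_integrable_compact continuous_intros compact_cbox)
    have q_int: "integrable lborel (q m)" for m
      using q_si[of m] by (simp add: q_def[abs_def] set_integrable_def)
    have q_val: "(\<integral>x. q m x \<partial>lborel) = a m * hartley (cas (m, 0)) (l, n)" for m
    proof -
      have "(\<integral>x. q m x \<partial>lborel) = set_lebesgue_integral lborel square (\<lambda>x. a m * cas (m, 0) x * cas (l, n) x)"
        by (simp add: q_def set_lebesgue_integral_def)
      also have "\<dots> = integral square (\<lambda>x. a m * cas (m, 0) x * cas (l, n) x)"
        by (rule set_borel_integral_eq_integral(2)[OF q_si])
      also have "\<dots> = a m * hartley (cas (m, 0)) (l, n)"
        by (simp only: mult.assoc hartley_def Henstock_Kurzweil_Integration.integral_mult_right)
      finally show ?thesis .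
    qed
    have sq: "integrable lborel (indicator square :: pt \<Rightarrow> real)"
      by (rule integrable_real_indicator) (use emeasure_bounded_finite[OF bounded_cbox] in auto)
    have q_norm: "(\<integral>x. norm (q m x) \<partial>lborel) \<le> 4 * (\<integral>x. indicator square x \<partial>lborel) * a m" for m
    proof -
      have "(\<integral>x. norm (q m x) \<partial>lborel) \<le> (\<integral>x. 4 * a m * indicator square x \<partial>lborel)"
        by (rule integral_mono) (use q_int q_le sq in auto)
      then show ?thesis by (simp add: mult_ac)
    qed
    have "((\<lambda>m. \<integral>x. q m x \<partial>lborel) has_sum (\<integral>x. indicator square x * (F x * cas (l, n) x) \<partial>lborel)) UNIV"
    proof (rule has_sum_integral(2)[OF _ _ q_int])
      show "((\<lambda>m. q m x) has_sum (indicator square x * (F x * cas (l, n) x))) UNIV" for x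
        unfolding q_def by (intro has_sum_cmult_right has_sum_cmult_left F_sum)
      show "(\<lambda>m. norm (q m x)) summable_on UNIV" for x
        by (rule summable_on_comparison_test[OF summable_on_cmult_left[OF summable_on_cmult_right[OF a_sum]] q_le]) auto
      show "(\<lambda>m. \<integral>x. norm (q m x) \<partial>lborel) summable_on UNIV"
        by (rule summable_on_comparison_test[OF summable_on_cmult_right[OF a_sum] q_norm]) auto
    qed auto
    moreover have "set_integrable lborel square (\<lambda>x. F x * cas (l, n) x)"
      unfolding set_integrable_def by (intro borel_integrable_compact continuous_intros compact_cbox continuous_on_subset[OF F_cont]) auto
    from set_borel_integral_eq_integral(2)[OF this]
    have "(\<integral>x. indicator square x * (F x * cas (l, n) x) \<partial>lborel) = hartley F (l, n)"
      by (simp add: set_lebesgue_integral_def hartley_def)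
    ultimately have "((\<lambda>m. a m * hartley (cas (m, 0)) (l, n)) has_sum hartley F (l, n)) UNIV"
      by (simp add: q_val)
    moreover have "((\<lambda>m. a m * hartley (cas (m, 0)) (l, n)) has_sum (if n = 0 then (2 * pi)\<^sup>2 * a l else 0)) UNIV"
      by (rule has_sum_finite_neutralI[of "{l}"]) (auto simp: hartley_cas)
    ultimately show ?thesis by (rule has_sum_unique)
  qed
  have G_hartley: "hartley (\<lambda>x. G (fst x)) (l, n) = (if n = 0 then (2 * pi)\<^sup>2 * a l else 0)" for l n
  proof -
    have inner: "integral {0..2 * pi} (\<lambda>y. G x * cas (l, n) (x, y)) = (if n = 0 then 2 * pi * (G x * casr (of_int l * x)) else 0)" for x
    proof (cases "n = 0")
      case True
      then show ?thesis by (simp add: cas_first)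
    next
      case False
      define g where "g y = G x * (sin (of_int l * x + of_int n * y) - cos (of_int l * x + of_int n * y)) / of_int n" for y
      have hI: "((\<lambda>y. G x * cas (l, n) (x, y)) has_integral (g (2 * pi) - g 0)) {0..2 * pi}"
        unfolding g_def
        by (rule fundamental_theorem_of_calculus)
           (use False in \<open>auto intro!: derivative_eq_intros simp: cas_def phase_def field_simps
              simp flip: has_real_derivative_iff_has_vector_derivative\<close>)
      have "g (2 * pi) = g 0"
      proof -
        have "cos (t + 2 * pi * of_int n) = cos t" "sin (t + 2 * pi * of_int n) = sin t" for t :: real
          by (simp_all add: cos_add sin_add)
        then show ?thesis by (simp add: g_def mult.commute[of "of_int n"])
      qed
      then show ?thesis using False by (simp only: integral_unique[OF hI]) simp
    qed
    have "hartley (\<lambda>x. G (fst x)) (l, n) = integral {0..2 * pi} (\<lambda>x. integral {0..2 * pi} (\<lambda>y. G x * cas (l, n) (x, y)))"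
      unfolding hartley_def
      by (subst integral_prod_continuous)
         (auto intro!: continuous_intros continuous_on_subset[OF G_cont2])
    also have "\<dots> = (if n = 0 then 2 * pi * (\<sigma> * sqrt (2 * pi) * exp (- ((of_int l * \<sigma>)\<^sup>2 / 2))) else 0)"
      unfolding inner using unfold[of l] by simp
    also have "\<dots> = (if n = 0 then (2 * pi)\<^sup>2 * a l else 0)"
    proof -
      have "2 * pi * sqrt (2 * pi) = (2 * pi)\<^sup>2 / sqrt (2 * pi)"
        using real_sqrt_mult_self[of "2 * pi"] by (simp add: field_simps power2_eq_square)
      then show ?thesis by (simp add: a_def field_simps)
    qed
    finally show ?thesis .
  qed
  have "1 * G (fst (0 :: pt)) + (-1) * F 0 = 0"
  proof (rule hartley_complete)
    show "continuous_on UNIV (\<lambda>x. 1 * G (fst x) + (-1) * F x)"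
      by (intro continuous_intros G_cont2 F_cont)
    show "doubly_periodic (\<lambda>x. 1 * G (fst x) + (-1) * F x)"
      using F_per G_per2 by (simp add: doubly_periodic_def)
    show "hartley (\<lambda>x. 1 * G (fst x) + (-1) * F x) k = 0" for k
      unfolding hartley_combination[OF G_cont2 F_cont] by (cases k) (simp add: G_hartley F_hartley)
  qed
  then have "G 0 = F 0" by simp
  moreover have "F 0 = (\<Sum>\<^sub>\<infinity>m. a m)" by (simp add: F_def cas_def phase_def)
  moreover have "(\<Sum>\<^sub>\<infinity>m. a m) = \<sigma> / sqrt (2 * pi) * (\<Sum>\<^sub>\<infinity>m::int. exp (- ((of_int m * \<sigma>)\<^sup>2 / 2)))"
    unfolding a_def by (rule infsum_cmult_right') 
  ultimately show ?thesis by (simp add: G_def h_def)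
qed

section \<open>The theta function and the heat trace\<close>

definition theta :: "real \<Rightarrow> real" where
  "theta t = (\<Sum>\<^sub>\<infinity>n::int. exp (- (pi * t * (real_of_int n)\<^sup>2)))"

text \<open>
  Poisson summation with variance \<open>\<sigma>\<^sup>2 = 2 \<pi> t\<close>.
\<close>
lemma theta_inversion:
  assumes "t > 0"
  shows "theta (1 / t) = sqrt t * theta t"
proof -
  define \<sigma> where "\<sigma> = sqrt (2 * pi * t)"
  have \<sigma>: "\<sigma> > 0" "\<sigma>\<^sup>2 = 2 * pi * t" using assms by (simp_all add: \<sigma>_def)
  have "(2 * pi * of_int n)\<^sup>2 / (2 * \<sigma>\<^sup>2) = pi * (1 / t) * (real_of_int n)\<^sup>2" for n
    unfolding \<sigma>(2) using assms by (simp add: field_simps power2_eq_square)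
  moreover have "(of_int m * \<sigma>)\<^sup>2 / 2 = pi * t * (real_of_int m)\<^sup>2" for m
    by (simp add: power_mult_distrib \<sigma>(2) mult_ac)
  moreover have "\<sigma> / sqrt (2 * pi) = sqrt t"
    using assms by (simp add: \<sigma>_def real_sqrt_mult)
  ultimately show ?thesis using poisson_gaussian[OF \<sigma>(1)] by (simp add: theta_def)
qed

lemma theta_has_sum:
  assumes "t > 0"
  shows "((\<lambda>n. exp (- (pi * t * (real_of_int n)\<^sup>2))) has_sum theta t) UNIV"
  unfolding theta_def using gaussian_summable[of "pi * t"] assms by (intro has_sum_infsum) auto

text \<open>
  The trace of the heat semigroup on functions of mean 0, with time scaled by \<open>\<pi>\<close> so that the
  inversion \<open>t \<mapsto> 1 / t\<close> takes its standard form.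
\<close>
definition heat_trace :: "real \<Rightarrow> real" where
  "heat_trace t = (\<Sum>\<^sub>\<infinity>k\<in>- {0}. exp (- (pi * t * norm_sq k)))"

text \<open>
  As \<open>\<bar>k\<bar>\<^sup>2\<close> is a sum of two squares, the lattice sum is a product of two theta series; the
  term \<open>k = 0\<close> is removed.
\<close>
lemma heat_trace_theta:
  assumes "t > 0"
  shows "((\<lambda>k. exp (- (pi * t * norm_sq k))) has_sum heat_trace t) (- {0})"
    and "heat_trace t = (theta t)\<^sup>2 - 1"
proof -
  have "((\<lambda>(m, n). exp (- (pi * t * (real_of_int m)\<^sup>2)) * exp (- (pi * t * (real_of_int n)\<^sup>2)))
      has_sum (theta t * theta t)) (UNIV \<times> UNIV)"
    by (rule has_sum_times_nonneg[OF theta_has_sum[OF assms] theta_has_sum[OF assms]]) auto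
  moreover have "(\<lambda>(m, n). exp (- (pi * t * (real_of_int m)\<^sup>2)) * exp (- (pi * t * (real_of_int n)\<^sup>2)))
      = (\<lambda>k. exp (- (pi * t * norm_sq k)))"
    by (auto simp: fun_eq_iff norm_sq_alt algebra_simps simp flip: exp_add)
  ultimately have "((\<lambda>k. exp (- (pi * t * norm_sq k))) has_sum (theta t)\<^sup>2) UNIV"
    by (simp add: power2_eq_square)
  moreover have "((\<lambda>k. exp (- (pi * t * norm_sq k))) has_sum 1) {0}"
    by (rule has_sum_finiteI) (auto simp: norm_sq_def freq_simps)
  ultimately have s: "((\<lambda>k. exp (- (pi * t * norm_sq k))) has_sum ((theta t)\<^sup>2 - 1)) (UNIV - {0})"
    by (rule has_sum_Diff) auto
  then show "heat_trace t = (theta t)\<^sup>2 - 1" by (simp add: heat_trace_def Compl_eq_Diff_UNIV infsumI)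
  with s show "((\<lambda>k. exp (- (pi * t * norm_sq k))) has_sum heat_trace t) (- {0})"
    by (simp add: Compl_eq_Diff_UNIV)
qed

lemma heat_trace_inversion:
  assumes "t > 0"
  shows "heat_trace (1 / t) = t * heat_trace t + t - 1"
  using assms by (simp add: heat_trace_theta theta_inversion power_mult_distrib algebra_simps)

lemma heat_trace_nonneg: "heat_trace t \<ge> 0"
  unfolding heat_trace_def by (rule infsum_nonneg) auto

text \<open>
  Every eigenvalue \<open>\<bar>k\<bar>\<^sup>2\<close> is at least 1, so each term decays at least as fast as \<open>exp (- \<pi>
  t)\<close>.
\<close>
lemma heat_trace_decay:
  assumes "t \<ge> 1"
  shows "heat_trace t \<le> exp (- (pi * (t - 1))) * heat_trace 1"
proof (rule has_sum_mono)
  show "((\<lambda>k. exp (- (pi * t * norm_sq k))) has_sum heat_trace t) (- {0})"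
    using assms by (intro heat_trace_theta) auto
  show "((\<lambda>k. exp (- (pi * (t - 1))) * exp (- (pi * 1 * norm_sq k))) has_sum exp (- (pi * (t - 1))) * heat_trace 1) (- {0})"
    by (intro has_sum_cmult_right heat_trace_theta) auto
  fix k :: "int \<times> int" assume "k \<in> - {0}"
  then have "1 \<le> norm_sq k" using norm_sq_ge_1 by auto
  then have "(t - 1) * 1 \<le> (t - 1) * norm_sq k" using assms by (intro mult_left_mono) auto
  then have "pi * ((t - 1) + norm_sq k) \<le> pi * (t * norm_sq k)"
    by (intro mult_left_mono) (auto simp: algebra_simps)
  then show "exp (- (pi * t * norm_sq k)) \<le> exp (- (pi * (t - 1))) * exp (- (pi * 1 * norm_sq k))"
    by (simp add: algebra_simps flip: exp_add)
qed

text \<open>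
  With \<open>q = exp (- \<pi>) \<le> 1 / 19\<close> the theta series at 1 is at most \<open>(1 + q) / (1 - q) \<le> 10 / 9\<close>,
  and \<open>(10 / 9)\<^sup>2 - 1 \<le> 3 / 10\<close>.
\<close>
lemma heat_trace_1_bound: "heat_trace 1 \<le> 3 / 10"
proof -
  define q where "q = exp (- pi)"
  have e: "exp 1 \<ge> (2.71 :: real)" using e_approx_32 by (simp add: abs_if split: if_split_asm)
  have "(2.71 :: real) ^ 3 \<le> exp 1 ^ 3" by (rule power_mono[OF e]) simp
  then have "(19 :: real) \<le> exp 3" by (simp add: power3_eq_cube flip: exp_add)
  also have "exp 3 \<le> exp pi" using pi_gt3 by simp
  finally have q: "0 < q" "q \<le> 1 / 19" by (simp_all add: q_def exp_minus field_simps)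
  have geo: "(\<lambda>n. q ^ n) sums (1 / (1 - q))" by (rule geometric_sums) (use q in auto)
  have "theta 1 \<le> 2 * (1 / (1 - q)) - 1"
  proof (rule has_sum_mono)
    show "((\<lambda>n. exp (- (pi * 1 * (real_of_int n)\<^sup>2))) has_sum theta 1) UNIV" by (rule theta_has_sum) simp
    show "((\<lambda>n::int. q ^ nat \<bar>n\<bar>) has_sum (2 * (1 / (1 - q)) - 1)) UNIV"
      using has_sum_int_abs[OF geo] q by simp
    fix n :: int
    have "real_of_int \<bar>n\<bar> \<le> real_of_int (n\<^sup>2)" by (simp only: of_int_le_iff int_abs_le_square)
    then have "pi * real (nat \<bar>n\<bar>) \<le> pi * (real_of_int n)\<^sup>2" by simp
    then show "exp (- (pi * 1 * (real_of_int n)\<^sup>2)) \<le> q ^ nat \<bar>n\<bar>"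
      unfolding q_def by (simp flip: exp_of_nat_mult add: mult.commute)
  qed
  also have "\<dots> = (1 + q) / (1 - q)" using q by (simp add: field_simps)
  also have "\<dots> \<le> 10 / 9" using q by (simp add: field_simps)
  finally have "theta 1 \<le> 10 / 9" .
  moreover have "theta 1 \<ge> 0" unfolding theta_def by (rule infsum_nonneg) auto
  ultimately have "(theta 1)\<^sup>2 \<le> (10 / 9)\<^sup>2" by (intro power_mono)
  then show ?thesis using heat_trace_theta(2)[of 1] by (simp add: power2_eq_square)
qed

lemma heat_trace_continuous: "continuous_on {1..} heat_trace"
  unfolding heat_trace_def
proof (rule continuous_on_infsum)
  show "(\<lambda>k. exp (- (pi * 1 * norm_sq k))) summable_on - {0}"
    using heat_trace_theta(1)[of 1] by (auto simp: summable_on_def)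
  fix k :: "int \<times> int" and t :: real assume "k \<in> - {0}" "t \<in> {1..}"
  then have "1 * norm_sq k \<le> t * norm_sq k"
    using norm_sq_ge_1[of k] by (intro mult_right_mono) auto
  then show "norm (exp (- (pi * t * norm_sq k))) \<le> exp (- (pi * 1 * norm_sq k))" by simp
qed (intro continuous_intros)

section \<open>Mellin transforms\<close>

text \<open>
  The power \<open>x\<^sup>w\<close> for \<open>x > 0\<close>, in a form that is visibly entire in \<open>w\<close> and measurable in \<open>x\<close>.
\<close>
definition cpow :: "real \<Rightarrow> complex \<Rightarrow> complex" where
  "cpow x w = exp (w * of_real (ln x))"

lemma cpow_measurable [measurable]: "(\<lambda>t. cpow t w) \<in> borel_measurable borel"
  unfolding cpow_def by measurable

lemma cpow_add: "cpow x (v + w) = cpow x v * cpow x w"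
  by (simp add: cpow_def distrib_right exp_add)

lemma cpow_mult: "x > 0 \<Longrightarrow> y > 0 \<Longrightarrow> cpow (x * y) w = cpow x w * cpow y w"
  by (simp add: cpow_def ln_mult distrib_left exp_add)

lemma cpow_inverse: "x > 0 \<Longrightarrow> cpow (1 / x) w = cpow x (- w)"
  by (simp add: cpow_def ln_div)

lemma cpow_1: "x > 0 \<Longrightarrow> cpow x 1 = of_real x"
  by (simp add: cpow_def exp_of_real)

lemma cpow_0: "cpow x 0 = 1"
  by (simp add: cpow_def)

lemma cpow_uminus: "cpow x (- w) = inverse (cpow x w)"
  by (simp add: cpow_def exp_minus)

lemma norm_cpow: "x > 0 \<Longrightarrow> norm (cpow x w) = x powr Re w"
  by (simp add: cpow_def powr_def)

lemma cpow_of_real: "x > 0 \<Longrightarrow> cpow x (of_real r) = of_real (x powr r)"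
  by (simp add: cpow_def powr_def flip: exp_of_real)

lemma cpow_nonzero: "cpow x w \<noteq> 0"
  by (simp add: cpow_def)

lemma cpow_eq_powr: "x > 0 \<Longrightarrow> cpow x w = of_real x powr w"
  by (simp add: cpow_def powr_def Ln_of_real)

lemma cpow_isCont: "x > 0 \<Longrightarrow> isCont (\<lambda>t. cpow t w) x"
  unfolding cpow_def by (intro continuous_intros) auto

lemma cpow_continuous_on: "S \<subseteq> {0<..} \<Longrightarrow> continuous_on S (\<lambda>t. cpow t w)"
  by (intro continuous_at_imp_continuous_on ballI cpow_isCont) auto

lemma Gamma_integral_lborel:
  assumes "Re w > 0"
  shows "integrable lborel (\<lambda>t. indicator {0<..} t *\<^sub>R (of_real (exp (- t)) * cpow t (w - 1)))"
    and "(\<integral>t. indicator {0<..} t *\<^sub>R (of_real (exp (- t)) * cpow t (w - 1)) \<partial>lborel) = Gamma w"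
proof -
  define f where "f t = indicator {0<..} t *\<^sub>R (of_real (exp (- t)) * cpow t (w - 1))" for t :: real
  have f: "f t = indicator {0<..} t *\<^sub>R (complex_of_real t powr (w - 1) / of_real (exp t))" for t
    by (auto simp: f_def indicator_def cpow_eq_powr exp_minus divide_inverse)
  have meas: "f \<in> borel_measurable lborel"
    unfolding f_def[abs_def] by measurable
  have ai: "(\<lambda>t. complex_of_real t powr (w - 1) / of_real (exp t)) absolutely_integrable_on {0<..}"
    by (rule absolutely_integrable_Gamma_integral'[OF assms])
  have "integrable lebesgue f"
    using ai unfolding set_integrable_def f[abs_def] .
  then show "integrable lborel (\<lambda>t. indicator {0<..} t *\<^sub>R (of_real (exp (- t)) * cpow t (w - 1)))"
    using integrable_completion[OF meas] unfolding f_def[abs_def] by blast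
  have "integral\<^sup>L lborel f = integral\<^sup>L lebesgue f"
    using integral_completion[OF meas] by simp
  also have "\<dots> = integral {0<..} (\<lambda>t. complex_of_real t powr (w - 1) / of_real (exp t))"
    using set_lebesgue_integral_eq_integral(2)[OF ai] unfolding set_lebesgue_integral_def f[abs_def] .
  also have "\<dots> = Gamma w"
    by (rule integral_unique[OF Gamma_integral_complex'[OF assms]])
  finally show "(\<integral>t. indicator {0<..} t *\<^sub>R (of_real (exp (- t)) * cpow t (w - 1)) \<partial>lborel) = Gamma w"
    by (simp add: f_def[abs_def])
qed

lemma Gamma_integral_scaled:
  assumes w: "Re w > 0" and a: "a > 0"
  shows "integrable lborel (\<lambda>t. indicator {0<..} t *\<^sub>R (of_real (exp (- (a * t))) * cpow t (w - 1)))"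
    and "(\<integral>t. indicator {0<..} t *\<^sub>R (of_real (exp (- (a * t))) * cpow t (w - 1)) \<partial>lborel) = Gamma w * cpow a (- w)"
proof -
  define B where "B t = indicator {0<..} t *\<^sub>R (of_real (exp (- t)) * cpow t (w - 1))" for t :: real
  define f where "f t = indicator {0<..} t *\<^sub>R (of_real (exp (- (a * t))) * cpow t (w - 1))" for t :: real
  have scale: "B (0 + a * t) = cpow a (w - 1) * f t" for t
    using a by (auto simp: B_def f_def indicator_def cpow_mult zero_less_mult_iff)
  have f_eq: "f t = cpow a (- (w - 1)) * B (0 + a * t)" for t
    unfolding scale by (simp add: mult.assoc[symmetric] cpow_0 flip: cpow_add)
  have B: "integrable lborel B" "integral\<^sup>L lborel B = Gamma w"
    using Gamma_integral_lborel[OF w] by (simp_all add: B_def[abs_def])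
  have Bi: "integrable lborel (\<lambda>t. B (0 + a * t))"
    using lborel_integrable_real_affine_iff[of a B 0] B(1) a by simp
  have "integrable lborel f"
    unfolding f_eq[abs_def] by (intro integrable_mult_right Bi)
  then show "integrable lborel (\<lambda>t. indicator {0<..} t *\<^sub>R (of_real (exp (- (a * t))) * cpow t (w - 1)))"
    by (simp add: f_def[abs_def])
  have "Gamma w = a *\<^sub>R (\<integral>t. B (0 + a * t) \<partial>lborel)"
    using lborel_integral_real_affine[of a B 0] B(2) a by simp
  also have "\<dots> = of_real a * cpow a (w - 1) * integral\<^sup>L lborel f"
    unfolding scale by (simp add: scaleR_conv_of_real)
  also have "of_real a * cpow a (w - 1) = cpow a w"
    using cpow_add[of a 1 "w - 1"] a by (simp add: cpow_1)
  finally have "integral\<^sup>L lborel f = Gamma w * cpow a (- w)"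
    using cpow_nonzero[of a w] by (simp add: cpow_uminus field_simps)
  then show "(\<integral>t. indicator {0<..} t *\<^sub>R (of_real (exp (- (a * t))) * cpow t (w - 1)) \<partial>lborel) = Gamma w * cpow a (- w)"
    by (simp add: f_def[abs_def])
qed

lemma Gamma_integral_scaled_norm:
  assumes w: "Re w > 0" and a: "a > 0"
  shows "(\<integral>t. norm (indicator {0<..} t *\<^sub>R (complex_of_real (exp (- (a * t))) * cpow t (w - 1))) \<partial>lborel)
      = Gamma (Re w) * a powr - Re w"
proof -
  define \<sigma> where "\<sigma> = complex_of_real (Re w)"
  have \<sigma>: "Re \<sigma> > 0" using w by (simp add: \<sigma>_def)
  have "norm (indicator {0<..} t *\<^sub>R (complex_of_real (exp (- (a * t))) * cpow t (w - 1)))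
      = Re (indicator {0<..} t *\<^sub>R (of_real (exp (- (a * t))) * cpow t (\<sigma> - 1)))" for t :: real
    using cpow_of_real[of t "Re w - 1"] by (auto simp: indicator_def norm_mult norm_cpow \<sigma>_def)
  then have "(\<integral>t. norm (indicator {0<..} t *\<^sub>R (complex_of_real (exp (- (a * t))) * cpow t (w - 1))) \<partial>lborel)
     = Re (Gamma \<sigma> * cpow a (- \<sigma>))"
    by (simp only: integral_Re[OF Gamma_integral_scaled(1)[OF \<sigma> a]] Gamma_integral_scaled(2)[OF \<sigma> a])
  also have "\<dots> = Gamma (Re w) * a powr - Re w"
    using cpow_of_real[OF a, of "- Re w"] by (simp add: \<sigma>_def Gamma_complex_of_real)
  finally show ?thesis .
qed

text \<open>
  For \<open>k = (m, n) \<noteq> 0\<close> one has \<open>max 1 \<bar>m\<bar> \<cdot> max 1 \<bar>n\<bar> \<le> m\<^sup>2 + n\<^sup>2\<close>, so the sum is dominated by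
  a product of two convergent series in one variable.
\<close>
lemma norm_sq_powr_summable:
  assumes "\<sigma> > 1"
  shows "(\<lambda>k. norm_sq k powr - \<sigma>) summable_on - {0}"
proof -
  define f where "f n = real (max 1 n) powr - \<sigma>" for n :: nat
  have "summable (\<lambda>n. real n powr - \<sigma>)" using assms by (simp add: summable_real_powr_iff)
  then have "summable f"
    by (rule summable_cong[THEN iffD1, rotated])
       (auto simp: f_def max_def intro!: eventually_sequentiallyI[of 1])
  then obtain S where S: "((\<lambda>m::int. f (nat \<bar>m\<bar>)) has_sum S) UNIV"
    using summable_on_int_abs[of f] by (auto simp: f_def summable_on_def)
  have "((\<lambda>(m, n). f (nat \<bar>m\<bar>) * f (nat \<bar>n\<bar>)) has_sum (S * S)) (UNIV \<times> UNIV :: (int \<times> int) set)"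
    by (rule has_sum_times_nonneg[OF S S]) (auto simp: f_def)
  then have "(\<lambda>(m, n). f (nat \<bar>m\<bar>) * f (nat \<bar>n\<bar>)) summable_on (UNIV :: (int \<times> int) set)"
    by (auto simp: summable_on_def)
  then have "(\<lambda>(m, n). f (nat \<bar>m\<bar>) * f (nat \<bar>n\<bar>)) summable_on (- {0 :: int \<times> int})"
    by (rule summable_on_subset_banach) auto
  then show ?thesis
  proof (rule summable_on_comparison_test)
    fix k :: "int \<times> int" assume k: "k \<in> - {0}"
    obtain m n where mn: "k = (m, n)" by (cases k)
    have "max 1 \<bar>m\<bar> * max 1 \<bar>n\<bar> \<le> m\<^sup>2 + n\<^sup>2"
    proof (cases "m = 0 \<or> n = 0")
      case True
      then have "max 1 \<bar>m\<bar> * max 1 \<bar>n\<bar> \<le> \<bar>m\<bar> + \<bar>n\<bar>" using k mn by (auto simp: max_def zero_prod_def)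
      then show ?thesis using int_abs_le_square[of m] int_abs_le_square[of n] by linarith
    next
      case False
      then have "max 1 \<bar>m\<bar> = \<bar>m\<bar>" "max 1 \<bar>n\<bar> = \<bar>n\<bar>" by auto
      moreover have "2 * (\<bar>m\<bar> * \<bar>n\<bar>) \<le> m\<^sup>2 + n\<^sup>2"
        using zero_le_power2[of "\<bar>m\<bar> - \<bar>n\<bar>"] by (simp add: power2_diff)
      moreover have "0 \<le> \<bar>m\<bar> * \<bar>n\<bar>" by simp
      ultimately show ?thesis by linarith
    qed
    then have le: "real (max 1 (nat \<bar>m\<bar>)) * real (max 1 (nat \<bar>n\<bar>)) \<le> norm_sq k"
    proof -
      assume *: "max 1 \<bar>m\<bar> * max 1 \<bar>n\<bar> \<le> m\<^sup>2 + n\<^sup>2"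
      have "real (max 1 (nat \<bar>z\<bar>)) = real_of_int (max 1 \<bar>z\<bar>)" for z :: int
        by (auto simp: max_def)
      then have "real (max 1 (nat \<bar>m\<bar>)) * real (max 1 (nat \<bar>n\<bar>)) = real_of_int (max 1 \<bar>m\<bar> * max 1 \<bar>n\<bar>)"
        by simp
      also have "\<dots> \<le> real_of_int (m\<^sup>2 + n\<^sup>2)" using * by (simp only: of_int_le_iff)
      finally show ?thesis by (simp only: norm_sq_alt mn fst_conv snd_conv)
    qed
    have "norm_sq k powr - \<sigma> \<le> (real (max 1 (nat \<bar>m\<bar>)) * real (max 1 (nat \<bar>n\<bar>))) powr - \<sigma>"
      by (rule powr_mono2') (use le assms in auto)
    also have "\<dots> = f (nat \<bar>m\<bar>) * f (nat \<bar>n\<bar>)" by (simp add: f_def powr_mult)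
    finally show "norm_sq k powr - \<sigma> \<le> (case k of (m, n) \<Rightarrow> f (nat \<bar>m\<bar>) * f (nat \<bar>n\<bar>))" by (simp add: mn)
  qed auto
qed

lemma infinite_lattice: "infinite (- {0 :: int \<times> int})"
proof -
  have "infinite (UNIV :: (int \<times> int) set)" by (simp add: finite_prod infinite_UNIV_int)
  then show ?thesis by simp
qed

text \<open>
  The heat trace is integrated term by term against \<open>t\<close> to the power \<open>w - 1\<close>; each term is a
  scaled Gamma integral.
\<close>
lemma epstein_mellin:
  assumes w: "Re w > 1"
  defines "P \<equiv> \<lambda>t. indicator {0<..} t *\<^sub>R (of_real (heat_trace t) * cpow t (w - 1))"
  shows "integrable lborel P"
    and "((\<lambda>k. Gamma w * cpow (pi * norm_sq k) (- w)) has_sum (\<integral>t. P t \<partial>lborel)) (- {0})"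
proof -
  define f where "f k t = indicator {0<..} t *\<^sub>R (complex_of_real (exp (- ((pi * norm_sq k) * t))) * cpow t (w - 1))" for k t
  have pos: "pi * norm_sq k > 0" if "k \<in> - {0}" for k
    using norm_sq_ge_1[of k] that by auto
  have w0: "Re w > 0" using w by simp
  have trace: "((\<lambda>k. exp (- ((pi * norm_sq k) * t))) has_sum heat_trace t) (- {0})" if "t > 0" for t
    using heat_trace_theta(1)[OF that] by (simp add: mult_ac)
  have int: "integrable lborel (f k)" if "k \<in> - {0}" for k
    using Gamma_integral_scaled(1)[OF w0 pos[OF that]] by (simp add: f_def[abs_def])
  have ptw: "((\<lambda>k. f k t) has_sum P t) (- {0})" for t
  proof (cases "t > 0")
    case True
    have "((\<lambda>k. complex_of_real (exp (- ((pi * norm_sq k) * t)))) has_sum of_real (heat_trace t)) (- {0})"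
      by (rule has_sum_of_real[OF trace[OF True]])
    from has_sum_cmult_left[OF this, of "cpow t (w - 1)"] show ?thesis
      using True by (simp add: f_def P_def)
  qed (simp add: f_def P_def)
  have nrm: "(\<lambda>k. norm (f k t)) summable_on - {0}" for t
  proof (cases "t > 0")
    case True
    have "(\<lambda>k. exp (- ((pi * norm_sq k) * t)) * norm (cpow t (w - 1))) summable_on - {0}"
      by (rule summable_on_cmult_left) (use trace[OF True] in \<open>auto simp: summable_on_def\<close>)
    then show ?thesis using True by (simp add: f_def norm_mult)
  qed (simp add: f_def)
  have "(\<lambda>k. Gamma (Re w) * pi powr - Re w * (norm_sq k powr - Re w)) summable_on - {0}"
    by (intro summable_on_cmult_right norm_sq_powr_summable w)
  also have "?this \<longleftrightarrow> (\<lambda>k. \<integral>t. norm (f k t) \<partial>lborel) summable_on - {0}"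
  proof (rule summable_on_cong)
    fix k :: "int \<times> int" assume "k \<in> - {0}"
    then show "Gamma (Re w) * pi powr - Re w * (norm_sq k powr - Re w) = (\<integral>t. norm (f k t) \<partial>lborel)"
      unfolding f_def Gamma_integral_scaled_norm[OF w0 pos[OF \<open>k \<in> - {0}\<close>]]
      using norm_sq_ge_1[of k] by (simp add: powr_mult)
  qed
  finally have sum: "(\<lambda>k. \<integral>t. norm (f k t) \<partial>lborel) summable_on - {0}" .
  have cnt: "countable (- {0 :: int \<times> int})" by simp
  note res = has_sum_integral[OF cnt infinite_lattice int ptw nrm sum]
  show "integrable lborel P" by (rule res(1))
  have "((\<lambda>k. \<integral>t. f k t \<partial>lborel) has_sum (\<integral>t. P t \<partial>lborel)) (- {0})" by (rule res(2))
  also have "?this \<longleftrightarrow> ((\<lambda>k. Gamma w * cpow (pi * norm_sq k) (- w)) has_sum (\<integral>t. P t \<partial>lborel)) (- {0})"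
    by (rule has_sum_cong) (use Gamma_integral_scaled(2)[OF w0 pos] in \<open>simp add: f_def\<close>)
  finally show "((\<lambda>k. Gamma w * cpow (pi * norm_sq k) (- w)) has_sum (\<integral>t. P t \<partial>lborel)) (- {0})" .
qed

lemma cpow_has_vector_derivative:
  assumes "x > 0" "z \<noteq> 0"
  shows "((\<lambda>t. cpow t z / z) has_vector_derivative cpow x (z - 1)) (at x)"
proof -
  have "((\<lambda>t. z * complex_of_real (ln t)) has_vector_derivative z * of_real (1 / x)) (at x)"
    using assms by (intro has_vector_derivative_mult_right has_vector_derivative_of_real)
      (auto intro!: derivative_eq_intros simp: has_real_derivative_iff_has_vector_derivative[symmetric])
  from field_vector_diff_chain_at[OF this DERIV_exp]
  have "((\<lambda>t. cpow t z) has_vector_derivative (z * of_real (1 / x)) * cpow x z) (at x)"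
    by (simp add: cpow_def[abs_def] o_def)
  from has_vector_derivative_divide[OF this, of z]
  have "((\<lambda>t. cpow t z / z) has_vector_derivative (z * of_real (1 / x)) * cpow x z / z) (at x)" .
  moreover have "(z * of_real (1 / x)) * cpow x z / z = cpow x (z - 1)"
    using assms cpow_add[of x "z - 1" 1] by (simp add: cpow_1 field_simps)
  ultimately show ?thesis by simp
qed

lemma cpow_integral_to_inf:
  assumes z: "Re z < - 1"
  shows "integrable lborel (\<lambda>t. indicator {1<..} t *\<^sub>R cpow t z)"
    and "(\<integral>t. indicator {1<..} t *\<^sub>R cpow t z \<partial>lborel) = - 1 / (z + 1)"
proof -
  have "((\<lambda>t. t powr Re z) has_integral - (1 powr (Re z + 1)) / (Re z + 1)) {1..}"
    by (rule has_integral_powr_to_inf) (use z in auto)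
  then have "(\<lambda>t. t powr Re z) absolutely_integrable_on {1..}"
    by (intro nonnegative_absolutely_integrable_1) auto
  then have "(\<lambda>t. t powr Re z) absolutely_integrable_on {1<..}"
    by (rule set_integrable_subset) auto
  moreover have "(\<lambda>t::real. indicator {1<..} t *\<^sub>R t powr Re z) \<in> borel_measurable lborel"
    by measurable
  ultimately have i: "integrable lborel (\<lambda>t. indicator {1<..} t *\<^sub>R t powr Re z)"
    using integrable_completion unfolding set_integrable_def by blast
  show int: "integrable lborel (\<lambda>t. indicator {1<..} t *\<^sub>R cpow t z)"
    by (rule Bochner_Integration.integrable_bound[OF i])
       (auto simp: indicator_def norm_cpow intro!: AE_I2)
  have nz: "z + 1 \<noteq> 0" using z by (auto simp: complex_eq_iff)
  have ei: "einterval 1 \<infinity> = {1<..}" by (auto simp: einterval_def one_ereal_def)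
  have "(LBINT t=1..\<infinity>. cpow t z) = 0 - cpow 1 (z + 1) / (z + 1)"
  proof (rule interval_integral_FTC_integrable)
    show "((\<lambda>t. cpow t (z + 1) / (z + 1)) has_vector_derivative cpow x z) (at x)" if "1 < ereal x" for x
      using cpow_has_vector_derivative[of x "z + 1"] that nz by (simp add: one_ereal_def)
    show "isCont (\<lambda>t. cpow t z) x" if "1 < ereal x" for x
      using that by (intro cpow_isCont) (simp add: one_ereal_def)
    show "set_integrable lborel (einterval 1 \<infinity>) (\<lambda>t. cpow t z)"
      using int by (simp add: set_integrable_def ei)
    have "((\<lambda>t. cpow t (z + 1) / (z + 1)) \<longlongrightarrow> cpow 1 (z + 1) / (z + 1)) (at_right 1)"
      using cpow_isCont[of 1 "z + 1"] nz
      by (intro tendsto_intros) (auto simp: isCont_def intro: filterlim_mono at_le)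
    then show "(((\<lambda>t. cpow t (z + 1) / (z + 1)) \<circ> real_of_ereal) \<longlongrightarrow> cpow 1 (z + 1) / (z + 1)) (at_right 1)"
      unfolding one_ereal_def ereal_tendsto_simps1 .
    have "((\<lambda>t. norm (cpow t (z + 1) / (z + 1))) \<longlongrightarrow> 0) at_top"
    proof (rule Lim_transform_eventually)
      show "((\<lambda>t. t powr (Re z + 1) / norm (z + 1)) \<longlongrightarrow> 0) at_top"
        using z by (intro tendsto_divide_zero tendsto_neg_powr filterlim_ident) auto
      show "\<forall>\<^sub>F t in at_top. t powr (Re z + 1) / norm (z + 1) = norm (cpow t (z + 1) / (z + 1))"
        using eventually_gt_at_top[of 0] by eventually_elim (simp add: norm_divide norm_cpow)
    qed
    then have "((\<lambda>t. cpow t (z + 1) / (z + 1)) \<longlongrightarrow> 0) at_top" by (rule tendsto_norm_zero_cancel)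
    then show "(((\<lambda>t. cpow t (z + 1) / (z + 1)) \<circ> real_of_ereal) \<longlongrightarrow> 0) (at_left \<infinity>)"
      unfolding ereal_tendsto_simps1 .
  qed auto
  then show "(\<integral>t. indicator {1<..} t *\<^sub>R cpow t z \<partial>lborel) = - 1 / (z + 1)"
    by (simp add: interval_lebesgue_integral_def set_lebesgue_integral_def ei cpow_def)
qed

section \<open>Continuation of the Epstein zeta function\<close>

lemma exp_powr_tail_integrable:
  assumes "R \<ge> 0"
  shows "integrable lborel (\<lambda>t. indicator {1<..} t *\<^sub>R (exp (- (pi * t)) * t powr R))"
proof -
  have "Re (of_real (R + 1)) > 0" using assms by simp
  from integrable_norm[OF Gamma_integral_scaled(1)[OF this pi_gt_zero]]
  show ?thesis
  proof (rule Bochner_Integration.integrable_bound)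
    show "AE t in lborel. norm (indicator {1<..} t *\<^sub>R (exp (- (pi * t)) * t powr R))
      \<le> norm (norm (indicator {0<..} t *\<^sub>R (complex_of_real (exp (- (pi * t))) * cpow t (of_real (R + 1) - 1))))"
      by (intro AE_I2) (auto simp: indicator_def norm_mult norm_cpow)
  qed measurable
qed

text \<open>
  Only the part \<open>t > 1\<close> of the Mellin transform, where the heat trace decays exponentially;
  this makes it entire.
\<close>
definition heat_mellin :: "complex \<Rightarrow> complex" where
  "heat_mellin w = (\<integral>t. indicator {1<..} t *\<^sub>R (of_real (heat_trace t) * cpow t w) \<partial>lborel)"

lemma heat_trace_indicator_measurable:
  "(\<lambda>t. indicator {1<..} t *\<^sub>R heat_trace t) \<in> borel_measurable borel"
  by (rule borel_measurable_continuous_on_indicator)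
     (auto intro: continuous_on_subset[OF heat_trace_continuous])

definition heat_majorant :: "real \<Rightarrow> real \<Rightarrow> real" where
  "heat_majorant R t = exp pi * heat_trace 1 * (indicator {1<..} t *\<^sub>R (exp (- (pi * t)) * t powr R))"

lemma heat_majorant_integrable: "R \<ge> 0 \<Longrightarrow> integrable lborel (heat_majorant R)"
  unfolding heat_majorant_def[abs_def] by (intro integrable_mult_right exp_powr_tail_integrable)

lemma heat_mellin_bound:
  assumes "Re w \<le> R"
  shows "norm (indicator {1<..} t *\<^sub>R (of_real (heat_trace t) * cpow t w)) \<le> heat_majorant R t"
proof (cases "t > 1")
  case True
  have "heat_trace t \<le> exp (- (pi * (t - 1))) * heat_trace 1"
    using True by (intro heat_trace_decay) auto
  also have "exp (- (pi * (t - 1))) = exp pi * exp (- (pi * t))"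
    by (simp add: algebra_simps flip: exp_add)
  finally have "heat_trace t \<le> exp pi * exp (- (pi * t)) * heat_trace 1" .
  moreover have "t powr Re w \<le> t powr R" using assms True by (intro powr_mono) auto
  ultimately have "heat_trace t * t powr Re w \<le> (exp pi * exp (- (pi * t)) * heat_trace 1) * t powr R"
    by (intro mult_mono) (auto simp: heat_trace_nonneg)
  then show ?thesis using True heat_trace_nonneg[of t]
    by (simp add: heat_majorant_def norm_mult norm_cpow mult_ac)
qed (simp add: heat_majorant_def)

lemma heat_mellin_integrable:
  "integrable lborel (\<lambda>t. indicator {1<..} t *\<^sub>R (of_real (heat_trace t) * cpow t w))"
proof -
  have eq: "indicator {1<..} t *\<^sub>R (of_real (heat_trace t) * cpow t w)
      = of_real (indicator {1<..} t *\<^sub>R heat_trace t) * cpow t w" for t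
    by (simp add: indicator_def)
  define R where "R = max 0 (Re w)"
  have "integrable lborel (heat_majorant R)"
    by (rule heat_majorant_integrable) (simp add: R_def)
  then show ?thesis
  proof (rule Bochner_Integration.integrable_bound)
    show "(\<lambda>t. indicator {1<..} t *\<^sub>R (of_real (heat_trace t) * cpow t w)) \<in> borel_measurable lborel"
      unfolding eq using heat_trace_indicator_measurable by measurable
    show "AE t in lborel. norm (indicator {1<..} t *\<^sub>R (of_real (heat_trace t) * cpow t w))
       \<le> norm (heat_majorant R t)"
      by (intro AE_I2 order_trans[OF heat_mellin_bound[of w R]]) (auto simp: R_def)
  qed
qed

text \<open>
  The integral over \<open>{1..n}\<close> depends holomorphically on \<open>w\<close>. The remainder is bounded by the
  tail of an integrable majorant that depends only on a bound for \<open>Re w\<close>, so the convergence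
  is locally uniform.
\<close>
lemma heat_mellin_holomorphic: "heat_mellin holomorphic_on UNIV"
proof -
  define f where "f w t = of_real (heat_trace t) * cpow t w" for w t
  define K where "K n w = integral (cbox 1 (real n)) (f w)" for n w
  have trace_cont: "continuous_on {1..b} heat_trace" for b
    using continuous_on_subset[OF heat_trace_continuous] by auto
  have f_cont: "continuous_on {1..b} (f w)" for w b
    unfolding f_def by (intro continuous_intros trace_cont cpow_continuous_on) auto
  have hol: "K n holomorphic_on UNIV" for n
    unfolding K_def
  proof (rule leibniz_rule_holomorphic)
    show "((\<lambda>w. f w t) has_field_derivative of_real (heat_trace t) * (of_real (ln t) * cpow t w)) (at w within UNIV)" for w t
      unfolding f_def cpow_def by (auto intro!: derivative_eq_intros)
    show "f w integrable_on cbox 1 (real n)" for w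
      by (rule integrable_continuous) (use f_cont in simp)
    have "continuous_on (UNIV \<times> cbox 1 (real n)) (\<lambda>x :: complex \<times> real. heat_trace (snd x))"
      by (rule continuous_on_compose2[OF trace_cont]) (auto intro!: continuous_intros)
    moreover have "continuous_on (UNIV \<times> cbox 1 (real n)) (\<lambda>x :: complex \<times> real. ln (snd x))"
      by (auto intro!: continuous_intros)
    ultimately show "continuous_on (UNIV \<times> cbox 1 (real n)) (\<lambda>(w, t). of_real (heat_trace t) * (of_real (ln t) * cpow t w))"
      unfolding cpow_def split_def by (intro continuous_intros) auto
  qed auto
  have tail: "norm (heat_mellin w - K n w) \<le> (\<integral>t. indicator {real n<..} t *\<^sub>R heat_majorant R t \<partial>lborel)"
    if R: "Re w \<le> R" "R \<ge> 0" and n: "n \<ge> 1" for w R n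
  proof -
    have si: "set_integrable lborel {1<..real n} (f w)"
      using heat_mellin_integrable[of w] unfolding f_def set_integrable_def[symmetric]
      by (rule set_integrable_subset) auto
    have "K n w = integral {1<..real n} (f w)"
      unfolding K_def cbox_interval
      by (rule integral_subset_negligible[symmetric]) (auto intro!: negligible_subset[OF negligible_sing[of "1::real"]])
    also have "\<dots> = (\<integral>t. indicator {1<..real n} t *\<^sub>R f w t \<partial>lborel)"
      using set_borel_integral_eq_integral(2)[OF si] by (simp add: set_lebesgue_integral_def)
    finally have K: "K n w = (\<integral>t. indicator {1<..real n} t *\<^sub>R f w t \<partial>lborel)" .
    have split: "indicator {1<..} t *\<^sub>R f w t - indicator {1<..real n} t *\<^sub>R f w t = indicator {real n<..} t *\<^sub>R f w t" for t
      using n by (auto simp: indicator_def)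
    have int_diff: "integrable lborel (\<lambda>t. indicator {real n<..} t *\<^sub>R f w t)"
      unfolding split[symmetric]
      using heat_mellin_integrable[of w] si unfolding f_def set_integrable_def
      by (rule Bochner_Integration.integrable_diff)
    have "heat_mellin w - K n w = (\<integral>t. indicator {1<..} t *\<^sub>R f w t \<partial>lborel) - (\<integral>t. indicator {1<..real n} t *\<^sub>R f w t \<partial>lborel)"
      by (simp add: K heat_mellin_def f_def)
    also have "\<dots> = (\<integral>t. indicator {1<..} t *\<^sub>R f w t - indicator {1<..real n} t *\<^sub>R f w t \<partial>lborel)"
      using heat_mellin_integrable[of w] si unfolding f_def set_integrable_def
      by (rule Bochner_Integration.integral_diff[symmetric])
    also have "\<dots> = (\<integral>t. indicator {real n<..} t *\<^sub>R f w t \<partial>lborel)"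
      unfolding split ..
    finally have "norm (heat_mellin w - K n w) = norm (\<integral>t. indicator {real n<..} t *\<^sub>R f w t \<partial>lborel)"
      by simp
    also have "\<dots> \<le> (\<integral>t. norm (indicator {real n<..} t *\<^sub>R f w t) \<partial>lborel)"
      by (rule integral_norm_bound)
    also have "\<dots> \<le> (\<integral>t. indicator {real n<..} t *\<^sub>R heat_majorant R t \<partial>lborel)"
    proof (rule integral_mono)
      show "integrable lborel (\<lambda>t. indicator {real n<..} t *\<^sub>R heat_majorant R t)"
        by (intro integrable_mult_indicator heat_majorant_integrable R) auto
      show "norm (indicator {real n<..} t *\<^sub>R f w t) \<le> indicator {real n<..} t *\<^sub>R heat_majorant R t" for t
        using heat_mellin_bound[OF R(1), of t] n by (auto simp: f_def indicator_def)
    qed (intro integrable_norm int_diff)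
    finally show ?thesis .
  qed
  have tail_lim: "(\<lambda>n. \<integral>t. indicator {real n<..} t *\<^sub>R heat_majorant R t \<partial>lborel) \<longlonglongrightarrow> 0"
    if "R \<ge> 0" for R
  proof -
    note g = heat_majorant_integrable[OF that]
    have "(\<lambda>n. \<integral>t. indicator {real n<..} t *\<^sub>R heat_majorant R t \<partial>lborel) \<longlonglongrightarrow> integral\<^sup>L lborel (\<lambda>t::real. 0 :: real)"
    proof (rule integral_dominated_convergence)
      show "(\<lambda>t. indicator {real n<..} t *\<^sub>R heat_majorant R t) \<in> borel_measurable lborel" for n
        using borel_measurable_integrable[OF g] by measurable
      show "integrable lborel (\<lambda>t. norm (heat_majorant R t))" using g by (rule integrable_norm)
      show "AE t in lborel. (\<lambda>n. indicator {real n<..} t *\<^sub>R heat_majorant R t) \<longlonglongrightarrow> 0"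
      proof (rule AE_I2)
        fix t :: real
        have "\<forall>\<^sub>F n in sequentially. indicator {real n<..} t *\<^sub>R heat_majorant R t = 0"
          using eventually_ge_at_top[of "nat \<lceil>t\<rceil>"]
          by eventually_elim (auto simp: indicator_def)
        then show "(\<lambda>n. indicator {real n<..} t *\<^sub>R heat_majorant R t) \<longlonglongrightarrow> 0"
          by (rule tendsto_eventually)
      qed
      show "AE t in lborel. norm (indicator {real n<..} t *\<^sub>R heat_majorant R t) \<le> norm (heat_majorant R t)" for n
        by (intro AE_I2) (auto simp: indicator_def)
    qed simp
    then show ?thesis by simp
  qed
  show ?thesis
  proof (rule holomorphic_uniform_sequence[OF open_UNIV hol])
    fix z :: complex
    define R where "R = norm z + 1"
    have "uniform_limit (cball z 1) K heat_mellin sequentially"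
    proof (rule uniform_limitI)
      fix e :: real assume "e > 0"
      have R: "R \<ge> 0" by (simp add: R_def)
      have "\<forall>\<^sub>F n in sequentially. (\<integral>t. indicator {real n<..} t *\<^sub>R heat_majorant R t \<partial>lborel) < e"
        by (rule order_tendstoD(2)[OF tail_lim[OF R] \<open>e > 0\<close>])
      with eventually_ge_at_top[of 1]
      show "\<forall>\<^sub>F n in sequentially. \<forall>w\<in>cball z 1. dist (K n w) (heat_mellin w) < e"
      proof eventually_elim
        case (elim n)
        show ?case
        proof
          fix w assume "w \<in> cball z 1"
          then have "norm w \<le> R" using norm_triangle_ineq2[of w z] by (simp add: R_def dist_norm norm_minus_commute)
          then have "Re w \<le> R" using complex_Re_le_cmod[of w] by linarith
          from tail[OF this R elim(1)] elim(2) show "dist (K n w) (heat_mellin w) < e"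
            by (simp add: dist_norm norm_minus_commute)
        qed
      qed
    qed
    then show "\<exists>d>0. cball z d \<subseteq> UNIV \<and> uniform_limit (cball z d) K heat_mellin sequentially"
      by (intro exI[of _ 1]) auto
  qed
qed

text \<open>
  Riemann's argument: on \<open>{0<..<1}\<close> substitute \<open>t = 1 / u\<close> and apply the inversion formula of
  the heat trace. Its polynomial part \<open>u - 1\<close> produces the two rational terms.
\<close>
lemma epstein_mellin_split:
  assumes w: "Re w > 1"
  shows "(\<integral>t. indicator {0<..} t *\<^sub>R (of_real (heat_trace t) * cpow t (w - 1)) \<partial>lborel)
      = heat_mellin (w - 1) + heat_mellin (- w) + 1 / (w - 1) - 1 / w"
proof -
  define p where "p t = of_real (heat_trace t) * cpow t (w - 1)" for t
  define P where "P t = indicator {0<..} t *\<^sub>R p t" for t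
  have P: "integrable lborel P" using epstein_mellin(1)[OF w] by (simp add: P_def[abs_def] p_def)
  have Pi: "integrable lborel (\<lambda>t. indicator S t *\<^sub>R P t)" if "S \<in> sets lborel" for S
    by (rule integrable_mult_indicator[OF that P])
  have "integral\<^sup>L lborel P = (\<integral>t. indicator {0<..<1} t *\<^sub>R P t + (indicator {1} t *\<^sub>R P t + indicator {1<..} t *\<^sub>R P t) \<partial>lborel)"
    by (rule Bochner_Integration.integral_cong) (auto simp: P_def indicator_def)
  also have "\<dots> = (\<integral>t. indicator {0<..<1} t *\<^sub>R P t \<partial>lborel) +
      ((\<integral>t. indicator {1} t *\<^sub>R P t \<partial>lborel) + (\<integral>t. indicator {1<..} t *\<^sub>R P t \<partial>lborel))"
    by (simp add: Pi)
  also have "(\<integral>t. indicator {1} t *\<^sub>R P t \<partial>lborel) = 0"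
    by (rule integral_eq_zero_AE) (use AE_lborel_singleton[of "1::real"] in eventually_elim, simp)
  also have "(\<integral>t. indicator {1<..} t *\<^sub>R P t \<partial>lborel) = heat_mellin (w - 1)"
    unfolding heat_mellin_def by (rule Bochner_Integration.integral_cong) (auto simp: P_def p_def indicator_def)
  also have "(\<integral>t. indicator {0<..<1} t *\<^sub>R P t \<partial>lborel) = heat_mellin (- w) + 1 / (w - 1) - 1 / w"
  proof -
    define q where "q u = of_real (heat_trace u) * cpow u (- w) + cpow u (- w) - cpow u (- w - 1)" for u
    have Pp: "(\<lambda>t. indicator {0<..<1} t *\<^sub>R P t) = (\<lambda>t. indicator {0<..<1} t *\<^sub>R p t)"
      by (auto simp: P_def indicator_def fun_eq_iff)
    have i1: "integrable lborel (\<lambda>t. indicator {0<..<1} t *\<^sub>R p t)"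
      using Pi[of "{0<..<1}"] unfolding Pp by simp
    then have "integrable lebesgue (\<lambda>t. indicator {0<..<1} t *\<^sub>R p t)"
      using integrable_completion borel_measurable_integrable by blast
    then have ai: "p absolutely_integrable_on {0<..<1}" by (simp add: set_integrable_def)
    have img: "(\<lambda>u::real. 1 / u) ` {1<..} = {0<..<1}"
    proof (intro equalityI subsetI)
      fix t :: real assume "t \<in> {0<..<1}"
      then show "t \<in> (\<lambda>u. 1 / u) ` {1<..}" by (intro image_eqI[of _ _ "1 / t"]) auto
    qed auto
    have sub: "\<bar>- 1 / u\<^sup>2\<bar> *\<^sub>R p (1 / u) = q u" if "u > 1" for u
    proof -
      have c1: "cpow (1 / u) (w - 1) = of_real u * (of_real u * cpow u (- w - 1))"
        using that cpow_add[of u 1 "1 + (- w - 1)"] cpow_add[of u 1 "- w - 1"] by (simp add: cpow_inverse cpow_1)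
      have c2: "cpow u (- w) = of_real u * cpow u (- w - 1)"
        using that cpow_add[of u 1 "- w - 1"] by (simp add: cpow_1)
      have "heat_trace (1 / u) = u * heat_trace u + u - 1"
        using that by (intro heat_trace_inversion) auto
      then have inv: "complex_of_real (heat_trace (1 / u)) = of_real u * of_real (heat_trace u) + of_real u - 1"
        by simp
      show ?thesis using that unfolding p_def q_def c1 c2 inv
        by (simp add: scaleR_conv_of_real field_simps power2_eq_square)
    qed
    have der: "((\<lambda>u. 1 / u) has_real_derivative - 1 / u\<^sup>2) (at u within {1<..})" if "u \<in> {1<..}" for u :: real
      using that by (auto intro!: derivative_eq_intros simp: power2_eq_square)
    have inj: "inj_on (\<lambda>u::real. 1 / u) {1<..}" by (auto simp: inj_on_def)
    have "{1<..} \<in> sets (lebesgue :: real measure)" by simp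
    from has_absolute_integral_change_of_variables_real[OF this der inj, of p "integral {0<..<1} p"]
    have "integral {1<..} (\<lambda>u. \<bar>- 1 / u\<^sup>2\<bar> *\<^sub>R p (1 / u)) = integral {0<..<1} p"
      using ai unfolding img by blast
    also have "integral {1<..} (\<lambda>u. \<bar>- 1 / u\<^sup>2\<bar> *\<^sub>R p (1 / u)) = integral {1<..} q"
      by (rule Henstock_Kurzweil_Integration.integral_cong) (use sub in auto)
    finally have "integral {0<..<1} p = integral {1<..} q" by simp
    moreover have "(\<integral>t. indicator {0<..<1} t *\<^sub>R p t \<partial>lborel) = integral {0<..<1} p"
      using set_borel_integral_eq_integral(2)[of "{0<..<1}" p] i1
      by (simp add: set_integrable_def set_lebesgue_integral_def)
    moreover have "integral {1<..} q = heat_mellin (- w) + 1 / (w - 1) - 1 / w"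
    proof -
      have c: "integrable lborel (\<lambda>t. indicator {1<..} t *\<^sub>R cpow t (- w))"
        "(\<integral>t. indicator {1<..} t *\<^sub>R cpow t (- w) \<partial>lborel) = - 1 / (- w + 1)"
        "integrable lborel (\<lambda>t. indicator {1<..} t *\<^sub>R cpow t (- w - 1))"
        "(\<integral>t. indicator {1<..} t *\<^sub>R cpow t (- w - 1) \<partial>lborel) = - 1 / (- w - 1 + 1)"
        by (rule cpow_integral_to_inf; use w in simp)+
      have qs: "indicator {1<..} u *\<^sub>R q u = indicator {1<..} u *\<^sub>R (of_real (heat_trace u) * cpow u (- w))
          + indicator {1<..} u *\<^sub>R cpow u (- w) - indicator {1<..} u *\<^sub>R cpow u (- w - 1)" for u
        by (simp add: q_def algebra_simps)
      have "integrable lborel (\<lambda>u. indicator {1<..} u *\<^sub>R q u)"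
        unfolding qs by (intro Bochner_Integration.integrable_diff Bochner_Integration.integrable_add c heat_mellin_integrable)
      then have "integral {1<..} q = (\<integral>u. indicator {1<..} u *\<^sub>R q u \<partial>lborel)"
        using set_borel_integral_eq_integral(2)[of "{1<..}" q] by (simp add: set_integrable_def set_lebesgue_integral_def)
      also have "\<dots> = heat_mellin (- w) + - 1 / (- w + 1) - - 1 / (- w - 1 + 1)"
        unfolding qs heat_mellin_def
        by (subst Bochner_Integration.integral_diff, intro Bochner_Integration.integrable_add c heat_mellin_integrable, rule c,
            subst Bochner_Integration.integral_add, rule heat_mellin_integrable, rule c, simp only: c)
      also have "\<dots> = heat_mellin (- w) + 1 / (w - 1) - 1 / w"
      proof -
        have "- 1 / (- w + 1) = 1 / (w - 1)" by (simp add: minus_divide_right)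
        then show ?thesis by simp
      qed
      finally show ?thesis .
    qed
    ultimately show ?thesis unfolding Pp by simp
  qed
  finally show ?thesis by (simp add: P_def[abs_def] p_def)
qed

text \<open>
  Drop the factor \<open>1 / \<surd>t \<le> 1\<close> and use exponential decay: the integral is at most \<open>heat_trace
  1 / \<pi> \<le> (3 / 10) / 3\<close>.
\<close>
lemma heat_mellin_half:
  obtains B where "heat_mellin (- 1 / 2) = of_real B" "B \<le> 1 / 10"
proof -
  define g where "g t = indicator {1<..} t *\<^sub>R (heat_trace t * t powr (- 1 / 2))" for t :: real
  have eq: "indicator {1<..} t *\<^sub>R (of_real (heat_trace t) * cpow t (- 1 / 2)) = complex_of_real (g t)" for t
    using cpow_of_real[of t "- 1 / 2"] by (auto simp: g_def indicator_def)
  have g: "integrable lborel g"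
    using heat_mellin_integrable[of "- 1 / 2"] unfolding eq by (simp add: complex_of_real_integrable_eq)
  define e where "e t = norm (indicator {0<..} t *\<^sub>R (complex_of_real (exp (- (pi * t))) * cpow t (1 - 1)))" for t
  have e: "integrable lborel e" "integral\<^sup>L lborel e = 1 / pi"
    unfolding e_def[abs_def]
    by (rule integrable_norm[OF Gamma_integral_scaled(1)], simp, simp)
       (use Gamma_integral_scaled_norm[of 1 pi] in \<open>simp add: powr_minus_divide\<close>)
  have e1: "integrable lborel (\<lambda>t. e (- 1 + 1 * t))"
    using lborel_integrable_real_affine_iff[of 1 e "- 1"] e(1) by simp
  have "integral\<^sup>L lborel g \<le> (\<integral>t. heat_trace 1 * e (- 1 + 1 * t) \<partial>lborel)"
  proof (rule integral_mono[OF g integrable_mult_right[OF e1]])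
    fix t :: real
    show "g t \<le> heat_trace 1 * e (- 1 + 1 * t)"
    proof (cases "t > 1")
      case True
      have "t powr (- 1 / 2) \<le> 1 powr (- 1 / 2)" using True by (intro powr_mono2') auto
      then have "heat_trace t * t powr (- 1 / 2) \<le> heat_trace t * 1" by (intro mult_left_mono heat_trace_nonneg) simp
      also have "\<dots> \<le> exp (- (pi * (t - 1))) * heat_trace 1" using heat_trace_decay[of t] True by simp
      finally show ?thesis using True by (simp add: g_def e_def norm_mult cpow_0 mult.commute algebra_simps)
    next
      case False
      then show ?thesis by (simp add: g_def e_def heat_trace_nonneg)
    qed
  qed
  also have "\<dots> = heat_trace 1 * (1 / pi)"
    using lborel_integral_real_affine[of 1 e "- 1"] e(2) by simp
  also have "\<dots> \<le> (3 / 10) * (1 / 3)"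
    using heat_trace_1_bound pi_gt3 heat_trace_nonneg[of 1] by (intro mult_mono) (auto simp: field_simps)
  finally have "integral\<^sup>L lborel g \<le> 1 / 10" by simp
  moreover have "heat_mellin (- 1 / 2) = of_real (integral\<^sup>L lborel g)"
    unfolding heat_mellin_def eq by simp
  ultimately show thesis using that by blast
qed

lemma ln_two_pi_less: "ln (2 * pi) < 19 / 10"
proof -
  have "2 * pi < 6.6" using pi_approx(2) by simp
  also have "(6.6 :: real) < exp (19 / 10)"
  proof -
    have e: "exp 1 \<ge> (2.71 :: real)" using e_approx_32 by (simp add: abs_if split: if_split_asm)
    have "(2.71 :: real) * 2.71 \<le> exp 1 * exp 1" by (rule mult_mono[OF e e]) auto
    also have "\<dots> = exp (19 / 10) * exp (1 / 10)" by (simp flip: exp_add)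
    also have "\<dots> \<le> exp (19 / 10) * (1 + 1 / 10 + (1 / 10)\<^sup>2)" by (intro mult_left_mono exp_bound) auto
    finally show ?thesis by (simp add: power2_eq_square)
  qed
  finally have "ln (2 * pi) < ln (exp (19 / 10))" by (subst ln_less_cancel_iff) auto
  then show ?thesis by simp
qed

text \<open>
  The function \<open>W\<close> is \<open>(w - 1) Z(w)\<close> for the Epstein zeta function \<open>Z\<close>, whose only pole is a
  simple one at 1.
\<close>
definition entire_epstein :: "(complex \<Rightarrow> complex) \<Rightarrow> bool" where
  "entire_epstein W \<longleftrightarrow> W holomorphic_on UNIV \<and>
     (\<forall>w. 1 < Re w \<longrightarrow> ((\<lambda>k. cpow (norm_sq k) (- w)) has_sum W w / (w - 1)) (- {0}))"

text \<open>
  Dividing the Mellin transform by \<open>\<Gamma>(w)\<close> removes the pole at 0, since \<open>1 / (w \<Gamma>(w)) = 1 / \<Gamma>(w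
  + 1)\<close>. At \<open>w = 1/2\<close> all factors are explicit, with \<open>\<Gamma>(1/2) = \<surd>\<pi>\<close>, and \<open>W(1/2) = 2 - B\<close> with
  \<open>B \<le> 1/10\<close>.
\<close>
lemma epstein_continuation:
  obtains W r where "entire_epstein W" and "W (1 / 2) = complex_of_real r" and "ln (2 * pi) < r"
proof -
  define W where "W w = cpow pi w * ((w - 1) * rGamma w * (heat_mellin (w - 1) + heat_mellin (- w))
      + rGamma w - (w - 1) * rGamma (w + 1))" for w
  have W_hol: "W holomorphic_on UNIV"
    unfolding W_def cpow_def
    by (intro holomorphic_intros holomorphic_on_compose_gen[OF _ heat_mellin_holomorphic, unfolded o_def]) auto
  have W_sum: "((\<lambda>k. cpow (norm_sq k) (- w)) has_sum W w / (w - 1)) (- {0})" if w: "Re w > 1" for w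
  proof -
    have nz: "w \<noteq> 0" "w - 1 \<noteq> 0" using w by auto
    have "w \<notin> \<int>\<^sub>\<le>\<^sub>0" using w by (auto elim!: nonpos_Ints_cases)
    then have G: "Gamma w \<noteq> 0" by (simp add: Gamma_eq_zero_iff)
    define M where "M = heat_mellin (w - 1) + heat_mellin (- w) + 1 / (w - 1) - 1 / w"
    have "((\<lambda>k. Gamma w * cpow (pi * norm_sq k) (- w)) has_sum M) (- {0})"
      using epstein_mellin(2)[OF w] epstein_mellin_split[OF w] by (simp add: M_def)
    from has_sum_cmult_right[OF this, of "rGamma w * cpow pi w"]
    have "((\<lambda>k. rGamma w * cpow pi w * (Gamma w * cpow (pi * norm_sq k) (- w))) has_sum rGamma w * cpow pi w * M) (- {0})" .
    also have "?this \<longleftrightarrow> ((\<lambda>k. cpow (norm_sq k) (- w)) has_sum rGamma w * cpow pi w * M) (- {0})"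
    proof (rule has_sum_cong)
      fix k :: "int \<times> int" assume "k \<in> - {0}"
      then have "norm_sq k > 0" using norm_sq_ge_1[of k] by auto
      then show "rGamma w * cpow pi w * (Gamma w * cpow (pi * norm_sq k) (- w)) = cpow (norm_sq k) (- w)"
        using G cpow_nonzero[of pi w] by (simp add: cpow_mult cpow_uminus rGamma_inverse_Gamma field_simps)
    qed
    also have "rGamma w * cpow pi w * M = W w / (w - 1)"
    proof -
      have "rGamma w = w * rGamma (w + 1)" by (rule rGamma_plus1[symmetric])
      then have rG: "rGamma w / w = rGamma (w + 1)" using nz by simp
      have "W w / (w - 1) = cpow pi w * (rGamma w * (heat_mellin (w - 1) + heat_mellin (- w))
          + rGamma w / (w - 1) - rGamma (w + 1))"
        using nz(2) by (simp add: W_def field_simps)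
      then show ?thesis unfolding rG[symmetric] M_def by (simp add: algebra_simps)
    qed
    finally show ?thesis .
  qed
  obtain B where B: "heat_mellin (- 1 / 2) = of_real B" "B \<le> 1 / 10" by (rule heat_mellin_half)
  have s: "complex_of_real (sqrt pi) \<noteq> 0" by simp
  have r1: "rGamma (1 / 2 :: complex) = 1 / of_real (sqrt pi)"
    by (simp add: rGamma_inverse_Gamma Gamma_one_half_complex inverse_eq_divide)
  have r2: "rGamma (1 / 2 + 1 :: complex) = 2 / of_real (sqrt pi)"
    using rGamma_plus1[of "1 / 2 :: complex"] unfolding r1 by simp
  have c: "cpow pi (1 / 2) = of_real (sqrt pi)"
    using cpow_of_real[of pi "1 / 2"] by (simp add: powr_half_sqrt)
  have "W (1 / 2) = of_real (sqrt pi) * ((1 / 2 - 1) * (1 / of_real (sqrt pi)) * (of_real B + of_real B)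
      + 1 / of_real (sqrt pi) - (1 / 2 - 1) * (2 / of_real (sqrt pi)))"
    using B(1) unfolding W_def r1 r2 c by simp
  also have "\<dots> = of_real (2 - B)" using s by (simp add: field_simps)
  finally have "W (1 / 2) = of_real (2 - B)" .
  moreover have "ln (2 * pi) < 2 - B" using ln_two_pi_less B(2) by linarith
  moreover have "entire_epstein W" using W_hol W_sum by (simp add: entire_epstein_def)
  ultimately show thesis using that by blast
qed

section \<open>A hyperbolic parametrisation of the shifted spectrum\<close>

text \<open>
  The partial sums converge locally uniformly by the Weierstrass M-test.
\<close>
lemma holomorphic_on_infsum:
  fixes f :: "'i \<Rightarrow> complex \<Rightarrow> complex"
  assumes hol: "\<And>i. i \<in> I \<Longrightarrow> f i holomorphic_on S"
    and loc: "\<And>z. z \<in> S \<Longrightarrow> \<exists>d>0. \<exists>B. cball z d \<subseteq> S \<and> B summable_on I \<and>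
       (\<forall>i\<in>I. \<forall>w\<in>cball z d. norm (f i w) \<le> B i)"
  shows "(\<lambda>w. \<Sum>\<^sub>\<infinity>i\<in>I. f i w) holomorphic_on S"
  unfolding holomorphic_on_def
proof
  fix z assume "z \<in> S"
  from loc[OF this] obtain d B where d: "d > 0" "cball z d \<subseteq> S" and B: "B summable_on I"
    and le: "\<And>i w. i \<in> I \<Longrightarrow> w \<in> cball z d \<Longrightarrow> norm (f i w) \<le> B i" by blast
  have ul: "uniform_limit (cball z d) (\<lambda>X w. \<Sum>i\<in>X. f i w) (\<lambda>w. \<Sum>\<^sub>\<infinity>i\<in>I. f i w) (finite_subsets_at_top I)"
    by (rule Weierstrass_m_test_general[OF le B])
  have fin: "(\<lambda>w. \<Sum>i\<in>X. f i w) holomorphic_on cball z d" if "X \<subseteq> I" for X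
    using that hol d by (intro holomorphic_on_sum) (blast intro: holomorphic_on_subset)
  have ev: "\<forall>\<^sub>F X in finite_subsets_at_top I.
      continuous_on (cball z d) (\<lambda>w. \<Sum>i\<in>X. f i w) \<and> (\<lambda>w. \<Sum>i\<in>X. f i w) holomorphic_on ball z d"
    unfolding eventually_finite_subsets_at_top
    by (intro exI[of _ "{}"])
       (auto intro!: holomorphic_on_imp_continuous_on fin intro: holomorphic_on_subset[OF fin ball_subset_cball])
  obtain "(\<lambda>w. \<Sum>\<^sub>\<infinity>i\<in>I. f i w) holomorphic_on ball z d"
    using holomorphic_uniform_limit[OF ev ul] by (auto simp: finite_subsets_at_top_neq_bot)
  then have "(\<lambda>w. \<Sum>\<^sub>\<infinity>i\<in>I. f i w) field_differentiable at z"
    using d(1) by (auto intro: holomorphic_on_imp_differentiable_at)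
  then show "(\<lambda>w. \<Sum>\<^sub>\<infinity>i\<in>I. f i w) field_differentiable at z within S"
    by (rule field_differentiable_at_within)
qed

text \<open>
  The number \<open>y\<close> with \<open>sinh y = 1 / (2 \<surd>\<nu>)\<close>. It turns the two shifts of \<open>\<mu> = \<surd>(\<nu> + 1/4)\<close> by \<open>\<plusminus>
  1/2\<close> into the factors \<open>exp (\<plusminus> y)\<close>, because \<open>(\<mu> + 1/2) (\<mu> - 1/2) = \<nu>\<close>.
\<close>
definition hyp_angle :: "real \<Rightarrow> real" where
  "hyp_angle \<nu> = ln (sqrt (\<nu> + 1 / 4) + 1 / 2) - ln \<nu> / 2"

lemma sinh_ge_self:
  assumes "(y :: real) \<ge> 0" shows "y \<le> sinh y"
proof -
  have "sinh 0 - 0 \<le> sinh y - y"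
  proof (rule DERIV_nonneg_imp_nondecreasing[OF assms])
    fix x :: real
    have "((\<lambda>x. sinh x - x) has_real_derivative cosh x - 1) (at x)"
      by (auto intro!: derivative_eq_intros)
    then show "\<exists>D. ((\<lambda>x. sinh x - x) has_real_derivative D) (at x) \<and> 0 \<le> D"
      using cosh_real_ge_1[of x] by (intro exI[of _ "cosh x - 1"]) auto
  qed
  then show ?thesis by simp
qed

text \<open>
  The difference of the two sides vanishes at 0 and has derivative \<open>s (cosh y - cosh (s y)) \<ge>
  0\<close>.
\<close>
lemma sinh_convex:
  assumes "(y :: real) \<ge> 0" "0 \<le> s" "s \<le> 1"
  shows "sinh (s * y) \<le> s * sinh y"
proof -
  have "s * sinh 0 - sinh (s * 0) \<le> s * sinh y - sinh (s * y)"
  proof (rule DERIV_nonneg_imp_nondecreasing[OF assms(1)])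
    fix x :: real assume x: "0 \<le> x"
    have "((\<lambda>x. s * sinh x - sinh (s * x)) has_real_derivative s * cosh x - s * cosh (s * x)) (at x)"
      by (auto intro!: derivative_eq_intros)
    moreover have "cosh (s * x) \<le> cosh x"
      using assms x by (subst cosh_real_nonneg_le_iff) (auto simp: mult_left_le_one_le)
    then have "0 \<le> s * cosh x - s * cosh (s * x)" using assms by (simp add: mult_left_mono)
    ultimately show "\<exists>D. ((\<lambda>x. s * sinh x - sinh (s * x)) has_real_derivative D) (at x) \<and> 0 \<le> D"
      by blast
  qed
  then show ?thesis by simp
qed

lemma exp_taylor_2: "norm (exp z - 1 - z - z\<^sup>2 / 2) \<le> exp (norm z) * norm z ^ 3" for z :: "'a::{banach,real_normed_field}"
proof -
  have "norm (exp z - (\<Sum>i\<le>2. z ^ i / fact i)) \<le> exp (norm z) * norm z ^ Suc 2 / fact 2"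
    by (rule Taylor_exp_field)
  also have "\<dots> \<le> exp (norm z) * norm z ^ 3" by simp
  finally show ?thesis by (simp add: numeral_2_eq_2 algebra_simps)
qed

lemma sinh_cubic_bound:
  assumes "0 \<le> y" "y \<le> (1 / 2 :: real)"
  shows "sinh y - y \<le> 2 * y ^ 3"
proof -
  have e: "exp y \<le> 2" using exp_bound_half[of y] assms by simp
  have "\<bar>exp y - 1 - y - y\<^sup>2 / 2\<bar> \<le> exp y * y ^ 3" "\<bar>exp (- y) - 1 + y - y\<^sup>2 / 2\<bar> \<le> exp y * y ^ 3"
    using exp_taylor_2[of y] exp_taylor_2[of "- y"] assms by simp_all
  moreover define P where "P = exp y * y ^ 3"
  ultimately have "\<bar>exp y - 1 - y - y\<^sup>2 / 2\<bar> \<le> P" "\<bar>exp (- y) - 1 + y - y\<^sup>2 / 2\<bar> \<le> P"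
    by simp_all
  then have "exp y \<le> P + 1 + y + y\<^sup>2 / 2" "1 - y + y\<^sup>2 / 2 - P \<le> exp (- y)"
    by (simp_all only: abs_le_iff) linarith+
  then have "(exp y - exp (- y)) / 2 - y \<le> P" by argo
  also have "P \<le> 2 * y ^ 3" unfolding P_def using e assms by (intro mult_right_mono) auto
  finally have "(exp y - exp (- y)) / 2 - y \<le> 2 * y ^ 3" .
  then show ?thesis by (simp add: sinh_field_def)
qed

lemma hyp_angle:
  assumes "\<nu> \<ge> 1"
  shows "ln (sqrt (\<nu> + 1 / 4) + 1 / 2) = ln \<nu> / 2 + hyp_angle \<nu>"
    and "ln (sqrt (\<nu> + 1 / 4) - 1 / 2) = ln \<nu> / 2 - hyp_angle \<nu>"
    and "sinh (hyp_angle \<nu>) = 1 / (2 * sqrt \<nu>)"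
    and "0 \<le> hyp_angle \<nu>"
proof -
  define \<mu> where "\<mu> = sqrt (\<nu> + 1 / 4)"
  have \<mu>2: "\<mu> * \<mu> = \<nu> + 1 / 4" using assms by (simp add: \<mu>_def)
  have "1 < \<mu>" using assms by (simp add: \<mu>_def)
  then have pos: "\<mu> + 1 / 2 > 0" "\<mu> - 1 / 2 > 0" by auto
  have prod: "(\<mu> + 1 / 2) * (\<mu> - 1 / 2) = \<nu>" using \<mu>2 by (simp add: algebra_simps)
  show 1: "ln (sqrt (\<nu> + 1 / 4) + 1 / 2) = ln \<nu> / 2 + hyp_angle \<nu>"
    by (simp add: hyp_angle_def)
  have "ln \<nu> = ln (\<mu> + 1 / 2) + ln (\<mu> - 1 / 2)"
    using ln_mult[of "\<mu> + 1 / 2" "\<mu> - 1 / 2"] pos prod by simp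
  then show 2: "ln (sqrt (\<nu> + 1 / 4) - 1 / 2) = ln \<nu> / 2 - hyp_angle \<nu>"
    by (simp add: hyp_angle_def \<mu>_def field_simps)
  have sq: "exp (ln \<nu> / 2) = sqrt \<nu>"
    using assms by (simp add: powr_half_sqrt[symmetric] powr_def)
  have y: "hyp_angle \<nu> = ln (\<mu> + 1 / 2) - ln \<nu> / 2" "- hyp_angle \<nu> = ln (\<mu> - 1 / 2) - ln \<nu> / 2"
    using 1 2 by (simp_all add: \<mu>_def)
  have "exp (hyp_angle \<nu>) = (\<mu> + 1 / 2) / sqrt \<nu>"
    unfolding y(1) exp_diff sq using pos by simp
  moreover have "exp (- hyp_angle \<nu>) = (\<mu> - 1 / 2) / sqrt \<nu>"
    unfolding y(2) exp_diff sq using pos by simp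
  ultimately have "sinh (hyp_angle \<nu>) = ((\<mu> + 1 / 2) / sqrt \<nu> - (\<mu> - 1 / 2) / sqrt \<nu>) / 2"
    by (simp add: sinh_field_def)
  then show 3: "sinh (hyp_angle \<nu>) = 1 / (2 * sqrt \<nu>)"
    by (simp only: diff_divide_distrib[symmetric]) simp
  have "sinh (hyp_angle \<nu>) \<ge> 0" unfolding 3 using assms by simp
  then show "0 \<le> hyp_angle \<nu>" by simp
qed

lemma powr_eq_cpow:
  assumes "\<nu> \<ge> 1" and e: "e = 1 \<or> e = (- 1 :: real)"
  shows "complex_of_real (sqrt (\<nu> + 1 / 4) + e / 2) powr (- s)
      = cpow \<nu> (- (s / 2)) * exp (- (of_real (e * hyp_angle \<nu>) * s))"
proof -
  have "1 < sqrt (\<nu> + 1 / 4)" using assms by simp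
  with e have pos: "sqrt (\<nu> + 1 / 4) + e / 2 > 0" by (elim disjE) linarith+
  have "ln (sqrt (\<nu> + 1 / 4) + e / 2) = ln \<nu> / 2 + e * hyp_angle \<nu>"
    using e hyp_angle(1,2)[OF assms(1)] by auto
  then show ?thesis
    using cpow_eq_powr[OF pos, of "- s"] by (simp add: cpow_def algebra_simps flip: exp_add)
qed

section \<open>The zeta functions of the cone\<close>

text \<open>
  A term of the zeta function minus the first three terms of its expansion in powers of \<open>1 /
  \<surd>\<nu>\<close>. Those three are multiples of \<open>\<nu>\<close> to the powers \<open>- s / 2\<close>, \<open>- (s + 1) / 2\<close> and \<open>- (s / 2
  + 1)\<close>, whose sums are values of the Epstein zeta function. Stopping one term earlier would
  give convergence for \<open>Re s > 0\<close> only, not in a neighbourhood of 0.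
\<close>
definition cone_remainder :: "real \<Rightarrow> real \<Rightarrow> complex \<Rightarrow> complex" where
  "cone_remainder e \<nu> s = cpow \<nu> (- (s / 2)) *
     (exp (- (of_real (e * hyp_angle \<nu>) * s)) - 1 + of_real e * s / of_real (2 * sqrt \<nu>) - s\<^sup>2 / of_real (8 * \<nu>))"

text \<open>
  With \<open>x = 1 / (2 \<surd>\<nu>)\<close> the remainder consists of the Taylor remainder of the exponential, of
  order \<open>y\<^sup>3\<close>, and of the errors from replacing \<open>y\<close> by \<open>x\<close> in the linear and in the quadratic
  term. All are of order \<open>x\<^sup>3\<close>, since \<open>0 \<le> x - y = sinh y - y \<le> 2 y\<^sup>3\<close>.
\<close>
lemma cone_remainder_bound:
  assumes \<nu>: "\<nu> \<ge> 1" and e: "e = 1 \<or> e = (- 1 :: real)" and s: "norm s \<le> M" "\<delta> - 1 \<le> Re s"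
  shows "norm (cone_remainder e \<nu> s) \<le> (exp M * M ^ 3 + 2 * M + 2 * M\<^sup>2) * \<nu> powr - (1 + \<delta> / 2)"
proof -
  define y x where "y = hyp_angle \<nu>" and "x = 1 / (2 * sqrt \<nu>)"
  have M: "M \<ge> 0" using s(1) norm_ge_zero[of s] by linarith
  have y: "0 \<le> y" "sinh y = x" using hyp_angle[OF \<nu>] by (auto simp: y_def x_def)
  have x: "0 \<le> x" "x \<le> 1 / 2" using \<nu> by (auto simp: x_def field_simps)
  have yx: "y \<le> x" using sinh_ge_self[OF y(1)] y(2) by simp
  have "x - y \<le> 2 * y ^ 3" using sinh_cubic_bound[OF y(1)] yx x y(2) by simp
  also have "\<dots> \<le> 2 * x ^ 3" using yx y by (simp add: power_mono)
  finally have d: "x - y \<le> 2 * x ^ 3" .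
  have d2: "x\<^sup>2 - y\<^sup>2 \<le> 2 * x ^ 3"
  proof -
    have "x\<^sup>2 - y\<^sup>2 = (x - y) * (x + y)" by (simp add: power2_eq_square algebra_simps)
    also have "\<dots> \<le> 2 * x ^ 3 * 1" using d yx x y by (intro mult_mono) auto
    finally show ?thesis by simp
  qed
  define z where "z = - (of_real (e * y) * s)"
  have nz: "norm z = y * norm s" using e y by (auto simp: z_def norm_mult)
  have "norm z \<le> x * M" unfolding nz using s yx y M by (intro mult_mono) auto
  moreover have "x * M \<le> M" using x M by (simp add: mult_left_le_one_le)
  ultimately have z: "norm z \<le> x * M" "norm z \<le> M" by auto
  have z2: "z\<^sup>2 = of_real (y\<^sup>2) * s\<^sup>2" using e by (auto simp: z_def power_mult_distrib)
  have x2: "x\<^sup>2 = 1 / (4 * \<nu>)" using \<nu> by (simp add: x_def power_divide power_mult_distrib)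
  have split: "exp z - 1 + of_real e * s / of_real (2 * sqrt \<nu>) - s\<^sup>2 / of_real (8 * \<nu>)
      = (exp z - 1 - z - z\<^sup>2 / 2) + (of_real e * s) * of_real (x - y) - s\<^sup>2 * of_real (x\<^sup>2 - y\<^sup>2) / 2"
  proof -
    have 1: "of_real e * s / of_real (2 * sqrt \<nu>) = of_real e * s * of_real x"
      by (simp add: x_def)
    have 2: "s\<^sup>2 / of_real (8 * \<nu>) = s\<^sup>2 * of_real (x\<^sup>2) / 2"
      unfolding x2 by simp
    show ?thesis unfolding 1 2 z2 of_real_diff
      by (simp add: z_def algebra_simps add_divide_distrib diff_divide_distrib)
  qed
  have "norm (exp z - 1 + of_real e * s / of_real (2 * sqrt \<nu>) - s\<^sup>2 / of_real (8 * \<nu>))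
     \<le> norm (exp z - 1 - z - z\<^sup>2 / 2) + norm ((of_real e * s) * of_real (x - y)) + norm (s\<^sup>2 * of_real (x\<^sup>2 - y\<^sup>2) / 2)"
    unfolding split using norm_triangle_ineq4 norm_triangle_ineq by (meson add_right_mono order_trans)
  also have "\<dots> \<le> exp M * M ^ 3 * x ^ 3 + 2 * M * x ^ 3 + M\<^sup>2 * x ^ 3"
  proof (intro add_mono)
    have "norm (exp z - 1 - z - z\<^sup>2 / 2) \<le> exp (norm z) * norm z ^ 3" by (rule exp_taylor_2)
    also have "\<dots> \<le> exp M * (x * M) ^ 3" using z by (intro mult_mono power_mono) auto
    finally show "norm (exp z - 1 - z - z\<^sup>2 / 2) \<le> exp M * M ^ 3 * x ^ 3" by (simp add: power_mult_distrib mult_ac)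
    have "norm ((of_real e * s) * of_real (x - y)) = norm s * (x - y)"
      using e yx by (auto simp only: norm_mult norm_of_real)
    also have "\<dots> \<le> M * (2 * x ^ 3)" using s d yx M by (intro mult_mono) auto
    finally show "norm ((of_real e * s) * of_real (x - y)) \<le> 2 * M * x ^ 3" by simp
    have "y\<^sup>2 \<le> x\<^sup>2" using yx y by (intro power_mono)
    then have "norm (s\<^sup>2 * of_real (x\<^sup>2 - y\<^sup>2) / 2) = (norm s)\<^sup>2 * (x\<^sup>2 - y\<^sup>2) / 2"
      by (simp only: norm_mult norm_divide norm_power norm_of_real) simp
    also have "\<dots> \<le> M\<^sup>2 * (2 * x ^ 3) / 2"
      using s d2 \<open>y\<^sup>2 \<le> x\<^sup>2\<close> by (intro divide_right_mono mult_mono power_mono) auto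
    finally show "norm (s\<^sup>2 * of_real (x\<^sup>2 - y\<^sup>2) / 2) \<le> M\<^sup>2 * x ^ 3" by simp
  qed
  also have "\<dots> \<le> (exp M * M ^ 3 + 2 * M + 2 * M\<^sup>2) * x ^ 3" using x by (simp add: algebra_simps)
  also have "x ^ 3 \<le> \<nu> powr - (3 / 2)"
  proof -
    have "x ^ 3 = (1 / 8) * (\<nu> powr - (1 / 2)) ^ 3"
      using \<nu> by (simp add: x_def powr_minus powr_half_sqrt power3_eq_cube field_simps)
    also have "(\<nu> powr - (1 / 2)) ^ 3 = \<nu> powr - (3 / 2)"
      using \<nu> by (simp add: powr_power)
    finally show ?thesis using powr_ge_zero[of \<nu> "- (3 / 2)"] by linarith
  qed
  finally have b: "norm (exp z - 1 + of_real e * s / of_real (2 * sqrt \<nu>) - s\<^sup>2 / of_real (8 * \<nu>))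
      \<le> (exp M * M ^ 3 + 2 * M + 2 * M\<^sup>2) * \<nu> powr - (3 / 2)" using M by (simp add: mult_left_mono)
  have "norm (cpow \<nu> (- (s / 2))) = \<nu> powr - (Re s / 2)" using \<nu> by (simp add: norm_cpow)
  also have "\<dots> \<le> \<nu> powr ((1 - \<delta>) / 2)" using \<nu> s(2) by (intro powr_mono) auto
  finally have c: "norm (cpow \<nu> (- (s / 2))) \<le> \<nu> powr ((1 - \<delta>) / 2)" .
  have "norm (cone_remainder e \<nu> s) \<le> \<nu> powr ((1 - \<delta>) / 2) * ((exp M * M ^ 3 + 2 * M + 2 * M\<^sup>2) * \<nu> powr - (3 / 2))"
    unfolding cone_remainder_def norm_mult y_def[symmetric] z_def[symmetric]
    by (rule mult_mono[OF c b]) auto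
  also have "\<dots> = (exp M * M ^ 3 + 2 * M + 2 * M\<^sup>2) * (\<nu> powr ((1 - \<delta>) / 2) * \<nu> powr - (3 / 2))"
    by (simp add: mult_ac)
  also have "\<nu> powr ((1 - \<delta>) / 2) * \<nu> powr - (3 / 2) = \<nu> powr - (1 + \<delta> / 2)"
    by (simp add: diff_divide_distrib flip: powr_add)
  finally show ?thesis .
qed

definition cone_correction :: "real \<Rightarrow> complex \<Rightarrow> complex" where
  "cone_correction e s = (\<Sum>\<^sub>\<infinity>k\<in>- {0}. cone_remainder e (norm_sq k) s)"

lemma cone_remainder_holomorphic: "cone_remainder e \<nu> holomorphic_on S"
  unfolding cone_remainder_def[abs_def] cpow_def divide_inverse by (intro holomorphic_intros)

lemma cone_correction_locally_bounded:
  assumes e: "e = 1 \<or> e = (- 1 :: real)" and z: "- 1 < Re z"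
  shows "\<exists>d>0. \<exists>B. cball z d \<subseteq> {s. - 1 < Re s} \<and> B summable_on (- {0}) \<and>
       (\<forall>k\<in>- {0}. \<forall>w\<in>cball z d. norm (cone_remainder e (norm_sq k) w) \<le> B k)"
proof -
  define d where "d = (Re z + 1) / 2"
  define M where "M = norm z + d"
  define C where "C = exp M * M ^ 3 + 2 * M + 2 * M\<^sup>2"
  have d: "d > 0" using z by (simp add: d_def)
  have w: "norm w \<le> M \<and> d - 1 \<le> Re w" if "w \<in> cball z d" for w
  proof -
    have le: "norm (z - w) \<le> d" using that by (simp add: dist_norm)
    have "norm w \<le> norm z + norm (z - w)" using norm_triangle_ineq4[of z "z - w"] by simp
    moreover have "\<bar>Re (z - w)\<bar> \<le> d" using abs_Re_le_cmod[of "z - w"] le by linarith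
    moreover have "Re z = 2 * d - 1" by (simp add: d_def field_simps)
    ultimately show ?thesis using le unfolding M_def minus_complex.sel by linarith
  qed
  show ?thesis
  proof (intro exI[of _ d] conjI exI[of _ "\<lambda>k. C * norm_sq k powr - (1 + d / 2)"] ballI)
    show "cball z d \<subseteq> {s. - 1 < Re s}" using w d by fastforce
    show "(\<lambda>k. C * norm_sq k powr - (1 + d / 2)) summable_on - {0}"
      using d by (intro summable_on_cmult_right norm_sq_powr_summable) auto
    show "norm (cone_remainder e (norm_sq k) v) \<le> C * norm_sq k powr - (1 + d / 2)"
      if "k \<in> - {0}" "v \<in> cball z d" for k v
      unfolding C_def using w[OF that(2)] that(1) by (intro cone_remainder_bound e norm_sq_ge_1) auto
  qed (use d in auto)
qed

lemma cone_correction_holomorphic: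
  assumes "e = 1 \<or> e = (- 1 :: real)"
  shows "cone_correction e holomorphic_on {s. - 1 < Re s}"
  unfolding cone_correction_def[abs_def]
  by (intro holomorphic_on_infsum cone_remainder_holomorphic)
     (use cone_correction_locally_bounded[OF assms] in blast)

lemma cone_correction_has_sum:
  assumes "e = 1 \<or> e = (- 1 :: real)" "- 1 < Re s"
  shows "((\<lambda>k. cone_remainder e (norm_sq k) s) has_sum cone_correction e s) (- {0})"
proof -
  obtain d B where d: "d > 0" and B: "B summable_on (- {0})"
    "\<And>k w. k \<in> - {0} \<Longrightarrow> w \<in> cball s d \<Longrightarrow> norm (cone_remainder e (norm_sq k) w) \<le> B k"
    using cone_correction_locally_bounded[OF assms] by blast
  have "(\<lambda>k. norm (cone_remainder e (norm_sq k) s)) summable_on - {0}"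
    by (rule summable_on_comparison_test[OF B(1)]) (use B(2) d in auto)
  from has_sum_infsum[OF abs_summable_summable[OF this]] show ?thesis
    unfolding cone_correction_def .
qed

lemma cone_correction_0: "cone_correction e 0 = 0"
  unfolding cone_correction_def by (rule infsum_0) (simp add: cone_remainder_def)

text \<open>
  The factor \<open>s\<^sup>2 / 8\<close> in front of \<open>Z(s / 2 + 1)\<close> cancels the pole of \<open>Z\<close> at 1, which lies at
  \<open>s = 0\<close>: what remains is \<open>s W(s / 2 + 1) / 4\<close>.
\<close>
definition cone_zeta :: "(complex \<Rightarrow> complex) \<Rightarrow> real \<Rightarrow> complex \<Rightarrow> complex" where
  "cone_zeta W e s = W (s / 2) / (s / 2 - 1) - of_real e * s / 2 * (W ((s + 1) / 2) / ((s + 1) / 2 - 1))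
     + s / 4 * W (s / 2 + 1) + cone_correction e s"

lemma cone_zeta_has_sum:
  assumes W: "entire_epstein W" and e: "e = 1 \<or> e = (- 1 :: real)" and s: "2 < Re s"
  shows "((\<lambda>k. complex_of_real (sqrt (norm_sq k + 1 / 4) + e / 2) powr (- s)) has_sum cone_zeta W e s) (- {0})"
proof -
  have s0: "s \<noteq> 0" using s by auto
  have Ws: "((\<lambda>k. cpow (norm_sq k) (- w)) has_sum W w / (w - 1)) (- {0})" if "1 < Re w" for w
    using W that by (simp add: entire_epstein_def)
  have a: "((\<lambda>k. cpow (norm_sq k) (- (s / 2))) has_sum W (s / 2) / (s / 2 - 1)) (- {0})"
    using s by (intro Ws) simp
  have b: "((\<lambda>k. - (of_real e * s / 2) * cpow (norm_sq k) (- ((s + 1) / 2))) has_sum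
      - (of_real e * s / 2) * (W ((s + 1) / 2) / ((s + 1) / 2 - 1))) (- {0})"
    using s by (intro has_sum_cmult_right Ws) simp
  have c: "((\<lambda>k. s\<^sup>2 / 8 * cpow (norm_sq k) (- (s / 2 + 1))) has_sum
      s\<^sup>2 / 8 * (W (s / 2 + 1) / (s / 2 + 1 - 1))) (- {0})"
    using s by (intro has_sum_cmult_right Ws) simp
  have r: "((\<lambda>k. cone_remainder e (norm_sq k) s) has_sum cone_correction e s) (- {0})"
    using s by (intro cone_correction_has_sum e) simp
  have "((\<lambda>k. cpow (norm_sq k) (- (s / 2)) + - (of_real e * s / 2) * cpow (norm_sq k) (- ((s + 1) / 2))
      + s\<^sup>2 / 8 * cpow (norm_sq k) (- (s / 2 + 1)) + cone_remainder e (norm_sq k) s) has_sum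
     (W (s / 2) / (s / 2 - 1) + - (of_real e * s / 2) * (W ((s + 1) / 2) / ((s + 1) / 2 - 1))
      + s\<^sup>2 / 8 * (W (s / 2 + 1) / (s / 2 + 1 - 1)) + cone_correction e s)) (- {0})"
    by (intro has_sum_add a b c r)
  also have "?this \<longleftrightarrow> ((\<lambda>k. complex_of_real (sqrt (norm_sq k + 1 / 4) + e / 2) powr (- s)) has_sum
     (W (s / 2) / (s / 2 - 1) + - (of_real e * s / 2) * (W ((s + 1) / 2) / ((s + 1) / 2 - 1))
      + s\<^sup>2 / 8 * (W (s / 2 + 1) / (s / 2 + 1 - 1)) + cone_correction e s)) (- {0})"
  proof (rule has_sum_cong)
    fix k :: "int \<times> int" assume "k \<in> - {0}"
    define \<nu> where "\<nu> = norm_sq k"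
    have \<nu>: "\<nu> \<ge> 1" using norm_sq_ge_1[of k] \<open>k \<in> - {0}\<close> by (simp add: \<nu>_def)
    define q where "q = cpow \<nu> (- (s / 2))"
    have half: "cpow \<nu> (- (1 / 2)) = 1 / of_real (sqrt \<nu>)"
      using cpow_of_real[of \<nu> "- (1 / 2)"] \<nu> by (simp add: powr_minus_divide powr_half_sqrt)
    have one: "cpow \<nu> (- 1) = 1 / of_real \<nu>"
      using \<nu> by (simp add: cpow_uminus cpow_1 divide_inverse)
    have 1: "cpow \<nu> (- ((s + 1) / 2)) = q / of_real (sqrt \<nu>)"
      using cpow_add[of \<nu> "- (s / 2)" "- (1 / 2)"] half by (simp add: q_def add_divide_distrib)
    have 2: "cpow \<nu> (- (s / 2 + 1)) = q / of_real \<nu>"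
      using cpow_add[of \<nu> "- (s / 2)" "- 1"] one by (simp add: q_def)
    show "cpow (norm_sq k) (- (s / 2)) + - (of_real e * s / 2) * cpow (norm_sq k) (- ((s + 1) / 2))
      + s\<^sup>2 / 8 * cpow (norm_sq k) (- (s / 2 + 1)) + cone_remainder e (norm_sq k) s
      = complex_of_real (sqrt (norm_sq k + 1 / 4) + e / 2) powr (- s)"
      unfolding \<nu>_def[symmetric] powr_eq_cpow[OF \<nu> e] cone_remainder_def 1 2 q_def[symmetric]
      by (simp add: algebra_simps)
  qed
  also have "s\<^sup>2 / 8 * (W (s / 2 + 1) / (s / 2 + 1 - 1)) = s / 4 * W (s / 2 + 1)"
    using s0 by (simp add: power2_eq_square field_simps)
  finally show ?thesis by (simp add: cone_zeta_def algebra_simps)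
qed

text \<open>
  The nonzero lattice points are grouped by the value of \<open>\<bar>k\<bar>\<^sup>2\<close>.
\<close>
lemma has_sum_over_spectrum:
  fixes f :: "real \<Rightarrow> complex"
  assumes "((\<lambda>k. f (norm_sq k)) has_sum S) (- {0})"
  shows "((\<lambda>\<nu>. of_nat (coexact_mult (\<lambda>i x. x) 0 \<nu>) * f \<nu>) has_sum S) (coexact_spectrum (\<lambda>i x. x) 0)"
proof -
  define A where "A = coexact_spectrum (\<lambda>i x. x) 0"
  have A: "A = norm_sq ` (- {0})" by (simp add: A_def coexact_spectrum_trivial)
  have bij: "bij_betw snd (Sigma A frequencies) (- {0})"
    by (rule bij_betwI[where g = "\<lambda>k. (norm_sq k, k)"]) (auto simp: A frequencies_def)
  have "((\<lambda>p. f (norm_sq (snd p))) has_sum S) (Sigma A frequencies)"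
    using has_sum_reindex_bij_betw[OF bij, of "\<lambda>k. f (norm_sq k)"] assms by simp
  moreover have "((\<lambda>k. f (norm_sq (snd (\<nu>, k)))) has_sum of_nat (coexact_mult (\<lambda>i x. x) 0 \<nu>) * f \<nu>) (frequencies \<nu>)"
    for \<nu>
  proof (rule has_sum_finiteI[OF finite_frequencies])
    have "(\<Sum>k\<in>frequencies \<nu>. f (norm_sq (snd (\<nu>, k)))) = (\<Sum>k\<in>frequencies \<nu>. f \<nu>)"
      by (rule sum.cong) (auto simp: frequencies_def)
    then show "of_nat (coexact_mult (\<lambda>i x. x) 0 \<nu>) * f \<nu> = (\<Sum>k\<in>frequencies \<nu>. f (norm_sq (snd (\<nu>, k))))"
      by (simp add: coexact_mult_trivial)
  qed
  ultimately show ?thesis unfolding A_def[symmetric] by (rule has_sum_SigmaD)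
qed

lemma entire_epstein_compose:
  assumes "entire_epstein W" "g holomorphic_on S"
  shows "(\<lambda>s. W (g s)) holomorphic_on S"
  using holomorphic_on_compose_gen[OF assms(2), of W UNIV] assms(1)
  by (simp add: entire_epstein_def o_def)

lemma cone_zeta_continuation:
  assumes W: "entire_epstein W" and e: "e = 1 \<or> e = (- 1 :: real)"
  shows "cex_zeta_continuation 1 (\<lambda>i x. x) 0 (e / 2) (cone_zeta W e)"
  unfolding cex_zeta_continuation_def
proof (rule exI[of _ 2], rule exI[of _ 1], intro conjI allI impI)
  have \<mu>: "cex_mu 1 0 \<nu> = sqrt (\<nu> + 1 / 4)" for \<nu>
    by (simp add: cex_mu_def cex_alpha_def power2_eq_square)
  show "((\<lambda>\<nu>. of_nat (coexact_mult (\<lambda>i x. x) 0 \<nu>) * complex_of_real (cex_mu 1 0 \<nu> + e / 2) powr - s) has_sum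
      cone_zeta W e s) (coexact_spectrum (\<lambda>i x. x) 0)" if "2 < Re s" for s
    unfolding \<mu> by (rule has_sum_over_spectrum[OF cone_zeta_has_sum[OF W e that]])
  define H where "H = {s. - 1 < Re s}"
  have H: "open H" by (simp add: H_def open_halfspace_Re_gt)
  have an: "f analytic_on H" if "f holomorphic_on H" for f
    using that H by (simp add: analytic_on_open)
  have w: "(\<lambda>s. W (s / 2)) analytic_on H" "(\<lambda>s. W ((s + 1) / 2)) analytic_on H" "(\<lambda>s. W (s / 2 + 1)) analytic_on H"
    by (intro an entire_epstein_compose[OF W] holomorphic_intros; simp)+
  have c: "cone_correction e analytic_on H"
    using cone_correction_holomorphic[OF e] by (intro an) (simp add: H_def)
  show "cone_zeta W e meromorphic_on {s. - 1 < Re s}"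
    unfolding cone_zeta_def[abs_def] H_def[symmetric]
    by (intro meromorphic_intros analytic_on_imp_meromorphic_on w c) 
  have sub: "{0} \<subseteq> H" by (simp add: H_def)
  show "cone_zeta W e analytic_on {0}"
    unfolding cone_zeta_def[abs_def]
    by (intro analytic_intros analytic_on_subset[OF w(1) sub] analytic_on_subset[OF w(2) sub]
        analytic_on_subset[OF w(3) sub] analytic_on_subset[OF c sub]) auto
qed auto

section \<open>The analytic anomaly\<close>

text \<open>
  The difference of two continuations is meromorphic on a common half plane, which is
  connected, and vanishes far to the right. So it vanishes outside a sparse set, and near 0 it
  is continuous.
\<close>
lemma cex_zeta_continuation_unique:
  assumes 1: "cex_zeta_continuation p E q a Z1" and 2: "cex_zeta_continuation p E q a Z2"
  shows "\<forall>\<^sub>F s in nhds 0. Z1 s = Z2 s"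
proof -
  obtain c1 \<epsilon>1 where z1: "0 < \<epsilon>1" "\<And>s. c1 < Re s \<Longrightarrow>
      ((\<lambda>\<nu>. of_nat (coexact_mult E q \<nu>) * complex_of_real (cex_mu p q \<nu> + a) powr (- s)) has_sum Z1 s) (coexact_spectrum E q)"
      "Z1 meromorphic_on {s. - \<epsilon>1 < Re s}" "Z1 analytic_on {0}"
    using 1 unfolding cex_zeta_continuation_def by blast
  obtain c2 \<epsilon>2 where z2: "0 < \<epsilon>2" "\<And>s. c2 < Re s \<Longrightarrow>
      ((\<lambda>\<nu>. of_nat (coexact_mult E q \<nu>) * complex_of_real (cex_mu p q \<nu> + a) powr (- s)) has_sum Z2 s) (coexact_spectrum E q)"
      "Z2 meromorphic_on {s. - \<epsilon>2 < Re s}" "Z2 analytic_on {0}"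
    using 2 unfolding cex_zeta_continuation_def by blast
  define U where "U = {s. - min \<epsilon>1 \<epsilon>2 < Re s}"
  define f where "f s = Z1 s - Z2 s" for s
  have U: "open U" "connected U" "0 \<in> U"
    using z1(1) z2(1) by (auto simp: U_def open_halfspace_Re_gt convex_halfspace_Re_gt convex_connected)
  have mero: "f meromorphic_on U"
    unfolding f_def
    by (intro meromorphic_intros meromorphic_on_subset[OF z1(3)] meromorphic_on_subset[OF z2(3)]) (auto simp: U_def)
  have zero: "f s = 0" if "max c1 c2 < Re s" for s
    using has_sum_unique[OF z1(2) z2(2), of s] that by (simp add: f_def)
  \<comment> \<open>a point where both series converge and which lies in \<open>U\<close>\<close>
  define s0 where "s0 = complex_of_real (max 0 (max c1 c2) + 1)"
  have s0: "s0 \<in> U" using z1(1) z2(1) by (auto simp: U_def s0_def)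
  have "\<not> (\<forall>\<^sub>\<approx>z\<in>U. f z \<noteq> 0)"
  proof
    assume "\<forall>\<^sub>\<approx>z\<in>U. f z \<noteq> 0"
    then have "\<forall>\<^sub>F z in at s0. f z \<noteq> 0" by (rule eventually_cosparse_imp_eventually_at) (rule s0)
    moreover have "\<forall>\<^sub>F z in at s0. z \<in> {s. max c1 c2 < Re s}"
      by (rule eventually_at_in_open'[OF open_halfspace_Re_gt]) (auto simp: s0_def max_def)
    ultimately have "\<forall>\<^sub>F z in at s0. False" by eventually_elim (use zero in auto)
    then show False by simp
  qed
  then have "\<forall>\<^sub>\<approx>z\<in>U. f z = 0" using meromorphic_imp_constant_or_avoid[OF mero U(1,2), of 0] by blast
  then have ev: "\<forall>\<^sub>F z in at 0. f z = 0" by (rule eventually_cosparse_imp_eventually_at) (rule U(3))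
  have "isCont f 0"
    using z1(4) z2(4) unfolding f_def by (intro continuous_diff analytic_at_imp_isCont)
  then have "(f \<longlongrightarrow> f 0) (at 0)" by (simp add: isCont_def)
  moreover have "(f \<longlongrightarrow> 0) (at 0)" using ev by (rule tendsto_eventually)
  ultimately have "f 0 = 0" using tendsto_unique[of "at (0::complex)"] by simp
  with ev have "\<forall>\<^sub>F z in nhds 0. f z = 0" by (auto simp: eventually_at_filter elim: eventually_mono)
  then show ?thesis by eventually_elim (simp add: f_def)
qed

text \<open>
  For real \<open>s\<close> in \<open>{0<..1}\<close> the two corrections differ by the sum of the terms \<open>2 (s sinh y -
  sinh (s y))\<close> times a positive power of \<open>\<nu>\<close>, which are nonnegative by convexity. The
  derivative at 0 is the limit of the quotients along \<open>s = 1 / (n + 1)\<close>, hence real and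
  nonnegative.
\<close>
lemma cone_correction_difference_derivative:
  obtains d where "((\<lambda>s. cone_correction 1 s - cone_correction (- 1) s) has_field_derivative complex_of_real d) (at 0)"
    and "0 \<le> d"
proof -
  define h where "h s = cone_correction 1 s - cone_correction (- 1) s" for s
  have "h holomorphic_on {s. - 1 < Re s}"
    unfolding h_def by (intro holomorphic_intros cone_correction_holomorphic) auto
  then obtain d where d: "(h has_field_derivative d) (at 0)"
    using holomorphic_on_imp_differentiable_at[of h "{s. - 1 < Re s}" 0]
    by (auto simp: open_halfspace_Re_gt field_differentiable_def)
  have h0: "h 0 = 0" by (simp add: h_def cone_correction_0)
  have real: "Im (h (of_real s)) = 0 \<and> 0 \<le> Re (h (of_real s))" if s: "0 < s" "s \<le> 1" for s
  proof -
    have "((\<lambda>k. cone_remainder 1 (norm_sq k) (of_real s) + (- 1) * cone_remainder (- 1) (norm_sq k) (of_real s))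
        has_sum (cone_correction 1 (of_real s) + (- 1) * cone_correction (- 1) (of_real s))) (- {0})"
      using s by (intro has_sum_add has_sum_cmult_right cone_correction_has_sum) auto
    then have sum: "((\<lambda>k. cone_remainder 1 (norm_sq k) (of_real s) - cone_remainder (- 1) (norm_sq k) (of_real s))
        has_sum h (of_real s)) (- {0})"
      by (simp add: h_def)
    have nonneg_term: "\<exists>r\<ge>0. cone_remainder 1 (norm_sq k) (of_real s) - cone_remainder (- 1) (norm_sq k) (of_real s) = complex_of_real r"
      if "k \<in> - {0}" for k
    proof -
      define \<nu> where "\<nu> = norm_sq k"
      define y where "y = hyp_angle \<nu>"
      have \<nu>: "\<nu> \<ge> 1" using norm_sq_ge_1[of k] that by (simp add: \<nu>_def)
      have y: "0 \<le> y" "sinh y = 1 / (2 * sqrt \<nu>)" using hyp_angle[OF \<nu>] by (auto simp: y_def)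
      have cp: "cpow \<nu> (- (of_real s / 2)) = of_real (\<nu> powr - (s / 2))"
        using cpow_of_real[of \<nu> "- (s / 2)"] \<nu> by simp
      have "cone_remainder 1 \<nu> (of_real s) - cone_remainder (- 1) \<nu> (of_real s)
          = of_real (\<nu> powr - (s / 2)) * (exp (- of_real (y * s)) - exp (of_real (y * s)) + 2 * (of_real s / of_real (2 * sqrt \<nu>)))"
        unfolding cone_remainder_def cp y_def[symmetric] by (simp add: algebra_simps)
      also have "\<dots> = of_real (\<nu> powr - (s / 2) * (exp (- (y * s)) - exp (y * s) + 2 * (s * (1 / (2 * sqrt \<nu>)))))"
        by (simp flip: exp_of_real)
      also have "exp (- (y * s)) - exp (y * s) + 2 * (s * (1 / (2 * sqrt \<nu>))) = 2 * (s * sinh y - sinh (s * y))"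
        unfolding y(2)[symmetric] by (simp add: sinh_field_def[of "s * y"] field_simps mult.commute)
      finally have eq: "cone_remainder 1 \<nu> (of_real s) - cone_remainder (- 1) \<nu> (of_real s)
          = of_real (\<nu> powr - (s / 2) * (2 * (s * sinh y - sinh (s * y))))" .
      have "0 \<le> \<nu> powr - (s / 2) * (2 * (s * sinh y - sinh (s * y)))"
        using sinh_convex[OF y(1), of s] s by simp
      with eq show ?thesis unfolding \<nu>_def by blast
    qed
    have "0 \<le> Re (h (of_real s))"
    proof (rule has_sum_nonneg[OF has_sum_Re[OF sum]])
      fix k :: "int \<times> int" assume "k \<in> - {0}"
      from nonneg_term[OF this] show "0 \<le> Re (cone_remainder 1 (norm_sq k) (of_real s) - cone_remainder (- 1) (norm_sq k) (of_real s))"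
        by (metis Re_complex_of_real)
    qed
    moreover have "Im (h (of_real s)) = 0"
    proof (rule has_sum_unique[OF has_sum_Im[OF sum]])
      show "((\<lambda>k. Im (cone_remainder 1 (norm_sq k) (of_real s) - cone_remainder (- 1) (norm_sq k) (of_real s))) has_sum 0) (- {0})"
        by (rule has_sum_0) (metis nonneg_term Im_complex_of_real)
    qed
    ultimately show ?thesis by simp
  qed
  define t where "t n = 1 / real (Suc n)" for n
  have t: "0 < t n" "t n \<le> 1" for n by (simp_all add: t_def)
  have "t \<longlonglongrightarrow> 0" unfolding t_def by (rule LIMSEQ_Suc_n_over_n[THEN LIMSEQ_ignore_initial_segment] lim_1_over_n LIMSEQ_inverse_real_of_nat[unfolded inverse_eq_divide])+
  then have "(\<lambda>n. complex_of_real (t n)) \<longlonglongrightarrow> 0" using tendsto_of_real[of t 0 sequentially] by simp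
  then have flt: "filterlim (\<lambda>n. complex_of_real (t n)) (at 0) sequentially"
    by (rule filterlim_atI) (use t in \<open>auto simp: less_imp_neq[THEN not_sym]\<close>)
  have "((\<lambda>s. (h s - h 0) / (s - 0)) \<longlongrightarrow> d) (at 0)"
    using d by (simp add: has_field_derivative_iff)
  then have "((\<lambda>s. h s / s) \<longlongrightarrow> d) (at 0)" by (simp add: h0)
  from filterlim_compose[OF this flt] have lim: "(\<lambda>n. h (of_real (t n)) / of_real (t n)) \<longlonglongrightarrow> d" .
  have re: "0 \<le> Re (h (of_real (t n)) / of_real (t n))" and im: "Im (h (of_real (t n)) / of_real (t n)) = 0" for n
    using real[OF t] t[of n] by simp_all
  have "0 \<le> Re d" using LIMSEQ_le_const[OF tendsto_Re[OF lim], of 0] re by auto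
  have "Im d = 0" using tendsto_Im[OF lim] unfolding im by (simp add: LIMSEQ_const_iff)
  then have "d = complex_of_real (Re d)" by (simp add: complex_eq_iff)
  with d \<open>0 \<le> Re d\<close> show thesis using that[of "Re d"] by (simp add: h_def[abs_def])
qed

text \<open>
  In the difference of the two zeta functions the even terms of the expansion cancel, and
  there remains \<open>- s Z((s + 1) / 2)\<close>, whose derivative at 0 is \<open>- Z(1/2) = 2 W(1/2)\<close>, plus the
  difference of the corrections.
\<close>
lemma cex_log_sum_bound:
  assumes W: "entire_epstein W" and r: "W (1 / 2) = complex_of_real r"
  shows "2 * r \<le> cex_log_sum 1 (\<lambda>i x. x) 0"
proof -
  obtain d where d: "((\<lambda>s. cone_correction 1 s - cone_correction (- 1) s) has_field_derivative complex_of_real d) (at 0)"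
    "0 \<le> d" by (rule cone_correction_difference_derivative)
  define g where "g s = - (W ((s + 1) / 2) / ((s + 1) / 2 - 1))" for s
  have "(\<lambda>s. W ((s + 1) / 2)) holomorphic_on UNIV"
    by (intro entire_epstein_compose[OF W] holomorphic_intros) auto
  then have "(\<lambda>s. W ((s + 1) / 2)) field_differentiable at 0"
    by (intro holomorphic_on_imp_differentiable_at) auto
  then have "g field_differentiable at 0"
    unfolding g_def by (intro derivative_intros) auto
  then obtain g' where g': "(g has_field_derivative g') (at 0)" by (auto simp: field_differentiable_def)
  have "((\<lambda>s. s * g s) has_field_derivative g 0) (at 0)"
    using DERIV_mult[OF DERIV_ident g'] by simp
  from DERIV_add[OF this d(1)]
  have "((\<lambda>s. s * g s + (cone_correction 1 s - cone_correction (- 1) s)) has_field_derivative g 0 + of_real d) (at 0)" .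
  moreover have "(\<lambda>s. s * g s + (cone_correction 1 s - cone_correction (- 1) s)) = (\<lambda>s. cone_zeta W 1 s - cone_zeta W (- 1) s)"
  proof
    fix s
    have cz: "cone_zeta W e s = W (s / 2) / (s / 2 - 1) + of_real e * s / 2 * g s + s / 4 * W (s / 2 + 1) + cone_correction e s" for e
      unfolding cone_zeta_def g_def by (simp only: mult_minus_right add_uminus_conv_diff)
    have "s * g s = s / 2 * g s + s / 2 * g s" by (simp add: field_simps)
    then show "s * g s + (cone_correction 1 s - cone_correction (- 1) s) = cone_zeta W 1 s - cone_zeta W (- 1) s"
      unfolding cz by simp
  qed
  moreover have "g 0 = of_real (2 * r)" by (simp add: g_def r)
  ultimately have der: "((\<lambda>s. cone_zeta W 1 s - cone_zeta W (- 1) s) has_field_derivative of_real (2 * r + d)) (at 0)"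
    by simp
  have "- cex_alpha 1 0 = 1 / 2" "cex_alpha 1 0 = - 1 / 2" by (simp_all add: cex_alpha_def)
  then have cont: "cex_zeta_continuation 1 (\<lambda>i x. x) 0 (- cex_alpha 1 0) (cone_zeta W 1)"
    "cex_zeta_continuation 1 (\<lambda>i x. x) 0 (cex_alpha 1 0) (cone_zeta W (- 1))"
    using cone_zeta_continuation[OF W, of 1] cone_zeta_continuation[OF W, of "- 1"] by (simp_all only: simp_thms)
  have "cex_log_sum 1 (\<lambda>i x. x) 0 = 2 * r + d"
    unfolding cex_log_sum_def
  proof (rule the_equality)
    show "\<exists>Zm Zp. cex_zeta_continuation 1 (\<lambda>i x. x) 0 (- cex_alpha 1 0) Zm \<and>
        cex_zeta_continuation 1 (\<lambda>i x. x) 0 (cex_alpha 1 0) Zp \<and>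
        ((\<lambda>s. Zm s - Zp s) has_field_derivative complex_of_real (2 * r + d)) (at 0)"
      using cont der by blast
    fix D
    assume "\<exists>Zm Zp. cex_zeta_continuation 1 (\<lambda>i x. x) 0 (- cex_alpha 1 0) Zm \<and>
        cex_zeta_continuation 1 (\<lambda>i x. x) 0 (cex_alpha 1 0) Zp \<and>
        ((\<lambda>s. Zm s - Zp s) has_field_derivative complex_of_real D) (at 0)"
    then obtain Zm Zp where Z: "cex_zeta_continuation 1 (\<lambda>i x. x) 0 (- cex_alpha 1 0) Zm"
      "cex_zeta_continuation 1 (\<lambda>i x. x) 0 (cex_alpha 1 0) Zp"
      "((\<lambda>s. Zm s - Zp s) has_field_derivative complex_of_real D) (at 0)" by blast
    have "\<forall>\<^sub>F s in nhds 0. Zm s - Zp s = cone_zeta W 1 s - cone_zeta W (- 1) s"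
      using cex_zeta_continuation_unique[OF Z(1) cont(1)] cex_zeta_continuation_unique[OF Z(2) cont(2)]
      by eventually_elim simp
    then have "((\<lambda>s. cone_zeta W 1 s - cone_zeta W (- 1) s) has_field_derivative complex_of_real D) (at 0)"
      by (rule iffD1[OF DERIV_cong_ev[OF refl _ refl] Z(3)])
    from DERIV_unique[OF this der] show "D = 2 * r + d" by (simp only: of_real_eq_iff)
  qed
  then show ?thesis using d(2) by simp
qed

lemma anomaly_positive:
  assumes h: "\<And>q. q \<le> 1 \<Longrightarrow> harmonic_onb (\<lambda>i x. x) q (h q)"
    and n: "\<And>q. q \<le> 1 \<Longrightarrow> integral_basis q (n q)"
  shows "0 < A_comb 1 (\<lambda>i x. x) h n + A_analy 1 (\<lambda>i x. x)"
proof -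
  obtain W r where W: "entire_epstein W" and r: "W (1 / 2) = complex_of_real r" "ln (2 * pi) < r"
    by (rule epstein_continuation)
  from cex_log_sum_bound[OF W r(1)] have "r \<le> A_analy 1 (\<lambda>i x. x)"
    unfolding A_analy_trivial by simp
  moreover have "A_comb 1 (\<lambda>i x. x) h n = - ln (2 * pi)"
    by (rule A_comb_trivial[OF harmonic_forms_trivial h n])
  ultimately show ?thesis using r(2) by simp
qed

theorem proposition5p1:
  fixes X M :: "'a::t2_space set"
    and A :: "'a chart set"
    and G :: "'a metric_tensor"
    and l :: real
    and \<kappa> :: "real \<times> complex \<times> complex \<Rightarrow> 'a"
    and \<rho> :: "(real \<Rightarrow> 'a) \<Rightarrow> real \<Rightarrow> real"
    and h :: "nat \<Rightarrow> form list"
    and n :: "nat \<Rightarrow> (nat set \<Rightarrow> int) list"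
  defines "E \<equiv> restricted_bundle \<kappa> l \<rho>"
  assumes "conical_pseudomanifold X M A G l \<kappa>"
    and "orthogonal_representation X (\<kappa> (l, 1, 1)) \<rho>"
    and "\<And>q. q \<le> 1 \<Longrightarrow> harmonic_onb E q (h q)"
    and "\<And>q. q \<le> 1 \<Longrightarrow> integral_basis q (n q)"
  shows "A_comb 1 E h n + A_analy 1 E \<noteq> 0"
proof -
  have E: "E = (\<lambda>i x. x)"
    unfolding E_def by (rule restricted_bundle_trivial[OF assms(2,3)])
  show ?thesis
    using anomaly_positive[of h n] assms(4,5) unfolding E by simp
qed

end
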